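(* Fix $\gamma>-1$. (a) The operator $(I_0^Hx^{2+2\gamma})^*\colon L^2_+(\mathcal G_H,\mu_H^{-2\gamma}d\beta\,da)\to L^2(\mathbb D_H,x^{2\gamma+3}dV_H)$ has kernel $$\ker(I_0^Hx^{2+2\gamma})^*=\overline{\mathrm{span}}\{\psi^{\gamma,H}_{n,k}:\ n\ge0,\ k<0\text{ or }k>n\}.$$ (b) The singular value decomposition of $I_0^Hx^{2+2\gamma}\colon L^2(\mathbb D_H,x^{2\gamma+3}dV_H)\to L^2_+(\mathcal G_H,\mu_H^{-2\gamma}d\beta\,da)/\ker(I_0^Hx^{2+2\gamma})^*$ is given by $\big(\widehat{\Phi^*Z^\gamma_{n,k}},\ \psi^{\gamma,H}_{n,k},\ \sigma^\gamma_{n,k}\big)_{n\ge0,\,0\le k\le n}$, where $\widehat{\Phi^*Z^\gamma_{n,k}}$ is $\Phi^*Z^\gamma_{n,k}$ normalized in $L^2(\mathbb D_H,x^{2\gamma+3}dV_H)$ and $\sigma^\gamma_{n,k}>0$ satisfies $$(\sigma^\gamma_{n,k})^2=\frac{2^{2\gamma+2}\pi}{n+1}\,\frac{B(n-k+1+\gamma,\,k+1+\gamma)}{B(n-k+1,\,k+1)},$$ with $B(x,y)=\Gamma(x)\Gamma(y)/\Gamma(x+y)$ the Beta function.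
   Context: Hyperbolic side: $\mathbb D_H=\{|z|\le1\}$, interior with Poincaré metric $g_H=c^{-2}|dz|^2$, $c=(1-|z|^2)/2$, volume $dV_H$, $x=\frac{1-|z|^2}{1+|z|^2}$; $\mathcal G_H=\mathbb S^1_\beta\times\mathbb R_a$, $\gamma_{\beta,a}(t)=e^{i\beta}\frac{(2+ia)\tanh(t/2)+ia}{ia\tanh(t/2)-2+ia}$, $I_0^Hf(\beta,a)=\int_{\mathbb R}f(\gamma_{\beta,a}(t))dt$, $\mu_H(a)=(1+a^2)^{-1/2}$, $\mathcal S^H_A(\beta,a)=(\beta+\pi+2\tan^{-1}a,-a)$, and $L^2_+(\mathcal G_H,\mu_H^{-2\gamma}d\beta da)$ is the subspace of $\mathcal S^H_A$-invariant functions in $L^2(\mathcal G_H,\mu_H^{-2\gamma}d\beta da)$. The operator $I_0^Hx^{2+2\gamma}$ is bounded between these spaces. Euclidean side: $\mathbb D_E=\{|z|\le1\}$ with Euclidean volume $dV_E$, $\partial_+S\mathbb D_E=\mathbb S^1_\beta\times[-\pi/2,\pi/2]_\alpha$ (point $e^{i\beta}$, direction $e^{i(\beta+\pi+\alpha)}$), $\mu(\beta,\alpha)=\cos\alpha$. For a function $h$ on $\partial_+S\mathbb D_E$ define the Euclidean backprojection $(I_0^E)^\sharp h(z)=\int_0^{2\pi}h(\beta(z,\theta),\alpha(z,\theta))\,d\theta$, where $(\beta(z,\theta),\alpha(z,\theta))$ is the point of $\partial_+S\mathbb D_E$ from which the oriented line through $z$ with direction $e^{i\theta}$ enters the disk (so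 $\theta\equiv\beta+\pi+\alpha$). Let $p_n^\gamma$ be the degree-$n$ polynomial on $[-1,1]$, a multiple of the Jacobi polynomial $P_n^{(\gamma+1/2,\gamma+1/2)}$, normalized by $\int_{-1}^1(p_n^\gamma(y))^2(1-y^2)^{\gamma+1/2}dy=(2\pi)^{-1}$. Set $\psi^\gamma_{n,k}(\beta,\alpha)=(\cos\alpha)^{2\gamma+1}e^{i(n-2k)(\beta+\alpha+\pi/2)}p_n^\gamma(\sin\alpha)$, $Z^\gamma_{n,k}=(I_0^E)^\sharp(\mu^{-2\gamma-1}\psi^\gamma_{n,k})$ ($n\ge0$, $0\le k\le n$), and $\psi^{\gamma,H}_{n,k}(\beta,a)=\mu_H(a)\,\psi^\gamma_{n,k}(\beta,\tan^{-1}a)$ ($n\ge0$, $k\in\mathbb Z$). Finally $\Phi\colon\mathbb D_H\to\mathbb D_E$, $\Phi(z)=\frac{2z}{1+|z|^2}$. *)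

theory Defs
  imports "HOL-Analysis.Analysis"
begin

section \<open>Generic weighted L2 notions (functions, not classes; everything up to a.e.)\<close>

definition L2 :: "'a measure \<Rightarrow> ('a \<Rightarrow> complex) set" where
  "L2 M = {f \<in> borel_measurable M. integrable M (\<lambda>x. (cmod (f x))\<^sup>2)}"

definition L2inner :: "'a measure \<Rightarrow> ('a \<Rightarrow> complex) \<Rightarrow> ('a \<Rightarrow> complex) \<Rightarrow> complex" where
  "L2inner M f g = (LINT x|M. f x * cnj (g x))"

definition L2norm :: "'a measure \<Rightarrow> ('a \<Rightarrow> complex) \<Rightarrow> real" where
  "L2norm M f = sqrt (LINT x|M. (cmod (f x))\<^sup>2)"

definition lin_combs :: "('a \<Rightarrow> complex) set \<Rightarrow> ('a \<Rightarrow> complex) set" where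
  "lin_combs S = {(\<lambda>x. \<Sum>f\<in>F. c f * f x) | F c. finite F \<and> F \<subseteq> S}"

definition cl_span :: "'a measure \<Rightarrow> ('a \<Rightarrow> complex) set \<Rightarrow> ('a \<Rightarrow> complex) set \<Rightarrow> ('a \<Rightarrow> complex) set" where
  "cl_span M V S = {g \<in> V. \<forall>e>0. \<exists>h\<in>lin_combs S. L2norm M (\<lambda>x. g x - h x) < e}"

definition xH :: "complex \<Rightarrow> real" where
  "xH z = (1 - (cmod z)\<^sup>2) / (1 + (cmod z)\<^sup>2)"

definition cH :: "complex \<Rightarrow> real" where
  "cH z = (1 - (cmod z)\<^sup>2) / 2"

definition muH :: "real \<Rightarrow> real" where
  "muH a = 1 / sqrt (1 + a\<^sup>2)"

text \<open>L2(D_H, x^(2 gamma+3) dV_H), dV_H = c^(-2) dLebesgue on the open unit disk\<close>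
definition D_meas :: "real \<Rightarrow> complex measure" where
  "D_meas \<gamma> = density lborel
     (\<lambda>z. ennreal (indicator (ball 0 1) z * xH z powr (2*\<gamma>+3) / (cH z)\<^sup>2))"

text \<open>G_H = S^1 x R; a point is encoded as (e^(i beta), a) :: complex \<times> real.
  Measure mu_H^(-2 gamma) d beta da, beta ranging over [0, 2 pi].\<close>
definition G_meas :: "real \<Rightarrow> (complex \<times> real) measure" where
  "G_meas \<gamma> = distr
     (density (lborel :: (real \<times> real) measure)
        (\<lambda>(b, a). ennreal (indicator {0..2*pi} b * muH a powr (-2*\<gamma>))))
     borel (\<lambda>(b, a). (cis b, a))"

text \<open>gamma_{beta,a}(t), with w = e^(i beta)\<close>
definition geodH :: "complex \<Rightarrow> real \<Rightarrow> real \<Rightarrow> complex" where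
  "geodH w a t = w * (((2 + \<i> * of_real a) * of_real (tanh (t/2)) + \<i> * of_real a) /
                      (\<i> * of_real a * of_real (tanh (t/2)) - 2 + \<i> * of_real a))"

definition IH :: "real \<Rightarrow> (complex \<Rightarrow> complex) \<Rightarrow> (complex \<times> real \<Rightarrow> complex)" where
  "IH \<gamma> f = (\<lambda>(w, a). LINT t|lborel. of_real (xH (geodH w a t) powr (2+2*\<gamma>)) * f (geodH w a t))"

definition SAH :: "complex \<times> real \<Rightarrow> complex \<times> real" where
  "SAH p = (fst p * cis (pi + 2 * arctan (snd p)), - snd p)"

definition L2plus :: "real \<Rightarrow> (complex \<times> real \<Rightarrow> complex) set" where
  "L2plus \<gamma> = {g \<in> L2 (G_meas \<gamma>). AE p in G_meas \<gamma>. g (SAH p) = g p}"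

definition adjH :: "real \<Rightarrow> (complex \<times> real \<Rightarrow> complex) \<Rightarrow> (complex \<Rightarrow> complex) \<Rightarrow> bool" where
  "adjH \<gamma> g h \<longleftrightarrow> h \<in> L2 (D_meas \<gamma>) \<and>
     (\<forall>f \<in> L2 (D_meas \<gamma>). L2inner (G_meas \<gamma>) (IH \<gamma> f) g = L2inner (D_meas \<gamma>) f h)"

definition kerAdjH :: "real \<Rightarrow> (complex \<times> real \<Rightarrow> complex) set" where
  "kerAdjH \<gamma> = {g \<in> L2plus \<gamma>. adjH \<gamma> g (\<lambda>_. 0)}"

definition jacobiP :: "real \<Rightarrow> real \<Rightarrow> nat \<Rightarrow> real \<Rightarrow> real" where
  "jacobiP al be n y = (\<Sum>s=0..n. ((of_nat n + al) gchoose (n - s)) * ((of_nat n + be) gchoose s)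
                         * ((y - 1)/2)^s * ((y + 1)/2)^(n - s))"

definition pJ :: "real \<Rightarrow> nat \<Rightarrow> real \<Rightarrow> real" where
  "pJ \<gamma> n y = jacobiP (\<gamma>+1/2) (\<gamma>+1/2) n y /
     sqrt (2*pi * (LBINT u=-1..1. (jacobiP (\<gamma>+1/2) (\<gamma>+1/2) n u)\<^sup>2 * (1 - u\<^sup>2) powr (\<gamma>+1/2)))"

text \<open>mu(beta,alpha) = cos alpha on the inward boundary \<partial>_+ S D_E\<close>
definition muE :: "real \<times> real \<Rightarrow> real" where
  "muE p = cos (snd p)"

definition psiE :: "real \<Rightarrow> nat \<Rightarrow> int \<Rightarrow> real \<times> real \<Rightarrow> complex" where
  "psiE \<gamma> n k p = of_real (cos (snd p) powr (2*\<gamma>+1))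
      * cis (of_int (int n - 2*k) * (fst p + snd p + pi/2)) * of_real (pJ \<gamma> n (sin (snd p)))"

text \<open>entry point (beta(z,theta), alpha(z,theta)) of the oriented line through z with direction
  e^(i theta): alpha = arcsin (Im (z e^(-i theta))), beta = theta - pi - alpha\<close>
definition alpha_in :: "complex \<Rightarrow> real \<Rightarrow> real" where
  "alpha_in z \<theta> = arcsin (Im (z * cis (- \<theta>)))"

definition beta_in :: "complex \<Rightarrow> real \<Rightarrow> real" where
  "beta_in z \<theta> = \<theta> - pi - alpha_in z \<theta>"

definition backprojE :: "(real \<times> real \<Rightarrow> complex) \<Rightarrow> complex \<Rightarrow> complex" where
  "backprojE h z = (LINT \<theta>:{0..2*pi}|lborel. h (beta_in z \<theta>, alpha_in z \<theta>))"

definition ZE :: "real \<Rightarrow> nat \<Rightarrow> int \<Rightarrow> complex \<Rightarrow> complex" where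
  "ZE \<gamma> n k = backprojE (\<lambda>p. of_real (muE p powr (-2*\<gamma>-1)) * psiE \<gamma> n k p)"

definition psiH :: "real \<Rightarrow> nat \<Rightarrow> int \<Rightarrow> complex \<times> real \<Rightarrow> complex" where
  "psiH \<gamma> n k q = of_real (muH (snd q)) * psiE \<gamma> n k (Arg (fst q), arctan (snd q))"

definition Phi :: "complex \<Rightarrow> complex" where
  "Phi z = 2 * z / of_real (1 + (cmod z)\<^sup>2)"

definition PhiZ :: "real \<Rightarrow> nat \<Rightarrow> int \<Rightarrow> complex \<Rightarrow> complex" where
  "PhiZ \<gamma> n k z = ZE \<gamma> n k (Phi z)"

definition uhat :: "real \<Rightarrow> nat \<Rightarrow> int \<Rightarrow> complex \<Rightarrow> complex" where
  "uhat \<gamma> n k z = PhiZ \<gamma> n k z / of_real (L2norm (D_meas \<gamma>) (PhiZ \<gamma> n k))"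

definition sigma_sq :: "real \<Rightarrow> nat \<Rightarrow> int \<Rightarrow> real" where
  "sigma_sq \<gamma> n k = 2 powr (2*\<gamma>+2) * pi / (real n + 1) *
     (Beta (real n - of_int k + 1 + \<gamma>) (of_int k + 1 + \<gamma>) / Beta (real n - of_int k + 1) (of_int k + 1))"

end

theory Submission
  imports Defs
begin

text \<open>
  The map \<open>Phi\<close> passes to the Klein model, where geodesics become chords of the unit disk and
  \<open>x\<^sup>2 = 1 - |z|\<^sup>2\<close>. After removing a power of \<open>muH\<close> and passing to the coordinates
  \<open>v = e^(i(\<beta> + arctan a))\<close>, \<open>y = sin (arctan a)\<close>, the operator becomes the Euclidean X-ray transform
  \<open>KE\<close> with weight \<open>(1 - |z|\<^sup>2) powr \<gamma>\<close>, and Santalo's formula identifies its adjoint as a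
  backprojection.

  The functions \<open>(i v)^m p_n(y)\<close> form an orthonormal basis on the boundary side, and those
  with \<open>m - n\<close> even span the functions invariant under the scattering relation. The backprojection
  of \<open>(i v)^(n - 2k) p_n(y)\<close> vanishes unless \<open>0 \<le> k \<le> n\<close>, in which case it is a nonzero multiple of
  \<open>z^(n-k) cnj z^k\<close> plus terms of lower degree. Since \<open>KE\<close> maps polynomials of degree \<open>N\<close> in \<open>z, cnj z\<close>
  to polynomials of degree at most \<open>N\<close> in \<open>y\<close> with coefficients depending on \<open>v\<close>, orthogonality of the Gegenbauer
  polynomials \<open>p_n\<close> makes the backprojections orthogonal. Their norms only involve the leading
  coefficient of the transform of \<open>z^(n-k) cnj z^k\<close>, which is a Beta integral.
\<close>

section \<open>Square-integrable functions\<close>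

text \<open>All exponents come from one identity: the point at relative position u on a chord at
  distance y from the origin satisfies 1 - |z|^2 = (1 - y^2)(1 - u^2), and \<open>muH a\<close> is
  the half length of the chord. Hence x^(2 + 2 gamma) dt splits into muH^(2 gamma + 2) and (1 -
  u^2)^gamma du. Dividing by that power of muH is also an isometry of the boundary spaces, since -2
  gamma + 2(2 gamma + 2) = 2(gamma + 1/2) + 3 and dy = muH^3 da. The operator is recovered from its
  adjoint: the backprojections are explicit polynomials, so every coefficient of the transform of
  \<open>uhat\<close> is known, and completeness on the boundary side identifies that transform. The
  singular value is the norm of the backprojection of a unit vector; the leading coefficient of p_n
  enters it once directly and once inversely, and cancels. Elements of L2 are functions, so
  identities hold almost everywhere and closed spans are handled through finite approximants.
  Measures are compared by push-forward on nonnegative functions, where Tonelli and substitution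
  carry no integrability conditions.\<close>

lemma L2_measurable [measurable_dest]: "f \<in> L2 M \<Longrightarrow> f \<in> borel_measurable M"
  by (simp add: L2_def)

lemma L2_integrable_norm_sq: "f \<in> L2 M \<Longrightarrow> integrable M (\<lambda>x. (cmod (f x))\<^sup>2)"
  by (simp add: L2_def)

lemma L2_iff_nn_integral:
  "f \<in> L2 M \<longleftrightarrow> f \<in> borel_measurable M \<and> (\<integral>\<^sup>+x. ennreal ((cmod (f x))\<^sup>2) \<partial>M) < \<infinity>"
  by (auto simp: L2_def integrable_iff_bounded)

lemma L2_integrable_mult_norm:
  assumes "f \<in> L2 M" "g \<in> L2 M"
  shows "integrable M (\<lambda>x. cmod (f x) * cmod (g x))"
proof -
  note [measurable] = assms
  have "integrable M (\<lambda>x. (cmod (f x))\<^sup>2 + (cmod (g x))\<^sup>2)"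
    using assms by (intro Bochner_Integration.integrable_add L2_integrable_norm_sq)
  moreover have "cmod (f x) * cmod (g x) \<le> (cmod (f x))\<^sup>2 + (cmod (g x))\<^sup>2" for x
    using sum_squares_bound[of "cmod (f x)" "cmod (g x)"]
      mult_nonneg_nonneg[of "cmod (f x)" "cmod (g x)", OF norm_ge_zero norm_ge_zero] by linarith
  ultimately show ?thesis
    by - (rule Bochner_Integration.integrable_bound, auto simp: abs_mult)
qed

lemma L2_integrable_inner:
  assumes "f \<in> L2 M" "g \<in> L2 M"
  shows "integrable M (\<lambda>x. f x * cnj (g x))"
proof -
  note [measurable] = assms
  have [measurable]: "cnj \<in> borel_measurable borel"
    by (intro borel_measurable_continuous_onI continuous_intros)
  show ?thesis
    by (rule Bochner_Integration.integrable_bound[OF L2_integrable_mult_norm[OF assms]])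
      (auto simp: norm_mult)
qed

lemma L2_add:
  assumes "f \<in> L2 M" "g \<in> L2 M"
  shows "(\<lambda>x. f x + g x) \<in> L2 M"
proof -
  note [measurable] = assms
  have int: "integrable M (\<lambda>x. 2 * (cmod (f x))\<^sup>2 + 2 * (cmod (g x))\<^sup>2)"
    using assms by (intro Bochner_Integration.integrable_add integrable_mult_right L2_integrable_norm_sq)
  have bound: "(cmod (f x + g x))\<^sup>2 \<le> 2 * (cmod (f x))\<^sup>2 + 2 * (cmod (g x))\<^sup>2" for x
  proof -
    have "(cmod (f x + g x))\<^sup>2 \<le> (cmod (f x) + cmod (g x))\<^sup>2"
      by (intro power_mono norm_triangle_ineq) auto
    also have "\<dots> \<le> 2 * (cmod (f x))\<^sup>2 + 2 * (cmod (g x))\<^sup>2"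
      using sum_squares_bound[of "cmod (f x)" "cmod (g x)"] by (simp add: power2_sum)
    finally show ?thesis .
  qed
  have "integrable M (\<lambda>x. (cmod (f x + g x))\<^sup>2)"
  proof (rule Bochner_Integration.integrable_bound[OF int])
    show "AE x in M. norm ((cmod (f x + g x))\<^sup>2) \<le> norm (2 * (cmod (f x))\<^sup>2 + 2 * (cmod (g x))\<^sup>2)"
      using order_trans[OF bound abs_ge_self] by (intro AE_I2) simp
  qed measurable
  moreover have "(\<lambda>x. f x + g x) \<in> borel_measurable M" by measurable
  ultimately show ?thesis by (simp add: L2_def)
qed

lemma L2_scale: "f \<in> L2 M \<Longrightarrow> (\<lambda>x. c * f x) \<in> L2 M"
  by (auto simp: L2_def norm_mult power_mult_distrib)

lemma L2_diff: "f \<in> L2 M \<Longrightarrow> g \<in> L2 M \<Longrightarrow> (\<lambda>x. f x - g x) \<in> L2 M"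
  using L2_add[of f M "\<lambda>x. (-1) * g x"] L2_scale[of g M "-1"] by (simp only: mult_minus1 add_uminus_conv_diff)

lemma L2_zero [simp]: "(\<lambda>_. 0) \<in> L2 M"
  by (simp add: L2_def)

lemma L2_sum: "(\<And>i. i \<in> I \<Longrightarrow> f i \<in> L2 M) \<Longrightarrow> (\<lambda>x. \<Sum>i\<in>I. f i x) \<in> L2 M"
  by (induction I rule: infinite_finite_induct) (auto intro: L2_add)

lemma L2_lincomb:
  "(\<And>i. i \<in> I \<Longrightarrow> e i \<in> L2 M) \<Longrightarrow> (\<lambda>x. \<Sum>i\<in>I. c i * e i x) \<in> L2 M"
  by (intro L2_sum L2_scale)

lemma (in finite_measure) L2_bounded:
  assumes "f \<in> borel_measurable M" "AE x in M. cmod (f x) \<le> C"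
  shows "f \<in> L2 M"
proof -
  have "AE x in M. norm ((cmod (f x))\<^sup>2) \<le> C\<^sup>2"
    using assms(2) by eventually_elim (auto intro: power_mono)
  then have "integrable M (\<lambda>x. (cmod (f x))\<^sup>2)"
    using assms(1) by (intro integrable_const_bound) auto
  then show ?thesis using assms(1) by (simp add: L2_def)
qed

lemma (in finite_measure) L2_integrable:
  assumes "f \<in> L2 M"
  shows "integrable M f"
proof -
  have "(\<lambda>_. 1) \<in> L2 M" by (rule L2_bounded[where C = 1]) auto
  from L2_integrable_inner[OF assms this] show ?thesis by simp
qed

lemma L2inner_cnj: "cnj (L2inner M f g) = L2inner M g f"
  unfolding L2inner_def
  by (subst Bochner_Integration.integral_cnj[symmetric]) (simp add: mult.commute)

lemma L2inner_add_left:
  "f \<in> L2 M \<Longrightarrow> g \<in> L2 M \<Longrightarrow> h \<in> L2 M \<Longrightarrow>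
    L2inner M (\<lambda>x. f x + g x) h = L2inner M f h + L2inner M g h"
  unfolding L2inner_def
  by (subst Bochner_Integration.integral_add[symmetric])
    (auto intro!: L2_integrable_inner simp: algebra_simps)

lemma L2inner_scale_left: "L2inner M (\<lambda>x. c * f x) h = c * L2inner M f h"
  unfolding L2inner_def by (simp add: mult.assoc)

lemma L2inner_scale_right: "L2inner M f (\<lambda>x. c * g x) = cnj c * L2inner M f g"
  using arg_cong[OF L2inner_scale_left[of M c g f], of cnj] by (simp add: L2inner_cnj)

lemma L2inner_diff_left:
  "f \<in> L2 M \<Longrightarrow> g \<in> L2 M \<Longrightarrow> h \<in> L2 M \<Longrightarrow>
    L2inner M (\<lambda>x. f x - g x) h = L2inner M f h - L2inner M g h"
  using L2inner_add_left[of f M "\<lambda>x. (-1) * g x" h] L2_scale[of g M "-1"]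
    L2inner_scale_left[of M "-1" g h]
  by (simp only: mult_minus1 add_uminus_conv_diff)

lemma L2inner_diff_right:
  assumes "f \<in> L2 M" "g \<in> L2 M" "h \<in> L2 M"
  shows "L2inner M f (\<lambda>x. g x - h x) = L2inner M f g - L2inner M f h"
  using arg_cong[OF L2inner_diff_left[OF assms(2,3,1)], of cnj] by (simp add: L2inner_cnj)

lemma L2inner_add_right:
  assumes "f \<in> L2 M" "g \<in> L2 M" "h \<in> L2 M"
  shows "L2inner M f (\<lambda>x. g x + h x) = L2inner M f g + L2inner M f h"
  using arg_cong[OF L2inner_add_left[OF assms(2,3,1)], of cnj] by (simp add: L2inner_cnj)

lemma L2inner_zero [simp]: "L2inner M (\<lambda>_. 0) h = 0" "L2inner M h (\<lambda>_. 0) = 0"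
  by (auto simp: L2inner_def)

lemma L2inner_lincomb_left:
  fixes c :: "'i \<Rightarrow> complex"
  assumes "\<And>i. i \<in> I \<Longrightarrow> e i \<in> L2 M" "h \<in> L2 M"
  shows "L2inner M (\<lambda>x. \<Sum>i\<in>I. c i * e i x) h = (\<Sum>i\<in>I. c i * L2inner M (e i) h)"
  using assms
proof (induction I rule: infinite_finite_induct)
  case (insert i I)
  then show ?case
    by (simp add: L2inner_add_left L2_scale L2_lincomb L2inner_scale_left)
qed auto

lemma L2inner_lincomb_right:
  fixes c :: "'i \<Rightarrow> complex"
  assumes "\<And>i. i \<in> I \<Longrightarrow> e i \<in> L2 M" "h \<in> L2 M"
  shows "L2inner M h (\<lambda>x. \<Sum>i\<in>I. c i * e i x) = (\<Sum>i\<in>I. cnj (c i) * L2inner M h (e i))"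
proof -
  have "cnj (L2inner M (\<lambda>x. \<Sum>i\<in>I. c i * e i x) h) = cnj (\<Sum>i\<in>I. c i * L2inner M (e i) h)"
    using assms by (subst L2inner_lincomb_left) auto
  then show ?thesis by (simp add: L2inner_cnj)
qed

lemma L2inner_cong_AE:
  assumes "AE x in M. f x = f' x" "AE x in M. g x = g' x"
    "f \<in> borel_measurable M" "f' \<in> borel_measurable M"
    "g \<in> borel_measurable M" "g' \<in> borel_measurable M"
  shows "L2inner M f g = L2inner M f' g'"
proof -
  have [measurable]: "cnj \<in> borel_measurable borel"
    by (intro borel_measurable_continuous_onI continuous_intros)
  note [measurable] = assms(3-6)
  show ?thesis
    unfolding L2inner_def by (rule integral_cong_AE) (use assms(1,2) in auto)
qed

lemma L2inner_self: "L2inner M f f = of_real ((L2norm M f)\<^sup>2)"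
  unfolding L2inner_def L2norm_def complex_norm_square[symmetric] integral_complex_of_real
  by simp

lemma L2norm_nonneg [simp]: "L2norm M f \<ge> 0"
  by (simp add: L2norm_def integral_nonneg_AE)

lemma L2norm_sq: "(L2norm M f)\<^sup>2 = (LINT x|M. (cmod (f x))\<^sup>2)"
  by (simp add: L2norm_def integral_nonneg_AE)

lemma L2norm_scale: "L2norm M (\<lambda>x. c * f x) = cmod c * L2norm M f"
  by (simp add: L2norm_def norm_mult power_mult_distrib real_sqrt_mult)

lemma L2norm_zero [simp]: "L2norm M (\<lambda>_. 0) = 0"
  by (simp add: L2norm_def)

lemma L2norm_cong_AE:
  assumes "AE x in M. f x = g x" "f \<in> borel_measurable M" "g \<in> borel_measurable M"
  shows "L2norm M f = L2norm M g"
proof -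
  have "(LINT x|M. (cmod (f x))\<^sup>2) = (LINT x|M. (cmod (g x))\<^sup>2)"
    by (rule integral_cong_AE) (use assms in auto)
  then show ?thesis by (simp add: L2norm_def)
qed

lemma L2_AE_zero:
  assumes "f \<in> L2 M" "L2norm M f = 0"
  shows "AE x in M. f x = 0"
proof -
  have "(LINT x|M. (cmod (f x))\<^sup>2) = 0"
    using assms(2) by (metis L2norm_sq zero_power2)
  then have "AE x in M. (cmod (f x))\<^sup>2 = 0"
    by (subst (asm) integral_nonneg_eq_0_iff_AE) (use assms in \<open>auto intro: L2_integrable_norm_sq\<close>)
  then show ?thesis by simp
qed

lemma L2_Cauchy_Schwarz:
  assumes f: "f \<in> L2 M" and g: "g \<in> L2 M"
  shows "cmod (L2inner M f g) \<le> L2norm M f * L2norm M g"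
proof (cases "L2norm M g = 0")
  case True
  then have "AE x in M. g x = 0" by (rule L2_AE_zero[OF g])
  then have "L2inner M f g = L2inner M f (\<lambda>_. 0)"
    by (intro L2inner_cong_AE) (use f g in \<open>auto intro: L2_measurable\<close>)
  then show ?thesis by simp
next
  case False
  define b where "b = L2inner M f g"
  define N where "N = (L2norm M g)\<^sup>2"
  have N: "N > 0" using False by (simp add: N_def)
  \<comment> \<open>\<open>c\<close> is the coefficient of the orthogonal projection of
    \<open>f\<close> onto \<open>g\<close>; the inequality is the nonnegativity of the squared norm
    of the remainder \<open>f - c g\<close>.\<close>
  define c where "c = b / of_real N"
  have cg: "(\<lambda>x. c * g x) \<in> L2 M" by (rule L2_scale[OF g])
  have "L2inner M (\<lambda>x. f x - c * g x) (\<lambda>x. f x - c * g x)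
     = L2inner M f f - cnj c * b - c * cnj b + c * cnj c * of_real N"
  proof -
    have "L2inner M g f = cnj b" "L2inner M g g = of_real N"
      by (simp_all only: b_def N_def L2inner_cnj L2inner_self)
    then show ?thesis
      unfolding L2inner_diff_left[OF f cg L2_diff[OF f cg]] L2inner_diff_right[OF f f cg]
        L2inner_diff_right[OF cg f cg]
      by (simp add: L2inner_scale_left L2inner_scale_right b_def[symmetric] algebra_simps)
  qed
  also have "c * cnj c * of_real N = cnj c * b"
    using N by (simp add: c_def)
  also have "c * cnj b = of_real ((cmod b)\<^sup>2 / N)"
    by (simp add: c_def complex_norm_square[symmetric] del: of_real_power)
  finally have "(of_real ((L2norm M (\<lambda>x. f x - c * g x))\<^sup>2) :: complex)
      = of_real ((L2norm M f)\<^sup>2 - (cmod b)\<^sup>2 / N)"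
    by (simp add: L2inner_self)
  then have "(L2norm M f)\<^sup>2 - (cmod b)\<^sup>2 / N \<ge> 0"
    by (metis of_real_eq_iff zero_le_power2)
  then have "(cmod b)\<^sup>2 \<le> (L2norm M f * L2norm M g)\<^sup>2"
    using N by (simp add: field_simps N_def power_mult_distrib)
  then show ?thesis
    unfolding b_def by (rule power2_le_imp_le) simp
qed

lemma L2norm_triangle:
  assumes f: "f \<in> L2 M" and g: "g \<in> L2 M"
  shows "L2norm M (\<lambda>x. f x + g x) \<le> L2norm M f + L2norm M g"
proof -
  have "(of_real ((L2norm M (\<lambda>x. f x + g x))\<^sup>2) :: complex)
      = L2inner M f f + L2inner M g g + (L2inner M f g + cnj (L2inner M f g))"
    unfolding L2inner_self[symmetric] using f g
    by (simp add: L2inner_add_left L2inner_add_right L2_add L2inner_cnj)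
  also have "\<dots> = of_real ((L2norm M f)\<^sup>2 + (L2norm M g)\<^sup>2 + 2 * Re (L2inner M f g))"
    by (simp add: L2inner_self complex_add_cnj)
  finally have "(L2norm M (\<lambda>x. f x + g x))\<^sup>2
      = (L2norm M f)\<^sup>2 + (L2norm M g)\<^sup>2 + 2 * Re (L2inner M f g)"
    by (simp only: of_real_eq_iff)
  also have "\<dots> \<le> (L2norm M f + L2norm M g)\<^sup>2"
    using complex_Re_le_cmod[of "L2inner M f g"] L2_Cauchy_Schwarz[OF f g]
    by (simp add: power2_sum)
  finally show ?thesis by (rule power2_le_imp_le) simp
qed

lemma L2norm_triangle_diff:
  assumes "f \<in> L2 M" "g \<in> L2 M" "h \<in> L2 M"
  shows "L2norm M (\<lambda>x. f x - h x) \<le> L2norm M (\<lambda>x. f x - g x) + L2norm M (\<lambda>x. g x - h x)"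
  using L2norm_triangle[OF L2_diff[OF assms(1,2)] L2_diff[OF assms(2,3)]]
  by (simp only: diff_add_cancel add_diff_eq)

lemma Pythagoras_L2:
  assumes f: "f \<in> L2 M" and g: "g \<in> L2 M" and 0: "L2inner M f g = 0"
  shows "(L2norm M (\<lambda>x. f x - g x))\<^sup>2 = (L2norm M f)\<^sup>2 + (L2norm M g)\<^sup>2"
proof -
  have "L2inner M g f = 0" unfolding L2inner_cnj[of M f g, symmetric] 0 by simp
  then have "(of_real ((L2norm M (\<lambda>x. f x - g x))\<^sup>2) :: complex)
      = of_real ((L2norm M f)\<^sup>2 + (L2norm M g)\<^sup>2)"
    using 0 f g unfolding of_real_add L2inner_self[symmetric]
    by (simp add: L2inner_diff_left L2inner_diff_right L2_diff)
  then show ?thesis by (simp only: of_real_eq_iff)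
qed

section \<open>Closed spans of indexed families\<close>

text \<open>\<open>lin_combs\<close> attaches coefficients to functions, the later arguments attach
  them to indices, and distinct indices may carry the same function. One direction picks one index
  per function; the other adds the coefficients over each fibre of \<open>e\<close>.\<close>

lemma lin_combs_image:
  "h \<in> lin_combs (e ` I) \<longleftrightarrow> (\<exists>F c. finite F \<and> F \<subseteq> I \<and> h = (\<lambda>x. \<Sum>i\<in>F. c i * e i x))"
proof
  assume "h \<in> lin_combs (e ` I)"
  then obtain F c where F: "finite F" "F \<subseteq> e ` I" and h: "h = (\<lambda>x. \<Sum>f\<in>F. c f * f x)"
    by (auto simp: lin_combs_def)
  obtain G where G: "G \<subseteq> I" "inj_on e G" "F = e ` G"
    using iffD1[OF subset_image_inj F(2)] by (elim exE conjE)
  have "finite G" using F(1) unfolding G(3) by (rule finite_imageD) (rule G(2))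
  have "h = (\<lambda>x. \<Sum>i\<in>G. c (e i) * e i x)"
    by (simp add: h G(3) sum.reindex[OF G(2)])
  then show "\<exists>F c. finite F \<and> F \<subseteq> I \<and> h = (\<lambda>x. \<Sum>i\<in>F. c i * e i x)"
    using G \<open>finite G\<close> by (intro exI[of _ G] exI[of _ "\<lambda>i. c (e i)"]) auto
next
  assume "\<exists>F c. finite F \<and> F \<subseteq> I \<and> h = (\<lambda>x. \<Sum>i\<in>F. c i * e i x)"
  then obtain F c where F: "finite F" "F \<subseteq> I" and h: "h = (\<lambda>x. \<Sum>i\<in>F. c i * e i x)"
    by blast
  have "h = (\<lambda>x. \<Sum>f\<in>e ` F. (\<Sum>i | i \<in> F \<and> e i = f. c i) * f x)"
  proof
    fix x
    have "h x = (\<Sum>f\<in>e ` F. \<Sum>i | i \<in> F \<and> e i = f. c i * e i x)"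
      unfolding h by (rule sum.image_gen[OF F(1)])
    then show "h x = (\<Sum>f\<in>e ` F. (\<Sum>i | i \<in> F \<and> e i = f. c i) * f x)"
      by (simp add: sum_distrib_right)
  qed
  then show "h \<in> lin_combs (e ` I)"
    using F unfolding lin_combs_def
    by (intro CollectI exI[of _ "e ` F"] exI[of _ "\<lambda>f. \<Sum>i | i \<in> F \<and> e i = f. c i"]) auto
qed

lemma lin_combs_base: "f \<in> S \<Longrightarrow> f \<in> lin_combs S"
  unfolding lin_combs_def by (intro CollectI exI[of _ "{f}"] exI[of _ "\<lambda>_. 1"]) auto

lemma lin_combs_zero: "(\<lambda>_. 0) \<in> lin_combs S"
  unfolding lin_combs_def by (intro CollectI exI[of _ "{}"]) auto

lemma lin_combs_scale:
  assumes "f \<in> lin_combs S"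
  shows "(\<lambda>x. a * f x) \<in> lin_combs S"
proof -
  from assms obtain F c where "finite F" "F \<subseteq> S" "f = (\<lambda>x. \<Sum>f\<in>F. c f * f x)"
    by (auto simp: lin_combs_def)
  then show ?thesis unfolding lin_combs_def
    by (intro CollectI exI[of _ F] exI[of _ "\<lambda>f. a * c f"])
      (auto simp: sum_distrib_left mult.assoc)
qed

lemma lin_combs_add:
  assumes "f \<in> lin_combs S" "g \<in> lin_combs S"
  shows "(\<lambda>x. f x + g x) \<in> lin_combs S"
proof -
  from assms(1) obtain F c where F: "finite F" "F \<subseteq> S" "f = (\<lambda>x. \<Sum>f\<in>F. c f * f x)"
    by (auto simp: lin_combs_def)
  from assms(2) obtain G d where G: "finite G" "G \<subseteq> S" "g = (\<lambda>x. \<Sum>f\<in>G. d f * f x)"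
    by (auto simp: lin_combs_def)
  let ?c = "\<lambda>h. (if h \<in> F then c h else 0) + (if h \<in> G then d h else 0)"
  have "f x + g x = (\<Sum>h\<in>F \<union> G. ?c h * h x)" for x
  proof -
    have "(\<Sum>h\<in>F \<union> G. ?c h * h x)
        = (\<Sum>h\<in>F \<union> G. if h \<in> F then c h * h x else 0) + (\<Sum>h\<in>F \<union> G. if h \<in> G then d h * h x else 0)"
      by (simp add: sum.distrib[symmetric]) (intro sum.cong, auto simp: algebra_simps)
    also have "\<dots> = f x + g x"
      using F(1) G(1)
      by (simp add: F(3) G(3) sum.inter_restrict[symmetric] Int_absorb1)
    finally show ?thesis by simp
  qed
  then show ?thesis using F(1,2) G(1,2) unfolding lin_combs_def
    by (intro CollectI exI[of _ "F \<union> G"] exI[of _ ?c]) auto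
qed

lemma lin_combs_sum:
  "(\<And>i. i \<in> I \<Longrightarrow> f i \<in> lin_combs S) \<Longrightarrow> (\<lambda>x. \<Sum>i\<in>I. c i * f i x) \<in> lin_combs S"
proof (induction I rule: infinite_finite_induct)
  case (insert i I)
  then show ?case
    using lin_combs_add[OF lin_combs_scale, of "f i" S "\<lambda>x. \<Sum>i\<in>I. c i * f i x" "c i"] by simp
qed (auto intro: lin_combs_zero)

lemma lin_combs_trans: "S \<subseteq> lin_combs T \<Longrightarrow> lin_combs S \<subseteq> lin_combs T"
  unfolding lin_combs_def[of S] by (auto intro!: lin_combs_sum)

lemma lin_combs_mono: "S \<subseteq> T \<Longrightarrow> lin_combs S \<subseteq> lin_combs T"
  using lin_combs_base by (intro lin_combs_trans) blast

text \<open>Index form of membership in a closed span, so that coefficients can be split, reindexed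
  and rescaled along the index set.\<close>

definition approximable :: "'a measure \<Rightarrow> ('i \<Rightarrow> 'a \<Rightarrow> complex) \<Rightarrow> 'i set \<Rightarrow> ('a \<Rightarrow> complex) \<Rightarrow> bool"
  where "approximable M e I g \<longleftrightarrow>
    (\<forall>\<epsilon>>0. \<exists>F c. finite F \<and> F \<subseteq> I \<and> L2norm M (\<lambda>x. g x - (\<Sum>i\<in>F. c i * e i x)) < \<epsilon>)"

lemma approximableE:
  assumes "approximable M e I g" "\<epsilon> > 0"
  obtains F c where "finite F" "F \<subseteq> I" "L2norm M (\<lambda>x. g x - (\<Sum>i\<in>F. c i * e i x)) < \<epsilon>"
  using assms unfolding approximable_def by (elim allE impE exE conjE)

lemma cl_span_image: "cl_span M V (e ` I) = {g \<in> V. approximable M e I g}"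
proof -
  have "(\<exists>h\<in>lin_combs (e ` I). P h) \<longleftrightarrow> (\<exists>F c. finite F \<and> F \<subseteq> I \<and> P (\<lambda>x. \<Sum>i\<in>F. c i * e i x))" for P
    by (auto simp: Bex_def lin_combs_image)
  then show ?thesis by (simp add: cl_span_def approximable_def)
qed

text \<open>Deleting the \<open>J\<close>-part of an approximant can only reduce the error:
  \<open>g\<close> minus the remaining part is orthogonal to the deleted part, so Pythagoras
  applies. This serves twice: to discard basis functions of the wrong parity, and to describe the
  kernel.\<close>

lemma approximable_orthogonal_part:
  assumes L2: "\<And>i. i \<in> I \<Longrightarrow> e i \<in> L2 M"
    and orth: "\<And>i j. i \<in> I \<Longrightarrow> j \<in> I \<Longrightarrow> i \<noteq> j \<Longrightarrow> L2inner M (e i) (e j) = 0"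
    and g: "g \<in> L2 M" and approx: "approximable M e I g"
    and J: "\<And>i. i \<in> I \<Longrightarrow> i \<in> J \<Longrightarrow> L2inner M g (e i) = 0"
  shows "approximable M e (I - J) g"
  unfolding approximable_def
proof (intro allI impI)
  fix \<epsilon> :: real assume "\<epsilon> > 0"
  then obtain F c where F: "finite F" "F \<subseteq> I"
    and less: "L2norm M (\<lambda>x. g x - (\<Sum>i\<in>F. c i * e i x)) < \<epsilon>"
    by (rule approximableE[OF approx])
  let ?a = "\<lambda>x. \<Sum>i\<in>F - J. c i * e i x" and ?b = "\<lambda>x. \<Sum>i\<in>F \<inter> J. c i * e i x"
  have a: "?a \<in> L2 M" and b: "?b \<in> L2 M" using F L2 by (auto intro!: L2_lincomb)
  have "L2inner M (\<lambda>x. g x - ?a x) (e j) = 0" if "j \<in> F \<inter> J" for j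
  proof -
    have "L2inner M ?a (e j) = (\<Sum>i\<in>F - J. c i * L2inner M (e i) (e j))"
      using F L2 that by (intro L2inner_lincomb_left) auto
    also have "\<dots> = 0" using F that by (intro sum.neutral) (auto intro!: orth)
    finally show ?thesis using J[of j] F L2 that a g by (auto simp: L2inner_diff_left)
  qed
  then have "L2inner M (\<lambda>x. g x - ?a x) ?b = 0"
    using F L2 g a by (subst L2inner_lincomb_right) (auto intro!: L2_diff)
  from Pythagoras_L2[OF L2_diff[OF g a] b this]
  have "(L2norm M (\<lambda>x. g x - ?a x))\<^sup>2 \<le> (L2norm M (\<lambda>x. g x - ?a x - ?b x))\<^sup>2"
    by simp
  then have "L2norm M (\<lambda>x. g x - ?a x) \<le> L2norm M (\<lambda>x. g x - ?a x - ?b x)"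
    by (rule power2_le_imp_le) simp
  also have "(\<lambda>x. g x - ?a x - ?b x) = (\<lambda>x. g x - (\<Sum>i\<in>F. c i * e i x))"
  proof
    fix x
    have "(\<Sum>i\<in>F. c i * e i x) = ?b x + ?a x"
      by (rule sum.Int_Diff[OF F(1)])
    then show "g x - ?a x - ?b x = g x - (\<Sum>i\<in>F. c i * e i x)" by simp
  qed
  also note less
  finally have "L2norm M (\<lambda>x. g x - ?a x) < \<epsilon>" .
  moreover have "finite (F - J)" "F - J \<subseteq> I - J" using F by auto
  ultimately show "\<exists>F c. finite F \<and> F \<subseteq> I - J \<and> L2norm M (\<lambda>x. g x - (\<Sum>i\<in>F. c i * e i x)) < \<epsilon>"
    by (intro exI[of _ "F - J"] exI[of _ c] conjI)
qed

text \<open>The inner product of \<open>f\<close> with every approximant vanishes, so Cauchy-Schwarz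
  bounds the one with \<open>g\<close> by the norm of \<open>f\<close> times the approximation
  error.\<close>

lemma approximable_inner_zero:
  assumes L2: "\<And>i. i \<in> I \<Longrightarrow> e i \<in> L2 M" and g: "g \<in> L2 M" and f: "f \<in> L2 M"
    and approx: "approximable M e I g"
    and zero: "\<And>i. i \<in> I \<Longrightarrow> L2inner M f (e i) = 0"
  shows "L2inner M f g = 0"
proof (rule ccontr)
  assume neq: "L2inner M f g \<noteq> 0"
  have *: "cmod (L2inner M f g) \<le> L2norm M f * \<epsilon>" if pos: "\<epsilon> > 0" for \<epsilon>
  proof -
    obtain F c where F: "finite F" "F \<subseteq> I"
      and less: "L2norm M (\<lambda>x. g x - (\<Sum>i\<in>F. c i * e i x)) < \<epsilon>"
      by (rule approximableE[OF approx pos])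
    have h: "(\<lambda>x. \<Sum>i\<in>F. c i * e i x) \<in> L2 M" using F L2 by (intro L2_lincomb) auto
    have "L2inner M f (\<lambda>x. \<Sum>i\<in>F. c i * e i x) = 0"
      using F L2 f zero by (subst L2inner_lincomb_right) (auto intro!: sum.neutral)
    then have "L2inner M f g = L2inner M f (\<lambda>x. g x - (\<Sum>i\<in>F. c i * e i x))"
      using f g h by (simp add: L2inner_diff_right)
    also have "cmod \<dots> \<le> L2norm M f * L2norm M (\<lambda>x. g x - (\<Sum>i\<in>F. c i * e i x))"
      by (rule L2_Cauchy_Schwarz[OF f L2_diff[OF g h]])
    also have "\<dots> \<le> L2norm M f * \<epsilon>" using less by (intro mult_left_mono) auto
    finally show ?thesis .
  qed
  \<comment> \<open>The \<open>+ 1\<close> keeps the denominator positive when \<open>f\<close> has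
    norm zero; this error forces the inner product to be at most half of its own modulus.\<close>
  define \<epsilon> where "\<epsilon> = cmod (L2inner M f g) / (2 * (L2norm M f + 1))"
  have pos: "L2norm M f + 1 > 0" using L2norm_nonneg[of M f] by linarith
  then have "\<epsilon> > 0" using neq by (simp add: \<epsilon>_def)
  from *[OF this] have "cmod (L2inner M f g) \<le> L2norm M f * \<epsilon>" .
  also have "\<dots> \<le> (L2norm M f + 1) * \<epsilon>" using \<open>\<epsilon> > 0\<close> by (intro mult_right_mono) auto
  also have "\<dots> = cmod (L2inner M f g) / 2" using pos by (simp add: \<epsilon>_def field_simps)
  finally show False using neq by simp
qed

text \<open>The case \<open>f = g\<close> of \<open>approximable_inner_zero\<close>. It turns
  completeness into uniqueness: functions with the same coefficients agree almost
  everywhere.\<close>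

lemma approximable_AE_zero:
  assumes "\<And>i. i \<in> I \<Longrightarrow> e i \<in> L2 M" "g \<in> L2 M" "approximable M e I g"
    "\<And>i. i \<in> I \<Longrightarrow> L2inner M g (e i) = 0"
  shows "AE x in M. g x = 0"
proof -
  have "L2inner M g g = 0" by (rule approximable_inner_zero[OF assms(1,2,2,3,4)])
  then have "L2norm M g = 0" by (simp add: L2inner_self)
  with assms(2) show ?thesis by (rule L2_AE_zero)
qed

section \<open>Changes of variables\<close>

text \<open>Reduces an identity of measures to nonnegative integrals, which is the form that Tonelli
  and the substitution lemmas produce.\<close>

lemma measure_eqI_nn_integral:
  assumes "sets M = sets N"
    and "\<And>h. h \<in> borel_measurable M \<Longrightarrow> (\<integral>\<^sup>+x. h x \<partial>M) = (\<integral>\<^sup>+x. h x \<partial>N)"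
  shows "M = N"
proof (rule measure_eqI[OF assms(1)])
  fix A assume A: "A \<in> sets M"
  then show "emeasure M A = emeasure N A"
    using assms(2)[of "indicator A"] assms(1) by (simp add: nn_integral_indicator)
qed

text \<open>The change of variables for absolutely integrable functions is applied to indicators of
  bounded sets, which have finite integral. Exhausting the line by \<open>{-n..n}\<close> gives
  equality of two measures, and with it the formula for every nonnegative measurable
  \<open>h\<close>.\<close>

lemma nn_integral_substitution_inj:
  fixes g g' :: "real \<Rightarrow> real"
  assumes S [measurable]: "S \<in> sets borel" and T [measurable]: "g ` S \<in> sets borel"
    and g [measurable]: "g \<in> borel_measurable borel" and g' [measurable]: "g' \<in> borel_measurable borel"
    and deriv: "\<And>x. x \<in> S \<Longrightarrow> (g has_field_derivative g' x) (at x)"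
    and inj: "inj_on g S"
    and h [measurable]: "h \<in> borel_measurable borel"
  shows "(\<integral>\<^sup>+x. h (g x) * ennreal \<bar>g' x\<bar> * indicator S x \<partial>lborel)
    = (\<integral>\<^sup>+x. h x * indicator (g ` S) x \<partial>lborel)"
proof -
  let ?M = "distr (density lborel (\<lambda>x. ennreal \<bar>g' x\<bar> * indicator S x)) borel g"
  let ?N = "density lborel (indicator (g ` S))"
  have bounded: "emeasure ?M (A \<inter> {-real n..real n}) = emeasure ?N (A \<inter> {-real n..real n})"
    if A [measurable]: "A \<in> sets borel" for A n
  proof -
    let ?A = "A \<inter> {-real n..real n}"
    have "?A \<inter> g ` S \<in> lmeasurable"
      by (rule bounded_set_imp_lmeasurable) (auto intro: bounded_subset[OF bounded_closed_interval])
    then have lm: "?A \<inter> g ` S \<in> lmeasurable" and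
      "(indicat_real (?A \<inter> g ` S) has_integral measure lebesgue (?A \<inter> g ` S)) UNIV"
      by (auto simp: lmeasurable_iff_has_integral)
    then have "(indicat_real ?A has_integral measure lebesgue (?A \<inter> g ` S)) (g ` S)"
    proof -
      have "indicat_real (?A \<inter> g ` S) = (\<lambda>x. if x \<in> g ` S then indicat_real ?A x else 0)"
        by (auto simp: indicator_def)
      with \<open>(indicat_real (?A \<inter> g ` S) has_integral _) _\<close> show ?thesis
        by (simp only: has_integral_restrict_UNIV)
    qed
    then have "indicat_real ?A absolutely_integrable_on g ` S \<and>
        integral (g ` S) (indicat_real ?A) = measure lebesgue (?A \<inter> g ` S)"
      by (auto intro!: nonnegative_absolutely_integrable_1 intro: has_integral_integrable)
    then have "(\<lambda>x. \<bar>g' x\<bar> * indicat_real ?A (g x)) absolutely_integrable_on S \<and>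
        integral S (\<lambda>x. \<bar>g' x\<bar> * indicat_real ?A (g x)) = measure lebesgue (?A \<inter> g ` S)"
      using S deriv inj
      by (subst has_absolute_integral_change_of_variables_1')
        (auto intro: has_field_derivative_at_within)
    then have "((\<lambda>x. \<bar>g' x\<bar> * indicat_real ?A (g x)) has_integral measure lebesgue (?A \<inter> g ` S)) S"
      by (metis absolutely_integrable_on_def has_integral_integral)
    from nn_integral_has_integral_lebesgue[OF _ this]
    have "(\<integral>\<^sup>+x. indicator S x * (\<bar>g' x\<bar> * indicat_real ?A (g x)) \<partial>lborel) = measure lebesgue (?A \<inter> g ` S)"
      by simp
    also have "\<dots> = emeasure lborel (?A \<inter> g ` S)"
      using emeasure_eq_measure2[OF lm] by (simp del: measure_completion)
    also have "\<dots> = emeasure ?N ?A"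
      by (simp add: emeasure_restricted Int_commute)
    also have "(\<integral>\<^sup>+x. indicator S x * (\<bar>g' x\<bar> * indicat_real ?A (g x)) \<partial>lborel) = emeasure ?M ?A"
      by (subst emeasure_distr) (auto simp: emeasure_density indicator_def intro!: nn_integral_cong)
    finally show ?thesis .
  qed
  have "?M = ?N"
  proof (rule measure_eqI)
    fix A assume A: "A \<in> sets ?M"
    then have [measurable]: "A \<in> sets borel" by simp
    have un: "A = (\<Union>n. A \<inter> {-real n..real n})"
    proof -
      have "x \<in> (\<Union>n. A \<inter> {-real n..real n})" if "x \<in> A" for x
      proof -
        obtain n where "\<bar>x\<bar> \<le> real n" using real_arch_simple by blast
        then have "x \<in> A \<inter> {-real n..real n}" using that by auto
        then show ?thesis by (rule UN_I[OF UNIV_I])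
      qed
      moreover have "(\<Union>n. A \<inter> {-real n..real n}) \<subseteq> A" by (intro UN_least Int_lower1)
      ultimately show ?thesis by (intro equalityI subsetI) fast+
    qed
    have inc: "incseq (\<lambda>n. A \<inter> {-real n..real n})"
      unfolding incseq_def by (intro allI impI Int_mono order_refl) simp
    have *: "emeasure L A = (SUP n. emeasure L (A \<inter> {-real n..real n}))" if "sets L = sets borel" for L
    proof -
      have "(SUP n. emeasure L (A \<inter> {-real n..real n})) = emeasure L (\<Union>n. A \<inter> {-real n..real n})"
      proof (rule SUP_emeasure_incseq[OF _ inc])
        have "A \<inter> {-real n..real n} \<in> sets borel" for n by measurable
        then show "range (\<lambda>n. A \<inter> {-real n..real n}) \<subseteq> sets L" unfolding that by (rule image_subsetI)
      qed
      then show ?thesis by (simp only: un[symmetric])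
    qed
    show "emeasure ?M A = emeasure ?N A"
      using *[of ?M] *[of ?N] bounded[OF \<open>A \<in> sets borel\<close>] by simp
  qed simp
  then have "(\<integral>\<^sup>+x. h x \<partial>?M) = (\<integral>\<^sup>+x. h x \<partial>?N)" by simp
  then show ?thesis
    by (simp add: nn_integral_distr nn_integral_density mult_ac)
qed

section \<open>Lebesgue measure on the complex plane: Fubini and rotations\<close>

lemma measurable_Complex [measurable]:
  assumes "f \<in> borel_measurable M" "g \<in> borel_measurable M"
  shows "(\<lambda>x. Complex (f x) (g x)) \<in> borel_measurable M"
  using assms unfolding Complex_eq by measurable

lemma measurable_Complex_pair [measurable]:
  "(\<lambda>(x, y). Complex x y) \<in> borel_measurable (borel :: (real \<times> real) measure)"
  unfolding case_prod_beta borel_prod[symmetric] by measurable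

lemma lborel_complex_eq: "lborel = distr (lborel :: (real \<times> real) measure) borel (\<lambda>(x, y). Complex x y)"
proof (rule lborel_eqI)
  fix l u :: complex assume le: "\<And>b. b \<in> Basis \<Longrightarrow> l \<bullet> b \<le> u \<bullet> b"
  have "(\<lambda>(x, y). Complex x y) -` box l u = {Re l<..<Re u} \<times> {Im l<..<Im u}"
    by (auto simp: in_box_complex_iff)
  then have "emeasure (distr (lborel :: (real \<times> real) measure) borel (\<lambda>(x, y). Complex x y)) (box l u)
     = emeasure (lborel \<Otimes>\<^sub>M lborel) ({Re l<..<Re u} \<times> {Im l<..<Im u})"
    by (simp add: emeasure_distr lborel_prod)
  also have "\<dots> = ennreal (Re u - Re l) * ennreal (Im u - Im l)"
    using le[of 1] le[of \<i>] by (subst lborel.emeasure_pair_measure_Times) (auto simp: Basis_complex_def)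
  also have "\<dots> = ennreal (\<Prod>b\<in>Basis. (u - l) \<bullet> b)"
    using le[of 1] le[of \<i>] by (auto simp: Basis_complex_def ennreal_mult)
  finally show "emeasure (distr (lborel :: (real \<times> real) measure) borel (\<lambda>(x, y). Complex x y)) (box l u)
    = ennreal (\<Prod>b\<in>Basis. (u - l) \<bullet> b)" .
qed simp

lemma nn_integral_lborel_complex:
  assumes [measurable]: "h \<in> borel_measurable borel"
  shows "(\<integral>\<^sup>+z. h z \<partial>lborel) = (\<integral>\<^sup>+x. \<integral>\<^sup>+y. h (Complex x y) \<partial>lborel \<partial>lborel)"
    "(\<integral>\<^sup>+z. h z \<partial>lborel) = (\<integral>\<^sup>+y. \<integral>\<^sup>+x. h (Complex x y) \<partial>lborel \<partial>lborel)"
proof -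
  have "(\<integral>\<^sup>+z. h z \<partial>lborel) = (\<integral>\<^sup>+p. h (Complex (fst p) (snd p)) \<partial>(lborel \<Otimes>\<^sub>M lborel))"
    by (subst lborel_complex_eq, subst nn_integral_distr) (auto simp: lborel_prod case_prod_beta)
  also have "\<dots> = (\<integral>\<^sup>+x. \<integral>\<^sup>+y. h (Complex x y) \<partial>lborel \<partial>lborel)"
    by (subst lborel.nn_integral_fst[symmetric]) auto
  finally show *: "(\<integral>\<^sup>+z. h z \<partial>lborel) = (\<integral>\<^sup>+x. \<integral>\<^sup>+y. h (Complex x y) \<partial>lborel \<partial>lborel)" .
  show "(\<integral>\<^sup>+z. h z \<partial>lborel) = (\<integral>\<^sup>+y. \<integral>\<^sup>+x. h (Complex x y) \<partial>lborel \<partial>lborel)"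
    unfolding * by (rule lborel_pair.Fubini'[symmetric]) measurable
qed

text \<open>A rotation with nonzero cosine is a composition of two maps that each change a single
  coordinate affinely; every other rotation is the square of such a rotation.\<close>

lemma nn_integral_lborel_mult_Re_nonzero:
  fixes v :: complex
  assumes v: "cmod v = 1" "Re v \<noteq> 0" and [measurable]: "h \<in> borel_measurable borel"
  shows "(\<integral>\<^sup>+z. h (v * z) \<partial>lborel) = (\<integral>\<^sup>+z. h z \<partial>lborel)"
proof -
  define c s where "c = Re v" and "s = Im v"
  have cs: "c \<noteq> 0" "c\<^sup>2 + s\<^sup>2 = 1"
    using v by (auto simp: c_def s_def cmod_def)
  have mult: "v * Complex x y = Complex (c * x - s * y) (s * x + c * y)" for x y
    by (simp add: complex_eq_iff c_def s_def)
  have "(\<integral>\<^sup>+z. h (v * z) \<partial>lborel)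
      = (\<integral>\<^sup>+y. \<integral>\<^sup>+x. h (Complex (c * x - s * y) (s * x + c * y)) \<partial>lborel \<partial>lborel)"
    by (subst nn_integral_lborel_complex(2)) (auto simp: mult)
  \<comment> \<open>First shear: for fixed \<open>y\<close> the new variable is the real part of the
    rotated point, and by \<open>c\<^sup>2 + s\<^sup>2 = 1\<close> the imaginary part becomes
    \<open>s/c * x + y/c\<close>. The second shear, in \<open>y\<close>, contributes the factor
    \<open>\<bar>c\<bar>\<close> that cancels \<open>\<bar>1/c\<bar>\<close>.\<close>
  also have "\<dots> = (\<integral>\<^sup>+y. \<bar>1/c\<bar> * (\<integral>\<^sup>+x. h (Complex x (s/c * x + y/c)) \<partial>lborel) \<partial>lborel)"
  proof (intro nn_integral_cong)
    fix y
    have "c * (s * y / c + 1/c * x) - s * y = x" for x using cs by (simp add: field_simps)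
    moreover have "s * (s * y / c + 1/c * x) + c * y = s/c * x + y/c" for x
    proof -
      have "s * (s * y / c + 1/c * x) + c * y = s/c * x + (s\<^sup>2 + c\<^sup>2) * y / c"
        using cs(1) by (simp add: field_simps power2_eq_square)
      then show ?thesis using cs(2) by (simp add: add.commute)
    qed
    ultimately show "(\<integral>\<^sup>+x. h (Complex (c * x - s * y) (s * x + c * y)) \<partial>lborel)
       = \<bar>1/c\<bar> * (\<integral>\<^sup>+x. h (Complex x (s/c * x + y/c)) \<partial>lborel)"
      using cs by (subst nn_integral_real_affine[where c = "1/c" and t = "s * y / c"]) auto
  qed
  also have "\<dots> = \<bar>1/c\<bar> * (\<integral>\<^sup>+y. \<integral>\<^sup>+x. h (Complex x (s/c * x + y/c)) \<partial>lborel \<partial>lborel)"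
    by (rule nn_integral_cmult) measurable
  also have "(\<integral>\<^sup>+y. \<integral>\<^sup>+x. h (Complex x (s/c * x + y/c)) \<partial>lborel \<partial>lborel)
      = (\<integral>\<^sup>+x. \<integral>\<^sup>+y. h (Complex x (s/c * x + y/c)) \<partial>lborel \<partial>lborel)"
    by (rule lborel_pair.Fubini') measurable
  also have "\<dots> = (\<integral>\<^sup>+x. \<bar>c\<bar> * (\<integral>\<^sup>+y. h (Complex x y) \<partial>lborel) \<partial>lborel)"
  proof (intro nn_integral_cong)
    fix x
    have "s/c * x + (- s * x + c * y) / c = y" for y using cs by (simp add: field_simps)
    then show "(\<integral>\<^sup>+y. h (Complex x (s/c * x + y/c)) \<partial>lborel) = \<bar>c\<bar> * (\<integral>\<^sup>+y. h (Complex x y) \<partial>lborel)"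
      using cs by (subst nn_integral_real_affine[where c = c and t = "- s * x"]) auto
  qed
  also have "\<dots> = \<bar>c\<bar> * (\<integral>\<^sup>+z. h z \<partial>lborel)"
    by (subst nn_integral_cmult) (auto simp: nn_integral_lborel_complex(1))
  also have "\<bar>1/c\<bar> * (\<bar>c\<bar> * (\<integral>\<^sup>+z. h z \<partial>lborel)) = (\<integral>\<^sup>+z. h z \<partial>lborel)"
    using cs by (simp add: mult.assoc[symmetric] ennreal_mult'[symmetric])
  finally show ?thesis .
qed

lemma nn_integral_lborel_mult:
  fixes v :: complex
  assumes v: "cmod v = 1" and [measurable]: "h \<in> borel_measurable borel"
  shows "(\<integral>\<^sup>+z. h (v * z) \<partial>lborel) = (\<integral>\<^sup>+z. h z \<partial>lborel)"
proof (cases "Re v = 0")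
  case False
  then show ?thesis using assms by (intro nn_integral_lborel_mult_Re_nonzero)
next
  case True
  define r where "r = csqrt v"
  have r2: "r * r = v" by (simp add: r_def power2_eq_square[symmetric])
  then have "(cmod r)\<^sup>2 = 1" using v by (metis norm_mult power2_eq_square)
  then have r: "cmod r = 1" using norm_ge_zero[of r] by (simp add: power2_eq_1_iff)
  have "Re r \<noteq> 0"
  proof
    assume "Re r = 0"
    then have "Re v = - (Im r)\<^sup>2" "(Im r)\<^sup>2 = 1"
      using \<open>(cmod r)\<^sup>2 = 1\<close> by (auto simp: r2[symmetric] power2_eq_square[of "Im r"] cmod_power2)
    then show False using True by simp
  qed
  have "(\<integral>\<^sup>+z. h (v * z) \<partial>lborel) = (\<integral>\<^sup>+z. h (r * (r * z)) \<partial>lborel)"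
    by (simp add: r2[symmetric] mult.assoc)
  also have "\<dots> = (\<integral>\<^sup>+z. h (r * z) \<partial>lborel)"
    by (rule nn_integral_lborel_mult_Re_nonzero[where h = "\<lambda>z. h (r * z)"])
      (use r \<open>Re r \<noteq> 0\<close> in auto)
  also have "\<dots> = (\<integral>\<^sup>+z. h z \<partial>lborel)"
    using r \<open>Re r \<noteq> 0\<close> by (intro nn_integral_lborel_mult_Re_nonzero) auto
  finally show ?thesis .
qed

section \<open>The measures of the Euclidean picture\<close>

text \<open>Arc length on the unit circle, carried as a measure on all of \<open>complex\<close> so
  that rotations are plain multiplications.\<close>

definition C_meas :: "complex measure" where
  "C_meas = distr (density lborel (\<lambda>b. ennreal (indicator {0..2*pi} b))) borel cis"

text \<open>The Gegenbauer weight: exponent \<open>\<gamma>\<close> weights the position along a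
  chord, exponent \<open>\<gamma> + 1/2\<close> its distance from the origin.\<close>

definition W_meas :: "real \<Rightarrow> real measure" where
  "W_meas c = density lborel (\<lambda>u. ennreal (indicator {-1<..<1} u * (1 - u\<^sup>2) powr c))"

definition E_meas :: "real \<Rightarrow> complex measure" where
  "E_meas \<gamma> = density lborel (\<lambda>z. ennreal (indicator (ball 0 1) z * (1 - (cmod z)\<^sup>2) powr \<gamma>))"

text \<open>Measure on oriented chords \<open>(v, y)\<close> with direction \<open>- v\<close> and
  signed distance \<open>y\<close> from the origin. The extra 1/2 is the half length
  \<open>sqrt (1 - y\<^sup>2)\<close> absorbed into the weight.\<close>

definition B_meas :: "real \<Rightarrow> (complex \<times> real) measure" where
  "B_meas \<gamma> = C_meas \<Otimes>\<^sub>M W_meas (\<gamma> + 1/2)"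

lemma sets_C_meas [measurable_cong, simp]: "sets C_meas = sets borel"
  and sets_W_meas [measurable_cong, simp]: "sets (W_meas c) = sets borel"
  and sets_E_meas [measurable_cong, simp]: "sets (E_meas \<gamma>) = sets borel"
  by (simp_all add: C_meas_def W_meas_def E_meas_def)

lemma sets_B_meas [measurable_cong]: "sets (B_meas \<gamma>) = sets (borel \<Otimes>\<^sub>M borel)"
  unfolding B_meas_def by (intro sets_pair_measure_cong) simp_all

lemma space_C_meas [simp]: "space C_meas = UNIV"
  and space_W_meas [simp]: "space (W_meas c) = UNIV"
  and space_E_meas [simp]: "space (E_meas \<gamma>) = UNIV"
  and space_B_meas [simp]: "space (B_meas \<gamma>) = UNIV"
  by (simp_all add: C_meas_def W_meas_def E_meas_def B_meas_def space_pair_measure)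

lemma measurable_cis [measurable]: "cis \<in> borel_measurable borel"
  by (intro borel_measurable_continuous_onI continuous_intros)

lemma measurable_cnj [measurable]: "cnj \<in> borel_measurable borel"
  by (intro borel_measurable_continuous_onI continuous_intros)

lemma nn_integral_C_meas:
  assumes [measurable]: "h \<in> borel_measurable borel"
  shows "(\<integral>\<^sup>+v. h v \<partial>C_meas) = (\<integral>\<^sup>+b. h (cis b) * indicator {0..2*pi} b \<partial>lborel)"
  unfolding C_meas_def
  by (simp add: nn_integral_distr nn_integral_density mult.commute ennreal_indicator)

lemma nn_integral_W_meas:
  assumes [measurable]: "h \<in> borel_measurable borel"
  shows "(\<integral>\<^sup>+u. h u \<partial>W_meas c)
    = (\<integral>\<^sup>+u. ennreal (indicator {-1<..<1} u * (1 - u\<^sup>2) powr c) * h u \<partial>lborel)"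
  unfolding W_meas_def by (simp add: nn_integral_density)

lemma ball_borel [measurable]: "ball (0 :: complex) 1 \<in> sets borel"
  by simp

lemma nn_integral_E_meas:
  assumes [measurable]: "h \<in> borel_measurable borel"
  shows "(\<integral>\<^sup>+z. h z \<partial>E_meas \<gamma>)
    = (\<integral>\<^sup>+z. ennreal (indicator (ball 0 1) z * (1 - (cmod z)\<^sup>2) powr \<gamma>) * h z \<partial>lborel)"
  unfolding E_meas_def by (simp add: nn_integral_density)

lemma AE_C_meas: "AE v in C_meas. cmod v = 1"
  unfolding C_meas_def by (subst AE_distr_iff) auto

lemma AE_W_meas: "AE u in W_meas c. -1 < u \<and> u < 1"
  unfolding W_meas_def by (subst AE_density) (auto simp: indicator_def)

lemma AE_E_meas: "AE z in E_meas \<gamma>. cmod z < 1"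
  unfolding E_meas_def by (subst AE_density) (auto simp: indicator_def)

section \<open>Rotation invariance of the circle and disk measures\<close>

lemma finite_measure_C_meas: "finite_measure C_meas"
  by (rule finite_measureI)
    (simp add: C_meas_def emeasure_distr emeasure_density ennreal_indicator nn_integral_indicator)

interpretation C_meas: finite_measure C_meas
  by (rule finite_measure_C_meas)

interpretation W_meas: sigma_finite_measure "W_meas c" for c
  unfolding W_meas_def by (subst sigma_finite_measure.sigma_finite_iff_density_finite[OF sigma_finite_lborel]) auto

lemma measure_C_meas [simp]: "measure C_meas UNIV = 2 * pi"
  by (simp add: measure_def C_meas_def emeasure_distr emeasure_density ennreal_indicator nn_integral_indicator)

text \<open>A rotation by the angle \<open>\<phi>\<close> moves the period \<open>{0..2*pi}\<close>
  to \<open>{\<phi>..\<phi>+2*pi}\<close>. The part beyond \<open>2*pi\<close> is shifted back by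
  one period; the doubly counted endpoint is a null set.\<close>

lemma nn_integral_C_meas_mult:
  assumes v: "cmod v = 1" and h [measurable]: "h \<in> borel_measurable borel"
  shows "(\<integral>\<^sup>+w. h (v * w) \<partial>C_meas) = (\<integral>\<^sup>+w. h w \<partial>C_meas)"
proof -
  obtain \<phi> where \<phi>: "0 \<le> \<phi>" "\<phi> < 2*pi" "v = cis \<phi>"
    using v complex_norm_eq_1_exp_eq[of v] Arg2pi[of v]
    by (metis cis_conv_exp complex_norm_eq_1_exp mult_1 norm_eq_zero of_real_1)
  define k where "k b = h (cis b)" for b
  have [measurable]: "k \<in> borel_measurable borel" unfolding k_def by measurable
  have per: "k (b + 2*pi) = k b" for b
    by (simp add: k_def cis.ctr)
  have "(\<integral>\<^sup>+w. h (v * w) \<partial>C_meas) = (\<integral>\<^sup>+b. k (\<phi> + b) * indicator {0..2*pi} b \<partial>lborel)"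
    by (subst nn_integral_C_meas) (auto simp: k_def \<phi> cis_mult)
  also have "\<dots> = (\<integral>\<^sup>+b. k b * indicator {\<phi>..\<phi>+2*pi} b \<partial>lborel)"
    by (subst (2) nn_integral_real_affine[where c = 1 and t = \<phi>]) (auto simp: indicator_def)
  also have "\<dots> = (\<integral>\<^sup>+b. k b * indicator {\<phi>..<2*pi} b + k b * indicator {2*pi..\<phi>+2*pi} b \<partial>lborel)"
    using \<phi> by (intro nn_integral_cong) (auto simp: indicator_def)
  also have "\<dots> = (\<integral>\<^sup>+b. k b * indicator {\<phi>..<2*pi} b \<partial>lborel) + (\<integral>\<^sup>+b. k b * indicator {2*pi..\<phi>+2*pi} b \<partial>lborel)"
    by (rule nn_integral_add) measurable
  also have "(\<integral>\<^sup>+b. k b * indicator {2*pi..\<phi>+2*pi} b \<partial>lborel) = (\<integral>\<^sup>+b. k b * indicator {0..\<phi>} b \<partial>lborel)"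
    by (subst nn_integral_real_affine[where c = 1 and t = "2*pi"])
      (auto simp: per add.commute[of "2*pi"] indicator_def)
  also have "(\<integral>\<^sup>+b. k b * indicator {\<phi>..<2*pi} b \<partial>lborel) + \<dots>
      = (\<integral>\<^sup>+b. k b * indicator {\<phi>..<2*pi} b + k b * indicator {0..\<phi>} b \<partial>lborel)"
    by (rule nn_integral_add[symmetric]) measurable
  also have "\<dots> = (\<integral>\<^sup>+b. k b * indicator {0..2*pi} b \<partial>lborel)"
  proof (rule nn_integral_cong_AE)
    have "AE b in lborel. b \<noteq> \<phi> \<and> b \<noteq> 2 * pi"
      using AE_lborel_singleton[of \<phi>] AE_lborel_singleton[of "2*pi"] by eventually_elim auto
    then show "AE b in lborel. k b * indicator {\<phi>..<2*pi} b + k b * indicator {0..\<phi>} b = k b * indicator {0..2*pi} b"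
      by eventually_elim (use \<phi> in \<open>auto simp: indicator_def\<close>)
  qed
  also have "\<dots> = (\<integral>\<^sup>+w. h w \<partial>C_meas)"
    by (subst nn_integral_C_meas) (auto simp: k_def)
  finally show ?thesis .
qed

lemma distr_C_meas_mult:
  assumes "cmod v = 1"
  shows "distr C_meas C_meas (\<lambda>w. v * w) = C_meas"
  by (rule measure_eqI_nn_integral)
    (auto simp: nn_integral_distr nn_integral_C_meas_mult[OF assms])

lemma nn_integral_E_meas_mult:
  assumes "cmod v = 1" and [measurable]: "h \<in> borel_measurable borel"
  shows "(\<integral>\<^sup>+w. h (v * w) \<partial>E_meas \<gamma>) = (\<integral>\<^sup>+w. h w \<partial>E_meas \<gamma>)"
  using nn_integral_lborel_mult[OF assms(1),
      of "\<lambda>z. ennreal (indicator (ball 0 1) z * (1 - (cmod z)\<^sup>2) powr \<gamma>) * h z"] assms(1)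
  by (simp add: nn_integral_E_meas norm_mult indicator_def dist_norm)

text \<open>With \<open>s = u * sqrt (1 - y\<^sup>2)\<close> at height \<open>y\<close>, the factor
  1 - |z|^2 becomes \<open>(1 - y\<^sup>2) * (1 - u\<^sup>2)\<close>, so the weight splits; the
  Jacobian \<open>sqrt (1 - y\<^sup>2)\<close> raises the exponent in \<open>y\<close> by
  1/2.\<close>

lemma nn_integral_E_meas_chords:
  assumes [measurable]: "h \<in> borel_measurable borel"
  shows "(\<integral>\<^sup>+y. \<integral>\<^sup>+u. h (Complex (u * sqrt (1 - y\<^sup>2)) y) \<partial>W_meas \<gamma> \<partial>W_meas (\<gamma> + 1/2))
    = (\<integral>\<^sup>+z. h z \<partial>E_meas \<gamma>)"
proof -
  let ?\<rho> = "\<lambda>z. ennreal (indicator (ball 0 1) z * (1 - (cmod z)\<^sup>2) powr \<gamma>)"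
  have "(\<integral>\<^sup>+z. h z \<partial>E_meas \<gamma>) = (\<integral>\<^sup>+y. \<integral>\<^sup>+s. ?\<rho> (Complex s y) * h (Complex s y) \<partial>lborel \<partial>lborel)"
    by (simp add: nn_integral_E_meas nn_integral_lborel_complex(2))
  also have "\<dots> = (\<integral>\<^sup>+y. ennreal (indicator {-1<..<1} y * (1 - y\<^sup>2) powr (\<gamma> + 1/2)) *
      (\<integral>\<^sup>+u. h (Complex (u * sqrt (1 - y\<^sup>2)) y) \<partial>W_meas \<gamma>) \<partial>lborel)"
  proof (intro nn_integral_cong)
    fix y :: real
    show "(\<integral>\<^sup>+s. ?\<rho> (Complex s y) * h (Complex s y) \<partial>lborel)
      = ennreal (indicator {-1<..<1} y * (1 - y\<^sup>2) powr (\<gamma> + 1/2)) *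
        (\<integral>\<^sup>+u. h (Complex (u * sqrt (1 - y\<^sup>2)) y) \<partial>W_meas \<gamma>)"
    proof (cases "-1 < y \<and> y < 1")
      case False
      then have "1 \<le> y\<^sup>2" by (metis abs_square_less_1 abs_less_iff linorder_not_less minus_less_iff)
      then have "\<not> cmod (Complex s y) < 1" for s
        by (simp add: cmod_def not_less add_increasing)
      then show ?thesis using False by (simp add: indicator_def)
    next
      case True
      define r where "r = sqrt (1 - y\<^sup>2)"
      have y2: "1 - y\<^sup>2 > 0" using True by (simp add: abs_square_less_1 abs_less_iff)
      then have r: "r > 0" "r\<^sup>2 = 1 - y\<^sup>2" by (auto simp: r_def)
      have "ennreal r * ?\<rho> (Complex (r * u) y)
          = ennreal ((1 - y\<^sup>2) powr (\<gamma> + 1/2)) * ennreal (indicator {-1<..<1} u * (1 - u\<^sup>2) powr \<gamma>)" for u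
      proof -
        have *: "1 - (cmod (Complex (r * u) y))\<^sup>2 = (1 - y\<^sup>2) * (1 - u\<^sup>2)"
          by (simp add: cmod_power2 power_mult_distrib r(2)) (simp add: algebra_simps)
        have "cmod (Complex (r * u) y) < 1 \<longleftrightarrow> 1 - (cmod (Complex (r * u) y))\<^sup>2 > 0"
          by (simp add: abs_square_less_1)
        also have "\<dots> \<longleftrightarrow> 1 - u\<^sup>2 > 0"
          unfolding * using y2 by (meson mult_pos_pos zero_less_mult_pos)
        also have "\<dots> \<longleftrightarrow> -1 < u \<and> u < 1"
          by (auto simp: abs_square_less_1)
        finally have iff: "cmod (Complex (r * u) y) < 1 \<longleftrightarrow> -1 < u \<and> u < 1" .
        have "r * ((1 - y\<^sup>2) * (1 - u\<^sup>2)) powr \<gamma> = (1 - y\<^sup>2) powr (\<gamma> + 1/2) * (1 - u\<^sup>2) powr \<gamma>" if "-1 < u" "u < 1"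
        proof -
          have "1 - u\<^sup>2 > 0" using that by (simp add: abs_square_less_1 abs_less_iff)
          then show ?thesis using y2 by (simp add: r_def powr_mult powr_add powr_half_sqrt)
        qed
        then show ?thesis
          using r y2 iff by (auto simp: * ennreal_mult[symmetric] indicator_def)
      qed
      then have "(\<integral>\<^sup>+s. ?\<rho> (Complex s y) * h (Complex s y) \<partial>lborel)
        = (\<integral>\<^sup>+u. ennreal ((1 - y\<^sup>2) powr (\<gamma> + 1/2)) * (ennreal (indicator {-1<..<1} u * (1 - u\<^sup>2) powr \<gamma>)
             * h (Complex (u * r) y)) \<partial>lborel)"
        using r(1)
        by (subst nn_integral_real_affine[where c = r and t = 0])
          (auto simp: nn_integral_cmult[symmetric] mult.assoc[symmetric] mult.commute[of _ r])
      also have "\<dots> = ennreal ((1 - y\<^sup>2) powr (\<gamma> + 1/2)) * (\<integral>\<^sup>+u. h (Complex (u * r) y) \<partial>W_meas \<gamma>)"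
        by (subst nn_integral_cmult) (auto simp: nn_integral_W_meas)
      finally show ?thesis using True by (simp add: r_def indicator_def)
    qed
  qed
  also have "\<dots> = (\<integral>\<^sup>+y. \<integral>\<^sup>+u. h (Complex (u * sqrt (1 - y\<^sup>2)) y) \<partial>W_meas \<gamma> \<partial>W_meas (\<gamma> + 1/2))"
    by (rule nn_integral_W_meas[symmetric]) measurable
  finally show ?thesis by simp
qed

text \<open>Substitution \<open>u = 1 - 2 * t\<close>. The power of 2 collects \<open>i + j\<close>
  from the two factors, \<open>2 * c\<close> from the weight \<open>4 * t * (1 - t)\<close>, and 1
  from the Jacobian.\<close>

lemma nn_integral_W_meas_Beta:
  assumes c: "c > -1"
  shows "(\<integral>\<^sup>+u. ennreal ((1 - u) ^ i * (1 + u) ^ j) \<partial>W_meas c)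
    = ennreal (2 powr (real i + real j + 2 * c + 1) * Beta (real i + c + 1) (real j + c + 1))"
proof -
  let ?k = "\<lambda>u. ennreal (indicator {-1<..<1} u * (1 - u\<^sup>2) powr c) * ennreal ((1 - u) ^ i * (1 + u) ^ j)"
  let ?p = "2 powr (real i + real j + 2 * c)"
  have k: "?k (1 + - 2 * t) = ennreal ?p * ennreal (indicator {0..1} t * (t powr (real i + c) * (1 - t) powr (real j + c)))"
    for t
  proof (cases "0 < t \<and> t < 1")
    case True
    then have t: "t > 0" "1 - t > 0" by auto
    have "1 - (1 - 2 * t)\<^sup>2 = 2\<^sup>2 * (t * (1 - t))" by (simp add: power2_eq_square algebra_simps)
    moreover have "(2\<^sup>2 * (t * (1 - t))) powr c = 2 powr (2 * c) * (t powr c * (1 - t) powr c)"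
      using t by (simp add: powr_mult powr_powr[symmetric])
    moreover have "(1 - (1 - 2 * t)) ^ i = 2 powr real i * t powr real i"
      using t by (simp add: powr_realpow power_mult_distrib)
    moreover have "(1 + (1 - 2 * t)) ^ j = 2 powr real j * (1 - t) powr real j"
    proof -
      have "1 + (1 - 2 * t) = 2 * (1 - t)" by simp
      then show ?thesis using t by (simp only: powr_realpow power_mult_distrib)
    qed
    ultimately have "(1 - (1 - 2 * t)\<^sup>2) powr c * ((1 - (1 - 2 * t)) ^ i * (1 + (1 - 2 * t)) ^ j)
      = ?p * (t powr (real i + c) * (1 - t) powr (real j + c))"
      by (simp only:) (simp add: powr_add)
    then show ?thesis using True t by (simp add: indicator_def ennreal_mult[symmetric])
  next
    case False
    \<comment> \<open>At \<open>t = 0\<close> and \<open>t = 1\<close> the left side vanishes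
      because the interval for \<open>u\<close> is open, the right side because
      \<open>0 powr x = 0\<close>.\<close>
    then consider "t < 0" | "t = 0" | "t = 1" | "t > 1" by linarith
    then show ?thesis by cases (auto simp: indicator_def)
  qed
  have "(\<integral>\<^sup>+t. indicator {0..1} t * (t powr (real i + c) * (1 - t) powr (real j + c)) \<partial>lborel)
      = ennreal (Beta (real i + c + 1) (real j + c + 1))"
    using has_integral_Beta_real[of "real i + c + 1" "real j + c + 1"] c
    by (intro nn_integral_has_integral_lebesgue) auto
  moreover have "(\<integral>\<^sup>+u. ?k u \<partial>lborel) = ennreal 2 * (\<integral>\<^sup>+t. ?k (1 + - 2 * t) \<partial>lborel)"
    by (subst nn_integral_real_affine[where c = "-2" and t = 1]) auto
  ultimately have "(\<integral>\<^sup>+u. ?k u \<partial>lborel) = ennreal 2 * (ennreal ?p * ennreal (Beta (real i + c + 1) (real j + c + 1)))"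
    unfolding k by (subst (asm) nn_integral_cmult) auto
  also have "\<dots> = ennreal (2 * (?p * Beta (real i + c + 1) (real j + c + 1)))"
    by (simp only: ennreal_mult'[symmetric] zero_le_numeral powr_ge_zero)
  also have "2 * (?p * Beta (real i + c + 1) (real j + c + 1))
      = 2 powr (real i + real j + 2 * c + 1) * Beta (real i + c + 1) (real j + c + 1)"
    by (simp add: powr_add)
  finally show ?thesis by (subst nn_integral_W_meas) auto
qed

lemma Beta_real_pos: "a > 0 \<Longrightarrow> b > 0 \<Longrightarrow> Beta a b > (0::real)"
  by (simp add: Beta_def Gamma_real_pos)

lemma has_bochner_integral_W_meas_Beta:
  assumes c: "c > -1"
  shows "has_bochner_integral (W_meas c) (\<lambda>u. (1 - u) ^ i * (1 + u) ^ j)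
    (2 powr (real i + real j + 2 * c + 1) * Beta (real i + c + 1) (real j + c + 1))"
proof (rule has_bochner_integral_nn_integral)
  show "AE u in W_meas c. 0 \<le> (1 - u) ^ i * (1 + u) ^ j"
    using AE_W_meas[of c] by eventually_elim auto
qed (use nn_integral_W_meas_Beta[OF c] Beta_real_pos[of "real i + c + 1" "real j + c + 1"] c in \<open>auto intro: less_imp_le\<close>)

lemma finite_measure_W_meas:
  assumes "c > -1"
  shows "finite_measure (W_meas c)"
  using nn_integral_W_meas_Beta[OF assms, of 0 0] by (intro finite_measureI) simp

lemma finite_measure_E_meas:
  assumes "\<gamma> > -1"
  shows "finite_measure (E_meas \<gamma>)"
proof (rule finite_measureI)
  interpret W: finite_measure "W_meas \<gamma>" using assms by (rule finite_measure_W_meas)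
  interpret V: finite_measure "W_meas (\<gamma> + 1/2)" using assms by (intro finite_measure_W_meas) simp
  have "emeasure (E_meas \<gamma>) (space (E_meas \<gamma>)) = emeasure (W_meas \<gamma>) UNIV * emeasure (W_meas (\<gamma> + 1/2)) UNIV"
    using nn_integral_E_meas_chords[of "\<lambda>_. 1" \<gamma>] by simp
  also have "\<dots> \<noteq> \<infinity>"
    using W.emeasure_finite[of UNIV] V.emeasure_finite[of UNIV] by (simp add: ennreal_mult_eq_top_iff)
  finally show "emeasure (E_meas \<gamma>) (space (E_meas \<gamma>)) \<noteq> \<infinity>" .
qed

section \<open>The measure on chords and Santalo's formula\<close>

lemma nn_integral_B_meas:
  assumes [measurable]: "h \<in> borel_measurable (borel \<Otimes>\<^sub>M borel)"
  shows "(\<integral>\<^sup>+p. h p \<partial>B_meas \<gamma>) = (\<integral>\<^sup>+v. \<integral>\<^sup>+y. h (v, y) \<partial>W_meas (\<gamma> + 1/2) \<partial>C_meas)"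
  unfolding B_meas_def by (subst W_meas.nn_integral_fst[symmetric]) auto

lemma finite_measure_B_meas:
  assumes "\<gamma> > -1"
  shows "finite_measure (B_meas \<gamma>)"
proof (rule finite_measureI)
  interpret V: finite_measure "W_meas (\<gamma> + 1/2)" using assms by (intro finite_measure_W_meas) simp
  have "emeasure (B_meas \<gamma>) (space (B_meas \<gamma>)) = emeasure (W_meas (\<gamma> + 1/2)) UNIV * emeasure C_meas UNIV"
    using nn_integral_B_meas[of "\<lambda>_. 1" \<gamma>] by simp
  also have "\<dots> \<noteq> \<infinity>"
    using V.emeasure_finite[of UNIV] C_meas.emeasure_finite[of UNIV] by (simp add: ennreal_mult_eq_top_iff)
  finally show "emeasure (B_meas \<gamma>) (space (B_meas \<gamma>)) \<noteq> \<infinity>" .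
qed

lemma AE_B_meas: "AE p in B_meas \<gamma>. cmod (fst p) = 1 \<and> -1 < snd p \<and> snd p < 1"
proof -
  interpret pair_sigma_finite C_meas "W_meas (\<gamma> + 1/2)"
    by (intro pair_sigma_finite.intro C_meas.sigma_finite_measure_axioms W_meas.sigma_finite_measure_axioms)
  show ?thesis unfolding B_meas_def
  proof (rule AE_pair_measure)
    show "AE v in C_meas. AE y in W_meas (\<gamma> + 1/2). cmod (fst (v, y)) = 1 \<and> -1 < snd (v, y) \<and> snd (v, y) < 1"
      using AE_C_meas by eventually_elim (use AE_W_meas in simp)
  qed measurable
qed

text \<open>The chord enters the disk at \<open>u = -1\<close>, in the point
  \<open>v * cis (- arcsin y)\<close>, and runs in direction \<open>- v\<close>. For
  \<open>(v, y) = tauG (w, a)\<close> that entry point is \<open>w\<close>, in agreement with the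
  boundary parametrization by \<open>beta\<close>.\<close>

definition chord :: "(complex \<times> real) \<times> real \<Rightarrow> complex" where
  "chord q = - fst (fst q) * Complex (snd q * sqrt (1 - (snd (fst q))\<^sup>2)) (snd (fst q))"

lemma measurable_chord [measurable]: "chord \<in> borel_measurable ((borel \<Otimes>\<^sub>M borel) \<Otimes>\<^sub>M borel)"
  unfolding chord_def[abs_def] by measurable

text \<open>For fixed \<open>v\<close>, the map is the chord parametrization of the disk followed by
  the rotation by \<open>- v\<close>, which preserves \<open>E_meas\<close>. A chord with a position
  on it is thus exchanged for a direction and a point.\<close>

lemma Santalo:
  assumes "\<gamma> > -1"
  shows "distr (B_meas \<gamma> \<Otimes>\<^sub>M W_meas \<gamma>) (C_meas \<Otimes>\<^sub>M E_meas \<gamma>) (\<lambda>q. (fst (fst q), chord q))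
    = C_meas \<Otimes>\<^sub>M E_meas \<gamma>"
proof (rule measure_eqI_nn_integral)
  interpret E: finite_measure "E_meas \<gamma>" by (rule finite_measure_E_meas[OF assms])
  fix h :: "complex \<times> complex \<Rightarrow> ennreal"
  assume "h \<in> borel_measurable (distr (B_meas \<gamma> \<Otimes>\<^sub>M W_meas \<gamma>) (C_meas \<Otimes>\<^sub>M E_meas \<gamma>) (\<lambda>q. (fst (fst q), chord q)))"
  then have [measurable]: "h \<in> borel_measurable (borel \<Otimes>\<^sub>M borel)"
    by (simp add: measurable_def space_pair_measure cong: sets_pair_measure_cong)
  have "(\<integral>\<^sup>+p. h p \<partial>(C_meas \<Otimes>\<^sub>M E_meas \<gamma>)) = (\<integral>\<^sup>+v. \<integral>\<^sup>+z. h (v, z) \<partial>E_meas \<gamma> \<partial>C_meas)"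
    by (rule E.nn_integral_fst[symmetric]) measurable
  also have "\<dots> = (\<integral>\<^sup>+v. \<integral>\<^sup>+y. \<integral>\<^sup>+u. h (v, chord ((v, y), u)) \<partial>W_meas \<gamma> \<partial>W_meas (\<gamma> + 1/2) \<partial>C_meas)"
  proof (rule nn_integral_cong_AE)
    show "AE v in C_meas. (\<integral>\<^sup>+z. h (v, z) \<partial>E_meas \<gamma>)
      = (\<integral>\<^sup>+y. \<integral>\<^sup>+u. h (v, chord ((v, y), u)) \<partial>W_meas \<gamma> \<partial>W_meas (\<gamma> + 1/2))"
      using AE_C_meas
    proof eventually_elim
      fix v assume "cmod v = 1"
      then have "(\<integral>\<^sup>+z. h (v, z) \<partial>E_meas \<gamma>) = (\<integral>\<^sup>+z. h (v, - v * z) \<partial>E_meas \<gamma>)"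
        by (intro nn_integral_E_meas_mult[where h = "\<lambda>z. h (v, z)", symmetric]) auto
      also have "\<dots> = (\<integral>\<^sup>+y. \<integral>\<^sup>+u. h (v, - v * Complex (u * sqrt (1 - y\<^sup>2)) y) \<partial>W_meas \<gamma> \<partial>W_meas (\<gamma> + 1/2))"
        by (intro nn_integral_E_meas_chords[where h = "\<lambda>z. h (v, - v * z)", symmetric]) measurable
      finally show "(\<integral>\<^sup>+z. h (v, z) \<partial>E_meas \<gamma>)
        = (\<integral>\<^sup>+y. \<integral>\<^sup>+u. h (v, chord ((v, y), u)) \<partial>W_meas \<gamma> \<partial>W_meas (\<gamma> + 1/2))"
        by (simp add: chord_def)
    qed
  qed
  also have "\<dots> = (\<integral>\<^sup>+p. \<integral>\<^sup>+u. h (fst p, chord (p, u)) \<partial>W_meas \<gamma> \<partial>B_meas \<gamma>)"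
    by (subst nn_integral_B_meas) auto
  also have "\<dots> = (\<integral>\<^sup>+q. h (fst (fst q), chord q) \<partial>(B_meas \<gamma> \<Otimes>\<^sub>M W_meas \<gamma>))"
    by (subst W_meas.nn_integral_fst[symmetric]) auto
  also have "\<dots> = (\<integral>\<^sup>+p. h p \<partial>distr (B_meas \<gamma> \<Otimes>\<^sub>M W_meas \<gamma>) (C_meas \<Otimes>\<^sub>M E_meas \<gamma>) (\<lambda>q. (fst (fst q), chord q)))"
    by (rule nn_integral_distr[symmetric]) measurable
  finally show "(\<integral>\<^sup>+p. h p \<partial>distr (B_meas \<gamma> \<Otimes>\<^sub>M W_meas \<gamma>) (C_meas \<Otimes>\<^sub>M E_meas \<gamma>) (\<lambda>q. (fst (fst q), chord q)))
    = (\<integral>\<^sup>+p. h p \<partial>(C_meas \<Otimes>\<^sub>M E_meas \<gamma>))" by simp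
qed simp

section \<open>Positions on a chord in terms of hyperbolic arc length\<close>

lemma range_tanh_shift: "range (\<lambda>t. tanh (t + d :: real)) = {-1<..<1}"
proof (intro equalityI subsetI)
  fix u :: real assume "u \<in> {-1<..<1}"
  define x where "x = sqrt ((1 + u) / (1 - u))"
  have "x > 0" "x\<^sup>2 = (1 + u) / (1 - u)"
    using \<open>u \<in> {-1<..<1}\<close> by (auto simp: x_def)
  then have "tanh (ln x - d + d) = u"
    using \<open>u \<in> {-1<..<1}\<close> by (simp add: tanh_ln_real) (simp add: field_simps)
  then show "u \<in> range (\<lambda>t. tanh (t + d))" by (metis rangeI)
qed (use tanh_real_lt_1 tanh_real_gt_neg1 in auto)

lemma measurable_tanh [measurable]: "(tanh :: real \<Rightarrow> real) \<in> borel_measurable borel"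
  by (intro borel_measurable_continuous_onI continuous_intros) simp

text \<open>The derivative \<open>1 - tanh\<^sup>2\<close> raises the exponent from \<open>c\<close>
  to \<open>c + 1\<close>. The free shift \<open>d\<close> accommodates the different origins of arc
  length on a geodesic and of position on its chord.\<close>

lemma W_meas_tanh:
  "W_meas c = distr (density lborel (\<lambda>t. ennreal ((1 - (tanh (t + d))\<^sup>2) powr (c + 1)))) borel (\<lambda>t. tanh (t + d))"
proof (rule measure_eqI_nn_integral)
  fix h :: "real \<Rightarrow> ennreal" assume "h \<in> borel_measurable (W_meas c)"
  then have [measurable]: "h \<in> borel_measurable borel" by simp
  have pos: "1 - (tanh t)\<^sup>2 > 0" for t :: real
    using tanh_real_lt_1[of t] tanh_real_gt_neg1[of t] by (simp add: abs_square_less_1 abs_less_iff)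
  have "(\<integral>\<^sup>+u. h u \<partial>W_meas c) = (\<integral>\<^sup>+u. ennreal ((1 - u\<^sup>2) powr c) * h u * indicator (range (\<lambda>t. tanh (t + d))) u \<partial>lborel)"
    unfolding range_tanh_shift
    by (subst nn_integral_W_meas) (auto simp: indicator_def intro!: nn_integral_cong)
  also have "\<dots> = (\<integral>\<^sup>+t. ennreal ((1 - (tanh (t + d))\<^sup>2) powr c) * h (tanh (t + d)) * ennreal \<bar>1 - (tanh (t + d))\<^sup>2\<bar> * indicator UNIV t \<partial>lborel)"
  proof (rule nn_integral_substitution_inj[symmetric])
    show "inj (\<lambda>t. tanh (t + d))" by (auto simp: inj_on_def)
    show "((\<lambda>t. tanh (t + d)) has_real_derivative 1 - (tanh (t + d))\<^sup>2) (at t)" for t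
      by (auto intro!: derivative_eq_intros)
  qed (auto simp: range_tanh_shift)
  also have "\<dots> = (\<integral>\<^sup>+t. ennreal ((1 - (tanh (t + d))\<^sup>2) powr (c + 1)) * h (tanh (t + d)) \<partial>lborel)"
    using pos by (intro nn_integral_cong) (simp add: powr_add ennreal_mult mult_ac less_imp_le)
  finally show "(\<integral>\<^sup>+u. h u \<partial>W_meas c)
    = (\<integral>\<^sup>+u. h u \<partial>distr (density lborel (\<lambda>t. ennreal ((1 - (tanh (t + d))\<^sup>2) powr (c + 1)))) borel (\<lambda>t. tanh (t + d)))"
    by (simp add: nn_integral_distr nn_integral_density)
qed simp

section \<open>The space of hyperbolic geodesics in chord coordinates\<close>

lemma muH_pos [simp]: "muH a > 0"
  by (simp add: muH_def add_pos_nonneg)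

lemma measurable_muH [measurable]: "muH \<in> borel_measurable borel"
  unfolding muH_def by measurable

lemma measurable_arctan [measurable]: "(arctan :: real \<Rightarrow> real) \<in> borel_measurable borel"
  by (intro borel_measurable_continuous_onI continuous_intros)

lemma sin_arctan_muH: "sin (arctan a) = a * muH a"
  and cos_arctan_muH: "cos (arctan a) = muH a"
  by (simp_all add: muH_def sin_arctan cos_arctan)

lemma muH_sq: "(muH a)\<^sup>2 = 1 - (a * muH a)\<^sup>2"
  using sin_cos_squared_add[of "arctan a"] by (simp add: sin_arctan_muH cos_arctan_muH)

lemma has_real_derivative_a_muH: "((\<lambda>a. a * muH a) has_real_derivative muH a ^ 3) (at a)"
proof -
  have "((\<lambda>a. sin (arctan a)) has_real_derivative cos (arctan a) * inverse (1 + a\<^sup>2)) (at a)"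
    by (auto intro!: derivative_eq_intros)
  moreover have "inverse (1 + a\<^sup>2) = (muH a)\<^sup>2"
    by (simp add: muH_def power_divide inverse_eq_divide)
  ultimately show ?thesis
    by (simp add: sin_arctan_muH cos_arctan_muH power3_eq_cube power2_eq_square mult_ac)
qed

lemma range_a_muH: "range (\<lambda>a. a * muH a) = {-1<..<1}"
proof (intro equalityI subsetI)
  fix y :: real assume "y \<in> {-1<..<1}"
  then have "cos (arcsin y) > 0" using cos_gt_zero_pi[of "arcsin y"] arcsin_lt_bounded[of y] by simp
  then have "arctan (tan (arcsin y)) = arcsin y"
    using \<open>y \<in> {-1<..<1}\<close> arcsin_lt_bounded[of y] by (intro arctan_tan) auto
  then have "tan (arcsin y) * muH (tan (arcsin y)) = y"
    using \<open>y \<in> {-1<..<1}\<close> by (simp add: sin_arctan_muH[symmetric])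
  then show "y \<in> range (\<lambda>a. a * muH a)" by (metis rangeI)
next
  fix y assume "y \<in> range (\<lambda>a. a * muH a)"
  then obtain a where a: "y = a * muH a" by auto
  have "(muH a)\<^sup>2 > 0" by (rule zero_less_power) simp
  then have "y\<^sup>2 < 1" unfolding muH_sq a by simp
  then show "y \<in> {-1<..<1}" by (simp add: abs_square_less_1 abs_less_iff)
qed

text \<open>With \<open>y = a * muH a\<close> the weight is muH^(2 gamma + 1) and dy = muH^3 da,
  which add up to the exponent \<open>2*\<gamma>+4\<close>.\<close>

lemma nn_integral_W_meas_muH:
  assumes [measurable]: "h \<in> borel_measurable borel"
  shows "(\<integral>\<^sup>+y. h y \<partial>W_meas (\<gamma> + 1/2)) = (\<integral>\<^sup>+a. ennreal (muH a powr (2*\<gamma>+4)) * h (a * muH a) \<partial>lborel)"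
proof -
  have "(\<integral>\<^sup>+u. h u \<partial>W_meas (\<gamma> + 1/2)) = (\<integral>\<^sup>+u. ennreal ((1 - u\<^sup>2) powr (\<gamma> + 1/2)) * h u * indicator (range (\<lambda>a. a * muH a)) u \<partial>lborel)"
    unfolding range_a_muH
    by (subst nn_integral_W_meas) (auto simp: indicator_def intro!: nn_integral_cong)
  also have "\<dots> = (\<integral>\<^sup>+a. ennreal ((1 - (a * muH a)\<^sup>2) powr (\<gamma> + 1/2)) * h (a * muH a) * ennreal \<bar>muH a ^ 3\<bar> * indicator UNIV a \<partial>lborel)"
  proof (rule nn_integral_substitution_inj[symmetric])
    show "inj (\<lambda>a. a * muH a)"
    proof (rule injI)
      fix a b assume "a * muH a = b * muH b"
      then have "sin (arctan a) = sin (arctan b)" by (simp add: sin_arctan_muH)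
      then have "arctan a = arctan b"
        using arctan_bounded[of a] arctan_bounded[of b] by (auto dest: sin_inj_pi[rotated 4])
      then show "a = b" by (metis tan_arctan)
    qed
  qed (auto simp: range_a_muH has_real_derivative_a_muH)
  also have "\<dots> = (\<integral>\<^sup>+a. ennreal (muH a powr (2*\<gamma>+4)) * h (a * muH a) \<partial>lborel)"
  proof (intro nn_integral_cong)
    fix a
    have "(1 - (a * muH a)\<^sup>2) powr (\<gamma> + 1/2) * \<bar>muH a ^ 3\<bar> = (muH a powr 2) powr (\<gamma> + 1/2) * muH a powr 3"
      using muH_pos[of a, THEN less_imp_le] by (simp add: muH_sq[symmetric])
    also have "\<dots> = muH a powr (2*\<gamma>+4)"
      by (simp only: powr_powr powr_add[symmetric]) (simp add: algebra_simps)
    finally have *: "(1 - (a * muH a)\<^sup>2) powr (\<gamma> + 1/2) * \<bar>muH a ^ 3\<bar> = muH a powr (2*\<gamma>+4)" .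
    show "ennreal ((1 - (a * muH a)\<^sup>2) powr (\<gamma> + 1/2)) * h (a * muH a) * ennreal \<bar>muH a ^ 3\<bar> * indicator UNIV a
       = ennreal (muH a powr (2*\<gamma>+4)) * h (a * muH a)"
      unfolding *[symmetric] ennreal_mult[OF powr_ge_zero abs_ge_zero] by (simp only: indicator_UNIV mult_ac mult_1)
  qed
  finally show ?thesis .
qed

lemma sets_G_meas [measurable_cong]: "sets (G_meas \<gamma>) = sets (borel \<Otimes>\<^sub>M borel)"
  by (simp only: G_meas_def sets_distr borel_prod)

lemma space_G_meas [simp]: "space (G_meas \<gamma>) = UNIV"
  by (simp add: G_meas_def)

lemma nn_integral_G_meas:
  assumes [measurable]: "h \<in> borel_measurable (borel \<Otimes>\<^sub>M borel)"
  shows "(\<integral>\<^sup>+p. h p \<partial>G_meas \<gamma>) = (\<integral>\<^sup>+v. \<integral>\<^sup>+a. ennreal (muH a powr (-2*\<gamma>)) * h (v, a) \<partial>lborel \<partial>C_meas)"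
proof -
  have m [measurable]: "(\<lambda>(b, a). ennreal (indicator {0..2*pi} b * muH a powr (-2*\<gamma>))) \<in> borel_measurable (lborel \<Otimes>\<^sub>M lborel)"
    by measurable
  have "(\<integral>\<^sup>+p. h p \<partial>G_meas \<gamma>) = (\<integral>\<^sup>+p. h (cis (fst p), snd p)
      \<partial>density (lborel \<Otimes>\<^sub>M lborel) (\<lambda>(b, a). ennreal (indicator {0..2*pi} b * muH a powr (-2*\<gamma>))))"
    unfolding G_meas_def lborel_prod[symmetric] borel_prod[symmetric]
    by (subst nn_integral_distr) (auto simp: case_prod_beta)
  also have "\<dots> = (\<integral>\<^sup>+p. ennreal (indicator {0..2*pi} (fst p) * muH (snd p) powr (-2*\<gamma>)) * h (cis (fst p), snd p) \<partial>(lborel \<Otimes>\<^sub>M lborel))"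
    by (subst nn_integral_density) (auto simp: case_prod_beta)
  also have "\<dots> = (\<integral>\<^sup>+b. \<integral>\<^sup>+a. ennreal (indicator {0..2*pi} b * muH a powr (-2*\<gamma>)) * h (cis b, a) \<partial>lborel \<partial>lborel)"
    by (subst lborel.nn_integral_fst[symmetric]) auto
  also have "\<dots> = (\<integral>\<^sup>+b. (\<integral>\<^sup>+a. ennreal (muH a powr (-2*\<gamma>)) * h (cis b, a) \<partial>lborel) * indicator {0..2*pi} b \<partial>lborel)"
    by (intro nn_integral_cong) (simp add: indicator_def)
  also have "\<dots> = (\<integral>\<^sup>+v. \<integral>\<^sup>+a. ennreal (muH a powr (-2*\<gamma>)) * h (v, a) \<partial>lborel \<partial>C_meas)"
    by (subst nn_integral_C_meas) auto
  finally show ?thesis .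
qed

lemma AE_G_meas: "AE p in G_meas \<gamma>. cmod (fst p) = 1"
proof (rule AE_I')
  let ?A = "{p :: complex \<times> real. cmod (fst p) \<noteq> 1}"
  have "Measurable.pred (borel \<Otimes>\<^sub>M borel) (\<lambda>p :: complex \<times> real. cmod (fst p) \<noteq> 1)" by measurable
  then have [measurable]: "?A \<in> sets (borel \<Otimes>\<^sub>M borel)" by (simp add: pred_def space_pair_measure)
  have "emeasure (G_meas \<gamma>) ?A = (\<integral>\<^sup>+p. indicator ?A p \<partial>G_meas \<gamma>)"
    by (simp add: sets_G_meas)
  also have "\<dots> = (\<integral>\<^sup>+v. \<integral>\<^sup>+a. ennreal (muH a powr (-2*\<gamma>)) * indicator ?A (v, a) \<partial>lborel \<partial>C_meas)"
    by (rule nn_integral_G_meas) measurable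
  also have "\<dots> = (\<integral>\<^sup>+v. 0 \<partial>C_meas)"
    by (rule nn_integral_cong_AE) (use AE_C_meas in eventually_elim, auto)
  finally show "?A \<in> null_sets (G_meas \<gamma>)" by (auto simp: null_sets_def sets_G_meas)
qed auto

text \<open>With \<open>alpha = arctan a\<close> this is
  \<open>(e^(i (beta + alpha)), sin alpha)\<close>, the chord coordinates of the geodesic.\<close>

definition tauG :: "complex \<times> real \<Rightarrow> complex \<times> real" where
  "tauG = (\<lambda>(w, a). (w * cis (arctan a), a * muH a))"

lemma measurable_tauG [measurable]: "tauG \<in> borel \<Otimes>\<^sub>M borel \<rightarrow>\<^sub>M borel \<Otimes>\<^sub>M borel"
  unfolding tauG_def by measurable

text \<open>The exponents add up, -2 gamma + 2(2 gamma + 2) = 2 gamma + 4. The rotation by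
  \<open>cis (arctan a)\<close> is harmless because for fixed \<open>a\<close> the circle measure is
  invariant; Tonelli moves the circle integral inside and back out.\<close>

lemma B_meas_tauG:
  "distr (density (G_meas \<gamma>) (\<lambda>p. ennreal ((muH (snd p) powr (2*\<gamma>+2))\<^sup>2))) (B_meas \<gamma>) tauG = B_meas \<gamma>"
proof (rule measure_eqI_nn_integral)
  fix h :: "complex \<times> real \<Rightarrow> ennreal"
  assume "h \<in> borel_measurable (distr (density (G_meas \<gamma>) (\<lambda>p. ennreal ((muH (snd p) powr (2*\<gamma>+2))\<^sup>2))) (B_meas \<gamma>) tauG)"
  then have [measurable]: "h \<in> borel_measurable (borel \<Otimes>\<^sub>M borel)"
    by (simp add: measurable_def space_pair_measure sets_B_meas)
  have "(\<integral>\<^sup>+p. h p \<partial>B_meas \<gamma>) = (\<integral>\<^sup>+v. \<integral>\<^sup>+a. ennreal (muH a powr (2*\<gamma>+4)) * h (v, a * muH a) \<partial>lborel \<partial>C_meas)"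
    by (simp add: nn_integral_B_meas nn_integral_W_meas_muH)
  also have "\<dots> = (\<integral>\<^sup>+a. \<integral>\<^sup>+v. ennreal (muH a powr (2*\<gamma>+4)) * h (v, a * muH a) \<partial>C_meas \<partial>lborel)"
    by (intro pair_sigma_finite.Fubini'[symmetric] pair_sigma_finite.intro sigma_finite_lborel
        C_meas.sigma_finite_measure_axioms) measurable
  also have "\<dots> = (\<integral>\<^sup>+a. \<integral>\<^sup>+v. ennreal (muH a powr (2*\<gamma>+4)) * h (v * cis (arctan a), a * muH a) \<partial>C_meas \<partial>lborel)"
  proof (rule nn_integral_cong)
    fix a
    show "(\<integral>\<^sup>+v. ennreal (muH a powr (2*\<gamma>+4)) * h (v, a * muH a) \<partial>C_meas)
      = (\<integral>\<^sup>+v. ennreal (muH a powr (2*\<gamma>+4)) * h (v * cis (arctan a), a * muH a) \<partial>C_meas)"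
      using nn_integral_C_meas_mult[of "cis (arctan a)" "\<lambda>v. ennreal (muH a powr (2*\<gamma>+4)) * h (v, a * muH a)"]
      by (simp add: mult.commute[of "cis (arctan a)"])
  qed
  also have "\<dots> = (\<integral>\<^sup>+v. \<integral>\<^sup>+a. ennreal (muH a powr (2*\<gamma>+4)) * h (v * cis (arctan a), a * muH a) \<partial>lborel \<partial>C_meas)"
    by (intro pair_sigma_finite.Fubini' pair_sigma_finite.intro sigma_finite_lborel
        C_meas.sigma_finite_measure_axioms) measurable
  also have "\<dots> = (\<integral>\<^sup>+p. ennreal ((muH (snd p) powr (2*\<gamma>+2))\<^sup>2) * h (tauG p) \<partial>G_meas \<gamma>)"
  proof -
    have "ennreal (muH a powr (-2*\<gamma>)) * ennreal ((muH a powr (2*\<gamma>+2))\<^sup>2) = ennreal (muH a powr (2*\<gamma>+4))" for a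
      by (simp add: ennreal_mult[symmetric] powr_add[symmetric] power2_eq_square)
    then show ?thesis
      by (subst nn_integral_G_meas) (auto simp: tauG_def mult.assoc[symmetric])
  qed
  also have "\<dots> = (\<integral>\<^sup>+p. h p \<partial>distr (density (G_meas \<gamma>) (\<lambda>p. ennreal ((muH (snd p) powr (2*\<gamma>+2))\<^sup>2))) (B_meas \<gamma>) tauG)"
    by (subst nn_integral_distr) (auto simp: nn_integral_density)
  finally show "(\<integral>\<^sup>+p. h p \<partial>distr (density (G_meas \<gamma>) (\<lambda>p. ennreal ((muH (snd p) powr (2*\<gamma>+2))\<^sup>2))) (B_meas \<gamma>) tauG)
    = (\<integral>\<^sup>+p. h p \<partial>B_meas \<gamma>)" by simp
qed simp

section \<open>The Klein model\<close>

lemma nn_integral_lborel_complex_slope: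
  assumes [measurable]: "h \<in> borel_measurable borel"
  shows "(\<integral>\<^sup>+z. h z \<partial>lborel) = (\<integral>\<^sup>+s. \<integral>\<^sup>+x. ennreal \<bar>x\<bar> * h (Complex x (x * s)) \<partial>lborel \<partial>lborel)"
proof -
  have "(\<integral>\<^sup>+z. h z \<partial>lborel) = (\<integral>\<^sup>+x. \<integral>\<^sup>+y. h (Complex x y) \<partial>lborel \<partial>lborel)"
    by (rule nn_integral_lborel_complex) measurable
  also have "\<dots> = (\<integral>\<^sup>+x. \<integral>\<^sup>+s. ennreal \<bar>x\<bar> * h (Complex x (x * s)) \<partial>lborel \<partial>lborel)"
  proof (rule nn_integral_cong_AE)
    show "AE x in lborel. (\<integral>\<^sup>+y. h (Complex x y) \<partial>lborel) = (\<integral>\<^sup>+s. ennreal \<bar>x\<bar> * h (Complex x (x * s)) \<partial>lborel)"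
      using AE_lborel_singleton[of 0]
    proof eventually_elim
      fix x :: real assume "x \<noteq> 0"
      then show "(\<integral>\<^sup>+y. h (Complex x y) \<partial>lborel) = (\<integral>\<^sup>+s. ennreal \<bar>x\<bar> * h (Complex x (x * s)) \<partial>lborel)"
        by (subst nn_integral_real_affine[where c = x and t = 0]) (auto simp: nn_integral_cmult)
    qed
  qed
  also have "\<dots> = (\<integral>\<^sup>+s. \<integral>\<^sup>+x. ennreal \<bar>x\<bar> * h (Complex x (x * s)) \<partial>lborel \<partial>lborel)"
    by (rule lborel_pair.Fubini'[symmetric]) measurable
  finally show ?thesis .
qed

lemma measurable_Phi [measurable]: "Phi \<in> borel_measurable borel"
  unfolding Phi_def[abs_def] by measurable

lemma measurable_xH [measurable]: "xH \<in> borel_measurable borel"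
  unfolding xH_def[abs_def] by measurable

lemma measurable_cH [measurable]: "cH \<in> borel_measurable borel"
  unfolding cH_def[abs_def] by measurable

lemma sets_D_meas [measurable_cong, simp]: "sets (D_meas \<gamma>) = sets borel"
  and space_D_meas [simp]: "space (D_meas \<gamma>) = UNIV"
  by (simp_all add: D_meas_def)

lemma AE_D_meas: "AE z in D_meas \<gamma>. cmod z < 1"
  unfolding D_meas_def by (subst AE_density) (auto simp: indicator_def)

text \<open>Inverse of \<open>Phi\<close> on the open disk: there
  \<open>1 + sqrt (1 - (cmod (Phi z))\<^sup>2)\<close> equals
  \<open>1 + xH z = 2 / (1 + (cmod z)\<^sup>2)\<close>.\<close>

definition Psi :: "complex \<Rightarrow> complex" where
  "Psi z = z / of_real (1 + sqrt (1 - (cmod z)\<^sup>2))"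

lemma measurable_Psi [measurable]: "Psi \<in> borel_measurable borel"
  unfolding Psi_def[abs_def] by measurable

lemma cmod_Phi: "cmod (Phi z) = 2 * cmod z / (1 + (cmod z)\<^sup>2)"
proof -
  have "1 + (cmod z)\<^sup>2 > 0" by (simp add: add_pos_nonneg)
  then show ?thesis unfolding Phi_def by (simp only: norm_divide norm_mult norm_of_real) simp
qed

lemma one_minus_cmod_Phi_sq: "1 - (cmod (Phi z))\<^sup>2 = (xH z)\<^sup>2"
proof -
  define r where "r = (cmod z)\<^sup>2"
  have r: "1 + r > 0" by (simp add: r_def add_pos_nonneg)
  have "(cmod (Phi z))\<^sup>2 = 4 * r / (1 + r)\<^sup>2"
    by (simp add: cmod_Phi power_divide power_mult_distrib r_def)
  then have "1 - (cmod (Phi z))\<^sup>2 = ((1 + r)\<^sup>2 - 4 * r) / (1 + r)\<^sup>2"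
    using r by (simp add: field_simps)
  also have "(1 + r)\<^sup>2 - 4 * r = (1 - r)\<^sup>2" by (simp add: power2_eq_square algebra_simps)
  finally show ?thesis by (simp add: xH_def r_def power_divide)
qed

lemma xH_pos: "cmod z < 1 \<Longrightarrow> xH z > 0"
  unfolding xH_def by (intro divide_pos_pos) (auto simp: abs_square_less_1 add_pos_nonneg)

lemma cmod_Phi_le: "cmod (Phi z) \<le> 1"
proof -
  have "(cmod (Phi z))\<^sup>2 \<le> 1" using one_minus_cmod_Phi_sq[of z] zero_le_power2[of "xH z"] by linarith
  then show ?thesis by (simp add: abs_square_le_1)
qed

lemma cmod_Phi_less: "cmod z < 1 \<Longrightarrow> cmod (Phi z) < 1"
proof -
  assume "cmod z < 1"
  then have "(xH z)\<^sup>2 > 0" using xH_pos[of z] by simp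
  then have "(cmod (Phi z))\<^sup>2 < 1" using one_minus_cmod_Phi_sq[of z] by linarith
  then show ?thesis by (simp add: abs_square_less_1)
qed

lemma Psi_Phi:
  assumes "cmod z < 1"
  shows "Psi (Phi z) = z"
proof -
  have pos: "1 + (cmod z)\<^sup>2 > 0" by (simp add: add_pos_nonneg)
  have "sqrt (1 - (cmod (Phi z))\<^sup>2) = xH z"
    using xH_pos[OF assms] by (simp add: one_minus_cmod_Phi_sq)
  moreover have "1 + xH z = 2 / (1 + (cmod z)\<^sup>2)"
    using pos by (simp add: xH_def field_simps)
  ultimately have "Psi (Phi z) = Phi z / of_real (2 / (1 + (cmod z)\<^sup>2))"
    by (simp add: Psi_def)
  moreover have "(of_real (1 + (cmod z)\<^sup>2) :: complex) \<noteq> 0"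
    using pos by (simp only: of_real_eq_0_iff)
  ultimately show ?thesis by (simp add: Phi_def del: of_real_add of_real_power)
qed

text \<open>\<open>Phi\<close> on the line of slope \<open>s\<close> in the coordinate
  \<open>x\<close>, with \<open>q = 1 + s\<^sup>2\<close>, so that \<open>x\<^sup>2 * q\<close> is
  the squared modulus. The open unit disk corresponds to the set that the substitution maps onto
  itself.\<close>

lemma radial_substitution:
  fixes q :: real and h :: "real \<Rightarrow> ennreal"
  assumes q: "q > 0" and [measurable]: "h \<in> borel_measurable borel"
  shows "(\<integral>\<^sup>+x. h (2 * x / (1 + x\<^sup>2 * q)) * ennreal \<bar>2 * (1 - x\<^sup>2 * q) / (1 + x\<^sup>2 * q)\<^sup>2\<bar> * indicator {x. x\<^sup>2 * q < 1} x \<partial>lborel)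
    = (\<integral>\<^sup>+x. h x * indicator {x. x\<^sup>2 * q < 1} x \<partial>lborel)"
proof -
  let ?S = "{x. x\<^sup>2 * q < 1}" and ?g = "\<lambda>x. 2 * x / (1 + x\<^sup>2 * q)"
  have pos: "1 + x\<^sup>2 * q > 0" for x using q by (simp add: add_pos_nonneg)
  have image: "?g ` ?S = ?S"
  proof (intro equalityI subsetI)
    fix w assume "w \<in> ?g ` ?S"
    then obtain x where x: "x\<^sup>2 * q < 1" "w = ?g x" by auto
    have "w\<^sup>2 * q = 4 * (x\<^sup>2 * q) / (1 + x\<^sup>2 * q)\<^sup>2"
      by (simp add: x power_divide power_mult_distrib)
    moreover have "4 * (x\<^sup>2 * q) < (1 + x\<^sup>2 * q)\<^sup>2"
    proof -
      have "0 < (1 - x\<^sup>2 * q)\<^sup>2" using x by simp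
      also have "\<dots> = (1 + x\<^sup>2 * q)\<^sup>2 - 4 * (x\<^sup>2 * q)" by (simp add: power2_eq_square algebra_simps)
      finally show ?thesis by simp
    qed
    ultimately show "w \<in> ?S" using pos[of x] by simp
  next
    fix w assume "w \<in> ?S"
    define s where "s = sqrt (1 - w\<^sup>2 * q)"
    have s: "s > 0" "w\<^sup>2 * q = 1 - s\<^sup>2" using \<open>w \<in> ?S\<close> by (auto simp: s_def)
    \<comment> \<open>The root inside the disk of the quadratic equation
      \<open>w * (1 + x\<^sup>2 * q) = 2 * x\<close>.\<close>
    define x where "x = w / (1 + s)"
    have "x\<^sup>2 * q = (1 - s\<^sup>2) / (1 + s)\<^sup>2" by (simp add: x_def power_divide s(2)[symmetric])
    also have "1 - s\<^sup>2 = (1 - s) * (1 + s)" by (simp add: power2_eq_square algebra_simps)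
    finally have x: "x\<^sup>2 * q = (1 - s) / (1 + s)" using s(1) by (simp add: power2_eq_square)
    then have "x \<in> ?S" using s(1) by simp
    moreover have "1 + x\<^sup>2 * q = 2 / (1 + s)" unfolding x using s(1) by (simp add: field_simps)
    then have "?g x = w" using s(1) by (simp add: x_def)
    ultimately show "w \<in> ?g ` ?S" by (intro image_eqI[of w ?g x]) simp_all
  qed
  have S [measurable]: "?S \<in> sets borel"
    by (intro borel_open open_Collect_less continuous_intros)
  have "(\<integral>\<^sup>+x. h (?g x) * ennreal \<bar>2 * (1 - x\<^sup>2 * q) / (1 + x\<^sup>2 * q)\<^sup>2\<bar> * indicator ?S x \<partial>lborel)
    = (\<integral>\<^sup>+x. h x * indicator (?g ` ?S) x \<partial>lborel)"
  proof (rule nn_integral_substitution_inj)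
    show "inj_on ?g ?S"
    proof (rule inj_onI)
      fix x y assume "x \<in> ?S" "y \<in> ?S" "?g x = ?g y"
      then have "x * (1 + y\<^sup>2 * q) = y * (1 + x\<^sup>2 * q)"
        using pos[of x] pos[of y] by (simp add: frac_eq_eq)
      \<comment> \<open>The second factor is positive: by the inequality of arithmetic and geometric
        means \<open>x * y * q\<close> is at most the mean of \<open>x\<^sup>2 * q\<close> and
        \<open>y\<^sup>2 * q\<close>, both below 1.\<close>
      then have "(x - y) * (1 - x * y * q) = 0" by (simp add: power2_eq_square algebra_simps)
      moreover have "x * y * q < 1"
      proof -
        have "2 * (x * y) * q \<le> (x\<^sup>2 + y\<^sup>2) * q"
          using q sum_squares_bound[of x y] by (intro mult_right_mono) auto
        then show ?thesis using \<open>x \<in> ?S\<close> \<open>y \<in> ?S\<close> by (simp add: algebra_simps)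
      qed
      ultimately show "x = y" by simp
    qed
    show "(?g has_real_derivative 2 * (1 - x\<^sup>2 * q) / (1 + x\<^sup>2 * q)\<^sup>2) (at x)" for x
      using pos[of x] by (auto intro!: derivative_eq_intros simp: power2_eq_square algebra_simps)
  qed (use S image in auto)
  then show ?thesis by (simp only: image)
qed

text \<open>In the coordinates \<open>(x, y/x)\<close> the map \<open>Phi\<close> only changes \<open>x\<close>, so one-dimensional substitutions suffice.\<close>

lemma E_meas_Phi: "distr (D_meas \<gamma>) (E_meas \<gamma>) Phi = E_meas \<gamma>"
proof (rule measure_eqI_nn_integral)
  fix h :: "complex \<Rightarrow> ennreal"
  assume "h \<in> borel_measurable (distr (D_meas \<gamma>) (E_meas \<gamma>) Phi)"
  then have [measurable]: "h \<in> borel_measurable borel" by (simp add: measurable_def)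
  let ?D = "\<lambda>z. ennreal (indicator (ball 0 1) z * xH z powr (2*\<gamma>+3) / (cH z)\<^sup>2) * h (Phi z)"
  let ?E = "\<lambda>z. ennreal (indicator (ball 0 1) z * (1 - (cmod z)\<^sup>2) powr \<gamma>) * h z"
  have "(\<integral>\<^sup>+z. h z \<partial>distr (D_meas \<gamma>) (E_meas \<gamma>) Phi) = (\<integral>\<^sup>+z. ?D z \<partial>lborel)"
    by (subst nn_integral_distr) (auto simp: D_meas_def nn_integral_density)
  also have "\<dots> = (\<integral>\<^sup>+s. \<integral>\<^sup>+x. ennreal \<bar>x\<bar> * ?D (Complex x (x * s)) \<partial>lborel \<partial>lborel)"
    by (rule nn_integral_lborel_complex_slope) measurable
  also have "\<dots> = (\<integral>\<^sup>+s. \<integral>\<^sup>+x. ennreal \<bar>x\<bar> * ?E (Complex x (x * s)) \<partial>lborel \<partial>lborel)"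
  proof (rule nn_integral_cong)
    fix s :: real
    define q where "q = 1 + s\<^sup>2"
    have q: "q > 0" by (simp add: q_def add_pos_nonneg)
    let ?g = "\<lambda>x. 2 * x / (1 + x\<^sup>2 * q)"
    have cm: "(cmod (Complex x (x * s)))\<^sup>2 = x\<^sup>2 * q" for x
      by (simp add: cmod_power2 q_def power_mult_distrib algebra_simps)
    have ball: "Complex x (x * s) \<in> ball 0 1 \<longleftrightarrow> x\<^sup>2 * q < 1" for x
      using abs_square_less_1[of "cmod (Complex x (x * s))"] by (simp add: cm dist_norm)
    have Phi: "Phi (Complex x (x * s)) = Complex (?g x) (?g x * s)" for x
      unfolding Phi_def cm by (simp add: complex_eq_iff)
    have "(\<integral>\<^sup>+x. ennreal \<bar>x\<bar> * ?E (Complex x (x * s)) \<partial>lborel)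
      = (\<integral>\<^sup>+x. (ennreal \<bar>x\<bar> * ?E (Complex x (x * s))) * indicator {x. x\<^sup>2 * q < 1} x \<partial>lborel)"
      by (intro nn_integral_cong) (use ball in \<open>auto simp: indicator_def simp del: mem_ball\<close>)
    also have "\<dots> = (\<integral>\<^sup>+x. (ennreal \<bar>?g x\<bar> * ?E (Complex (?g x) (?g x * s))) *
        ennreal \<bar>2 * (1 - x\<^sup>2 * q) / (1 + x\<^sup>2 * q)\<^sup>2\<bar> * indicator {x. x\<^sup>2 * q < 1} x \<partial>lborel)"
      by (rule radial_substitution[OF q, symmetric]) measurable
    also have "\<dots> = (\<integral>\<^sup>+x. ennreal \<bar>x\<bar> * ?D (Complex x (x * s)) \<partial>lborel)"
    proof (intro nn_integral_cong)
      fix x :: real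
      let ?z = "Complex x (x * s)"
      define r where "r = x\<^sup>2 * q"
      have r0: "r \<ge> 0" using q by (simp add: r_def)
      \<comment> \<open>With \<open>X = xH ?z\<close>, the factor X^(2 gamma) is the weight of
        \<open>E_meas\<close> at \<open>Phi ?z\<close>. The remaining
        \<open>X ^ 3 / (cH ?z)\<^sup>2\<close> equals 4 (1 - r) / (1 + r)^3, the Jacobian of
        \<open>Phi\<close>; this accounts for the 3 in the exponent of
        \<open>D_meas\<close>.\<close>
      have weight: "\<bar>?g x\<bar> * (1 - (cmod (Phi ?z))\<^sup>2) powr \<gamma> * \<bar>2 * (1 - r) / (1 + r)\<^sup>2\<bar>
          = \<bar>x\<bar> * (xH ?z powr (2*\<gamma>+3) / (cH ?z)\<^sup>2)" if "r < 1"
      proof -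
        define X where "X = xH ?z"
        have X: "X = (1 - r) / (1 + r)" "cH ?z = (1 - r) / 2"
          by (simp_all add: X_def xH_def cH_def cm r_def)
        have Xp: "X > 0" using that r0 by (simp add: X)
        have a: "(1 - (cmod (Phi ?z))\<^sup>2) powr \<gamma> = X powr (2*\<gamma>)"
          unfolding one_minus_cmod_Phi_sq X_def[symmetric] using Xp by (simp add: powr_powr flip: powr_numeral)
        have b: "X powr (2*\<gamma>+3) = X powr (2*\<gamma>) * X ^ 3"
          using Xp by (simp add: powr_add)
        have c: "\<bar>?g x\<bar> * \<bar>2 * (1 - r) / (1 + r)\<^sup>2\<bar> = \<bar>x\<bar> * (X ^ 3 / ((1 - r) / 2)\<^sup>2)"
        proof -
          have "2 * m / p * (2 * d / p\<^sup>2) = m * ((d / p) ^ 3 / (d / 2)\<^sup>2)" if "d > 0" "p > 0" for m d p :: real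
            using that by (simp add: power_divide power3_eq_cube power2_eq_square field_simps)
          from this[of "1 - r" "1 + r" "\<bar>x\<bar>"] show ?thesis
            using that r0 unfolding X r_def[symmetric] by (simp add: abs_mult)
        qed
        have "\<bar>?g x\<bar> * X powr (2*\<gamma>) * \<bar>2 * (1 - r) / (1 + r)\<^sup>2\<bar>
            = (\<bar>?g x\<bar> * \<bar>2 * (1 - r) / (1 + r)\<^sup>2\<bar>) * X powr (2*\<gamma>)" by (simp only: mult_ac)
        then show ?thesis
          unfolding a X_def[symmetric] X(2) b c by (simp add: mult_ac)
      qed
      show "(ennreal \<bar>?g x\<bar> * ?E (Complex (?g x) (?g x * s))) *
        ennreal \<bar>2 * (1 - x\<^sup>2 * q) / (1 + x\<^sup>2 * q)\<^sup>2\<bar> * indicator {x. x\<^sup>2 * q < 1} x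
        = ennreal \<bar>x\<bar> * ?D ?z"
      proof (cases "r < 1")
        case True
        then have z: "?z \<in> ball 0 1" unfolding ball r_def .
        then have Pz: "Phi ?z \<in> ball 0 1" using cmod_Phi_less[of ?z] by (simp add: dist_norm)
        have "(ennreal \<bar>?g x\<bar> * ?E (Phi ?z)) * ennreal \<bar>2 * (1 - r) / (1 + r)\<^sup>2\<bar>
          = ennreal (\<bar>?g x\<bar> * (1 - (cmod (Phi ?z))\<^sup>2) powr \<gamma> * \<bar>2 * (1 - r) / (1 + r)\<^sup>2\<bar>) * h (Phi ?z)"
        proof -
          have "(ennreal A * (ennreal P * H)) * ennreal B = ennreal (A * P * B) * H"
            if "A \<ge> 0" "P \<ge> 0" "B \<ge> 0" for A P B :: real and H
            using that by (simp add: ennreal_mult mult_ac)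
          from this[OF abs_ge_zero powr_ge_zero abs_ge_zero] show ?thesis
            using Pz by (simp only: indicator_simps mult_1)
        qed
        also have "\<dots> = ennreal \<bar>x\<bar> * ?D ?z"
          unfolding weight[OF True] ennreal_mult'[OF abs_ge_zero] using z
          by (simp only: indicator_simps mult_1 mult.assoc)
        finally show ?thesis using True unfolding Phi[symmetric] by (simp add: r_def)
      next
        case False
        then show ?thesis using ball[of x] by (simp add: r_def indicator_def del: mem_ball)
      qed
    qed
    finally show "(\<integral>\<^sup>+x. ennreal \<bar>x\<bar> * ?D (Complex x (x * s)) \<partial>lborel)
      = (\<integral>\<^sup>+x. ennreal \<bar>x\<bar> * ?E (Complex x (x * s)) \<partial>lborel)" by simp
  qed
  also have "\<dots> = (\<integral>\<^sup>+z. ?E z \<partial>lborel)"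
    by (rule nn_integral_lborel_complex_slope[symmetric]) measurable
  also have "\<dots> = (\<integral>\<^sup>+z. h z \<partial>E_meas \<gamma>)"
    by (rule nn_integral_E_meas[symmetric]) measurable
  finally show "(\<integral>\<^sup>+z. h z \<partial>distr (D_meas \<gamma>) (E_meas \<gamma>) Phi) = (\<integral>\<^sup>+z. h z \<partial>E_meas \<gamma>)" .
qed simp

section \<open>Gegenbauer polynomials\<close>

text \<open>This is, up to sign, an \<open>n\<close>-th finite difference of a polynomial of degree
  \<open>m < n\<close> in \<open>s\<close>. Pascal's rule extracts one difference, which lowers
  \<open>m\<close> by one and shifts \<open>x\<close>.\<close>

lemma alternating_sum_pochhammer:
  fixes x :: real
  assumes "m < n"
  shows "(\<Sum>s\<le>n. (-1) ^ s * real (n choose s) * pochhammer (x + real s) m) = 0"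
  using assms
proof (induction n arbitrary: m x)
  case (Suc n)
  let ?f = "\<lambda>s. pochhammer (x + real s) m"
  \<comment> \<open>For \<open>m = 0\<close> the truncated \<open>m - 1\<close> is harmless, since
    the factor \<open>real m\<close> is zero.\<close>
  have diff: "?f s - ?f (Suc s) = - real m * pochhammer (x + 1 + real s) (m - 1)" for s
  proof (cases m)
    case (Suc k)
    have "?f s = (x + real s) * pochhammer (x + 1 + real s) k"
      unfolding Suc pochhammer_rec by (simp add: add_ac)
    moreover have "?f (Suc s) = (x + 1 + real s + real k) * pochhammer (x + 1 + real s) k"
      unfolding Suc pochhammer_Suc by (simp add: algebra_simps)
    ultimately show ?thesis by (simp add: Suc algebra_simps)
  qed simp
  have "(\<Sum>s\<le>Suc n. (-1) ^ s * real (Suc n choose s) * ?f s)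
     = ?f 0 + (\<Sum>s\<le>n. (-1) ^ Suc s * real (Suc n choose Suc s) * ?f (Suc s))"
    by (subst sum.atMost_Suc_shift) simp
  also have "\<dots> = ?f 0 + (\<Sum>s\<le>n. (-1) ^ Suc s * real (n choose Suc s) * ?f (Suc s))
      - (\<Sum>s\<le>n. (-1) ^ s * real (n choose s) * ?f (Suc s))"
  proof -
    have "(-1) ^ Suc s * real (Suc n choose Suc s) * ?f (Suc s)
      = (-1) ^ Suc s * real (n choose Suc s) * ?f (Suc s) - (-1) ^ s * real (n choose s) * ?f (Suc s)" for s
      by (simp add: algebra_simps)
    then show ?thesis by (simp only: sum_subtractf)
  qed
  also have "?f 0 + (\<Sum>s\<le>n. (-1) ^ Suc s * real (n choose Suc s) * ?f (Suc s))
      = (\<Sum>s\<le>Suc n. (-1) ^ s * real (n choose s) * ?f s)"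
    by (subst sum.atMost_Suc_shift[of _ n]) simp
  also have "\<dots> = (\<Sum>s\<le>n. (-1) ^ s * real (n choose s) * ?f s)" by simp
  also have "\<dots> - (\<Sum>s\<le>n. (-1) ^ s * real (n choose s) * ?f (Suc s))
     = (\<Sum>s\<le>n. (-1) ^ s * real (n choose s) * (?f s - ?f (Suc s)))"
    by (simp add: sum_subtractf[symmetric] algebra_simps)
  also have "\<dots> = - real m * (\<Sum>s\<le>n. (-1) ^ s * real (n choose s) * pochhammer (x + 1 + real s) (m - 1))"
    unfolding diff sum_distrib_left by (simp add: mult_ac)
  also have "\<dots> = 0"
    using Suc.IH[of "m - 1" "x + 1"] Suc.prems by (cases m) auto
  finally show ?case .
qed simp

lemma integrable_W_meas_continuous:
  fixes f :: "real \<Rightarrow> 'b :: {banach, second_countable_topology}"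
  assumes c: "c > -1" and f: "continuous_on UNIV f"
  shows "integrable (W_meas c) f"
proof -
  interpret finite_measure "W_meas c" using c by (rule finite_measure_W_meas)
  have "compact (f ` {-1..1})"
    by (intro compact_continuous_image continuous_on_subset[OF f]) auto
  then obtain B where B: "\<And>y. y \<in> {-1..1} \<Longrightarrow> norm (f y) \<le> B"
    by (metis bounded_iff compact_imp_bounded imageI)
  have "AE y in W_meas c. norm (f y) \<le> B"
    using AE_W_meas by eventually_elim (use B in auto)
  moreover have "f \<in> borel_measurable (W_meas c)"
    using borel_measurable_continuous_onI[OF f] by simp
  ultimately show ?thesis by (intro integrable_const_bound)
qed

definition jacobi_poly :: "real \<Rightarrow> nat \<Rightarrow> real poly" where
  "jacobi_poly l n = (\<Sum>s\<le>n. smult (((real n + l) gchoose (n - s)) * ((real n + l) gchoose s) / 2 ^ n)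
     ([:-1, 1:] ^ s * [:1, 1:] ^ (n - s)))"

lemma poly_jacobi_poly: "poly (jacobi_poly l n) y = jacobiP l l n y"
proof -
  have "((y - 1) / 2) ^ s * ((y + 1) / 2) ^ (n - s) = (y - 1) ^ s * (y + 1) ^ (n - s) / 2 ^ n" if "s \<le> n" for s
  proof -
    have "(2::real) ^ n = 2 ^ s * 2 ^ (n - s)" using that by (simp add: power_add[symmetric])
    then show ?thesis by (simp add: power_divide)
  qed
  then show ?thesis
    unfolding jacobi_poly_def jacobiP_def atLeast0AtMost poly_sum
    by (intro sum.cong) (auto simp: mult.assoc add.commute[of 1 y])
qed

lemma degree_jacobi_poly_le: "degree (jacobi_poly l n) \<le> n"
  unfolding jacobi_poly_def
proof (intro degree_sum_le order.trans[OF degree_smult_le])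
  fix s assume "s \<in> {..n}"
  then have "degree ([:-1, 1:] ^ s * [:1, 1:] ^ (n - s) :: real poly) \<le> s * 1 + (n - s) * 1"
    by (intro order.trans[OF degree_mult_le] add_mono order.trans[OF degree_power_le]) auto
  then show "degree ([:-1, 1:] ^ s * [:1, 1:] ^ (n - s) :: real poly) \<le> n"
    using \<open>s \<in> {..n}\<close> by simp
qed auto

text \<open>Every product in the defining sum is monic of degree \<open>n\<close>, so the leading
  coefficient is a Vandermonde sum and equals the generalized binomial coefficient of
  \<open>2 n + 2 l\<close> over \<open>n\<close>, divided by \<open>2 ^ n\<close>. For
  \<open>l > -1/2\<close> all factors in its numerator are positive.\<close>

lemma coeff_jacobi_poly_pos:
  assumes "l > -1/2"
  shows "coeff (jacobi_poly l n) n > 0"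
proof -
  have monic: "coeff ([:-1, 1:] ^ s * [:1, 1:] ^ (n - s) :: real poly) n = 1" if "s \<le> n" for s
  proof -
    let ?p = "[:-1, 1:] ^ s * [:1, 1:] ^ (n - s) :: real poly"
    have "lead_coeff ?p = 1" by (simp add: lead_coeff_mult lead_coeff_power)
    moreover have "degree ?p = n"
      using that by (subst degree_mult_eq) (auto simp: degree_power_eq)
    ultimately show ?thesis by simp
  qed
  have "coeff (jacobi_poly l n) n
      = (\<Sum>s\<le>n. ((real n + l) gchoose (n - s)) * ((real n + l) gchoose s) / 2 ^ n)"
    unfolding jacobi_poly_def coeff_sum coeff_smult using monic by (intro sum.cong) auto
  also have "\<dots> = (\<Sum>s=0..n. ((real n + l) gchoose s) * ((real n + l) gchoose (n - s))) / 2 ^ n"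
    by (simp add: sum_divide_distrib atLeast0AtMost mult.commute)
  also have "\<dots> = ((real n + l) + (real n + l) gchoose n) / 2 ^ n"
    by (simp only: gbinomial_Vandermonde)
  also have "\<dots> > 0"
    unfolding gbinomial_prod_rev using assms by (intro divide_pos_pos prod_pos) auto
  finally show ?thesis .
qed

text \<open>Each term integrates to a Beta value. Its Gamma factors cancel against those of the
  binomial coefficients up to \<open>Gamma (s + m + l + 1) / Gamma (l + 1 + s)\<close>, a Pochhammer
  symbol, and what remains is the vanishing alternating sum.\<close>

lemma jacobi_poly_orthogonal_power:
  assumes l: "l > -1" and m: "m < n"
  shows "(LINT y|W_meas l. poly (jacobi_poly l n) y * (1 - y) ^ m) = 0"
proof -
  let ?a = "\<lambda>s. ((real n + l) gchoose (n - s)) * ((real n + l) gchoose s) / 2 ^ n"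
  let ?K = "(Gamma (real n + l + 1))\<^sup>2 / (fact n * Gamma (real n + real m + 2 * l + 2)) / 2 ^ n * 2 powr (real n + real m + 2 * l + 1)"
  have eq: "poly (jacobi_poly l n) y * (1 - y) ^ m = (\<Sum>s\<le>n. ?a s * (-1) ^ s * ((1 - y) ^ (s + m) * (1 + y) ^ (n - s)))" for y
  proof -
    have "(y - 1) ^ s = (-1) ^ s * (1 - y) ^ s" for s
      by (simp add: power_mult_distrib[symmetric])
    then show ?thesis
      unfolding jacobi_poly_def poly_sum sum_distrib_right
      by (intro sum.cong) (auto simp: power_add add.commute mult_ac)
  qed
  have "has_bochner_integral (W_meas l) (\<lambda>y. \<Sum>s\<le>n. ?a s * (-1) ^ s * ((1 - y) ^ (s + m) * (1 + y) ^ (n - s)))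
     (\<Sum>s\<le>n. ?a s * (-1) ^ s * (2 powr (real (s + m) + real (n - s) + 2 * l + 1) * Beta (real (s + m) + l + 1) (real (n - s) + l + 1)))"
    by (intro has_bochner_integral_sum has_bochner_integral_mult_right has_bochner_integral_W_meas_Beta l)
  then have "(LINT y|W_meas l. poly (jacobi_poly l n) y * (1 - y) ^ m)
     = (\<Sum>s\<le>n. ?a s * (-1) ^ s * (2 powr (real (s + m) + real (n - s) + 2 * l + 1) * Beta (real (s + m) + l + 1) (real (n - s) + l + 1)))"
    unfolding eq by (rule has_bochner_integral_integral_eq)
  also have "\<dots> = (\<Sum>s\<le>n. ?K * ((-1) ^ s * real (n choose s) * pochhammer (l + 1 + real s) m))"
  proof (intro sum.cong refl)
    fix s assume "s \<in> {..n}"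
    then have s: "s \<le> n" by simp
    have np: "x \<notin> \<int>\<^sub>\<le>\<^sub>0" if "x > 0" for x :: real
      using that by (auto simp: nonpos_Ints_def)
    have g1: "(real n + l) gchoose (n - s) = Gamma (real n + l + 1) / (fact (n - s) * Gamma (l + 1 + real s))"
      using l s by (subst gbinomial_Gamma) (auto intro!: np simp: of_nat_diff algebra_simps)
    have g2: "(real n + l) gchoose s = Gamma (real n + l + 1) / (fact s * Gamma (real (n - s) + l + 1))"
      using l s by (subst gbinomial_Gamma) (auto intro!: np simp: of_nat_diff algebra_simps)
    have p: "pochhammer (l + 1 + real s) m = Gamma (real (s + m) + l + 1) / Gamma (l + 1 + real s)"
      using l by (subst pochhammer_Gamma) (auto intro!: np simp: algebra_simps)
    have B: "Beta (real (s + m) + l + 1) (real (n - s) + l + 1)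
       = Gamma (real (s + m) + l + 1) * Gamma (real (n - s) + l + 1) / Gamma (real n + real m + 2 * l + 2)"
      using s by (simp add: Beta_def of_nat_diff algebra_simps)
    have G: "Gamma (real (n - s) + l + 1) \<noteq> 0"
    proof -
      have "real (n - s) + l + 1 > 0" using l of_nat_0_le_iff[of "n - s", where 'a = real] by linarith
      from Gamma_real_pos[OF this] show ?thesis by simp
    qed
    have e: "real (s + m) + real (n - s) + 2 * l + 1 = real n + real m + 2 * l + 1"
      using s by (simp add: of_nat_diff)
    have alg: "(A / (x * P)) * (A / (y * Q)) / t * sg * (T * (R * Q / D)) = A\<^sup>2 / (z * D) / t * T * (sg * (z / (x * y)) * (R / P))"
      if "Q \<noteq> 0" "z \<noteq> 0" for A x y P Q R t sg T D z :: real
      using that by (simp add: power2_eq_square field_simps)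
    have ch: "real (n choose s) = fact n / (fact (n - s) * fact s)"
      using binomial_fact[OF s, where 'a = real] by (simp add: mult.commute)
    show "?a s * (-1) ^ s * (2 powr (real (s + m) + real (n - s) + 2 * l + 1) * Beta (real (s + m) + l + 1) (real (n - s) + l + 1))
       = ?K * ((-1) ^ s * real (n choose s) * pochhammer (l + 1 + real s) m)"
      unfolding e g1 g2 p B ch by (rule alg[OF G]) simp
  qed
  also have "\<dots> = ?K * (\<Sum>s\<le>n. (-1) ^ s * real (n choose s) * pochhammer (l + 1 + real s) m)"
    by (rule sum_distrib_left[symmetric])
  also have "\<dots> = 0" by (simp only: alternating_sum_pochhammer[OF m] mult_zero_right)
  finally show ?thesis .
qed

lemma jacobi_poly_orthogonal:
  assumes l: "l > -1" and q: "degree q < n"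
  shows "(LINT y|W_meas l. poly (jacobi_poly l n) y * poly q y) = 0"
proof -
  \<comment> \<open>The coefficients of \<open>r\<close> are those of \<open>q\<close> expanded in
    powers of \<open>1 - y\<close>.\<close>
  define r where "r = pcompose q [:1, -1:]"
  have "degree r \<le> degree q"
    unfolding r_def using degree_pcompose_le[of q "[:1, -1 :: real:]"] by simp
  have "poly q y = (\<Sum>m\<le>degree r. coeff r m * (1 - y) ^ m)" for y
  proof -
    have "poly q y = poly r (1 - y)" by (simp add: r_def poly_pcompose)
    then show ?thesis by (simp add: poly_altdef)
  qed
  then have "(LINT y|W_meas l. poly (jacobi_poly l n) y * poly q y)
      = (LINT y|W_meas l. (\<Sum>m\<le>degree r. coeff r m * (poly (jacobi_poly l n) y * (1 - y) ^ m)))"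
    by (simp add: sum_distrib_left mult_ac)
  also have "\<dots> = (\<Sum>m\<le>degree r. (LINT y|W_meas l. coeff r m * (poly (jacobi_poly l n) y * (1 - y) ^ m)))"
    by (intro Bochner_Integration.integral_sum integrable_W_meas_continuous l continuous_intros)
  also have "\<dots> = 0"
    using q \<open>degree r \<le> degree q\<close> l by (intro sum.neutral) (auto simp: jacobi_poly_orthogonal_power)
  finally show ?thesis .
qed

lemma AE_W_meas_poly_nonzero:
  assumes "p \<noteq> 0"
  shows "AE y in W_meas c. poly p y \<noteq> (0::real)"
proof -
  have "finite {y. poly p y = 0}" using assms by (rule poly_roots_finite)
  then have "AE y in lborel. y \<notin> {y. poly p y = 0}"
    by (intro AE_not_in) (auto intro: finite_imp_null_set_lborel)
  then show ?thesis unfolding W_meas_def by (subst AE_density) auto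
qed

lemma W_meas_nontrivial:
  assumes "c > -1"
  shows "\<not> (AE y in W_meas c. False)"
proof
  assume "AE y in W_meas c. False"
  then have "emeasure (W_meas c) UNIV = 0" by (subst (asm) AE_iff_measurable[of UNIV]) auto
  then have "2 powr (2 * c + 1) * Beta (c + 1) (c + 1) \<le> 0"
    using nn_integral_W_meas_Beta[OF assms, of 0 0] by (simp add: ennreal_eq_0_iff)
  moreover have "Beta (c + 1) (c + 1) > 0" using assms by (intro Beta_real_pos) auto
  ultimately show False by (simp add: mult_le_0_iff)
qed

text \<open>A nonzero polynomial has finitely many roots, and the weighted measure is nonzero
  without charging finite sets.\<close>

lemma jacobi_norm_pos:
  assumes l: "l > -1/2"
  shows "(LINT y|W_meas l. (jacobiP l l n y)\<^sup>2) > 0"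
proof -
  have l': "l > -1" using l by simp
  have "jacobi_poly l n \<noteq> 0" using coeff_jacobi_poly_pos[OF l, of n] by auto
  have "(LINT y|W_meas l. (poly (jacobi_poly l n) y)\<^sup>2) \<noteq> 0"
  proof
    assume "(LINT y|W_meas l. (poly (jacobi_poly l n) y)\<^sup>2) = 0"
    then have "AE y in W_meas l. (poly (jacobi_poly l n) y)\<^sup>2 = 0"
      by (subst (asm) integral_nonneg_eq_0_iff_AE)
        (auto intro!: integrable_W_meas_continuous l' continuous_intros)
    then have "AE y in W_meas l. False"
      using AE_W_meas_poly_nonzero[OF \<open>jacobi_poly l n \<noteq> 0\<close>, of l] by eventually_elim simp
    then show False using W_meas_nontrivial[OF l'] by simp
  qed
  moreover have "(LINT y|W_meas l. (poly (jacobi_poly l n) y)\<^sup>2) \<ge> 0" by (simp add: integral_nonneg_AE)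
  ultimately show ?thesis unfolding poly_jacobi_poly by linarith
qed

lemma LBINT_eq_W_meas:
  assumes [measurable]: "f \<in> borel_measurable borel"
  shows "(LBINT u=-1..1. f u * (1 - u\<^sup>2) powr c) = (LINT u|W_meas c. f u :: real)"
proof -
  have "(LBINT u=ereal (-1)..ereal 1. f u * (1 - u\<^sup>2) powr c) = (LINT u|lborel. indicator {-1<..<1} u *\<^sub>R (f u * (1 - u\<^sup>2) powr c))"
    by (subst interval_integral_Ioo) (auto simp: set_lebesgue_integral_def)
  also have "\<dots> = (LINT u|W_meas c. f u)"
    unfolding W_meas_def by (subst integral_density) (auto simp: mult_ac)
  finally show ?thesis by (simp add: one_ereal_def)
qed

section \<open>The normalized Gegenbauer polynomials p_n\<close>

definition pJ_poly :: "real \<Rightarrow> nat \<Rightarrow> real poly" where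
  "pJ_poly \<gamma> n = smult (1 / sqrt (2*pi * (LINT y|W_meas (\<gamma> + 1/2). (jacobiP (\<gamma> + 1/2) (\<gamma> + 1/2) n y)\<^sup>2)))
     (jacobi_poly (\<gamma> + 1/2) n)"

lemma poly_pJ_poly: "poly (pJ_poly \<gamma> n) y = pJ \<gamma> n y"
proof -
  have "(\<lambda>y. jacobiP l l n y) \<in> borel_measurable borel" for l
    unfolding poly_jacobi_poly[symmetric] by (intro borel_measurable_continuous_onI continuous_intros)
  then have "(LBINT u=-1..1. (jacobiP (\<gamma> + 1/2) (\<gamma> + 1/2) n u)\<^sup>2 * (1 - u\<^sup>2) powr (\<gamma> + 1/2))
     = (LINT u|W_meas (\<gamma> + 1/2). (jacobiP (\<gamma> + 1/2) (\<gamma> + 1/2) n u)\<^sup>2)"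
    by (intro LBINT_eq_W_meas) measurable
  then show ?thesis by (simp only: pJ_poly_def pJ_def poly_smult poly_jacobi_poly) simp
qed

lemma degree_pJ_poly_le: "degree (pJ_poly \<gamma> n) \<le> n"
  unfolding pJ_poly_def by (rule order.trans[OF degree_smult_le degree_jacobi_poly_le])

lemma coeff_pJ_poly_pos:
  assumes "\<gamma> > -1"
  shows "coeff (pJ_poly \<gamma> n) n > 0"
proof -
  have "\<gamma> + 1/2 > -1/2" using assms by simp
  from jacobi_norm_pos[OF this, of n] coeff_jacobi_poly_pos[OF this, of n] show ?thesis
    unfolding pJ_poly_def coeff_smult by (intro mult_pos_pos divide_pos_pos) auto
qed

lemma pJ_poly_orthogonal:
  assumes "\<gamma> > -1" "degree q < n"
  shows "(LINT y|W_meas (\<gamma> + 1/2). poly (pJ_poly \<gamma> n) y * poly q y) = 0"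
  unfolding pJ_poly_def poly_smult mult.assoc
  using jacobi_poly_orthogonal[of "\<gamma> + 1/2" q n] assms by simp

lemma pJ_poly_norm:
  assumes "\<gamma> > -1"
  shows "(LINT y|W_meas (\<gamma> + 1/2). poly (pJ_poly \<gamma> n) y * poly (pJ_poly \<gamma> n) y) = 1 / (2*pi)"
proof -
  define I where "I = (LINT y|W_meas (\<gamma> + 1/2). (jacobiP (\<gamma> + 1/2) (\<gamma> + 1/2) n y)\<^sup>2)"
  have "I > 0" unfolding I_def using assms by (intro jacobi_norm_pos) simp
  have sq: "(1 / sqrt t * J) * (1 / sqrt t * J) = 1 / t * J\<^sup>2" if "t > 0" for t J :: real
    using that by (simp add: power2_eq_square)
  have "(LINT y|W_meas (\<gamma> + 1/2). poly (pJ_poly \<gamma> n) y * poly (pJ_poly \<gamma> n) y)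
     = (LINT y|W_meas (\<gamma> + 1/2). 1 / (2*pi*I) * (jacobiP (\<gamma> + 1/2) (\<gamma> + 1/2) n y)\<^sup>2)"
    unfolding pJ_poly_def I_def[symmetric] poly_smult poly_jacobi_poly
    using \<open>I > 0\<close> by (subst sq) auto
  also have "\<dots> = 1 / (2*pi*I) * I" by (simp add: I_def)
  finally show ?thesis using \<open>I > 0\<close> by simp
qed

text \<open>Subtracting the multiple of p_n with the same coefficient at \<open>n\<close> leaves a
  polynomial of smaller degree, orthogonal to p_n. Hence only the coefficient of \<open>q\<close> at
  \<open>n\<close> matters, divided by that of p_n; \<open>2 * pi\<close> is the
  normalization.\<close>

lemma pJ_poly_integral:
  assumes \<gamma>: "\<gamma> > -1" and q: "degree q \<le> n"
  shows "(LINT y|W_meas (\<gamma> + 1/2). poly (pJ_poly \<gamma> n) y * poly q y) = coeff q n / (2 * pi * coeff (pJ_poly \<gamma> n) n)"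
proof (cases "n = 0")
  \<comment> \<open>For \<open>n = 0\<close> there is no smaller degree for a remainder, but then
    \<open>q\<close> is itself a constant multiple of p_0.\<close>
  case True
  then have "q = smult (coeff q n / coeff (pJ_poly \<gamma> n) n) (pJ_poly \<gamma> n)"
    using q degree_pJ_poly_le[of \<gamma> n] coeff_pJ_poly_pos[OF \<gamma>, of n]
    by (intro poly_eqI) (metis coeff_eq_0 coeff_smult le_zero_eq mult_zero_right nonzero_eq_divide_eq
        not_less_iff_gr_or_eq zero_less_iff_neq_zero)
  then have "poly q y = coeff q n / coeff (pJ_poly \<gamma> n) n * poly (pJ_poly \<gamma> n) y" for y
    by (metis poly_smult)
  then have "(LINT y|W_meas (\<gamma> + 1/2). poly (pJ_poly \<gamma> n) y * poly q y)
    = (LINT y|W_meas (\<gamma> + 1/2). coeff q n / coeff (pJ_poly \<gamma> n) n * (poly (pJ_poly \<gamma> n) y * poly (pJ_poly \<gamma> n) y))"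
    by (simp add: mult_ac)
  then show ?thesis by (simp add: pJ_poly_norm[OF \<gamma>])
next
  case False
  define t where "t = coeff q n / coeff (pJ_poly \<gamma> n) n"
  define r where "r = q - smult t (pJ_poly \<gamma> n)"
  have "coeff r n = 0" using coeff_pJ_poly_pos[OF \<gamma>, of n] by (simp add: r_def t_def)
  moreover have "degree r \<le> n"
    unfolding r_def by (intro degree_diff_le q order.trans[OF degree_smult_le degree_pJ_poly_le])
  ultimately have "degree r < n"
    using False by (metis degree_0 leading_coeff_0_iff nat_less_le bot_nat_0.not_eq_extremum)
  then have 0: "(LINT y|W_meas (\<gamma> + 1/2). poly (pJ_poly \<gamma> n) y * poly r y) = 0"
    by (rule pJ_poly_orthogonal[OF \<gamma>])
  have "poly q y = poly r y + t * poly (pJ_poly \<gamma> n) y" for y by (simp add: r_def)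
  then have "(LINT y|W_meas (\<gamma> + 1/2). poly (pJ_poly \<gamma> n) y * poly q y)
    = (LINT y|W_meas (\<gamma> + 1/2). poly (pJ_poly \<gamma> n) y * poly r y + t * (poly (pJ_poly \<gamma> n) y * poly (pJ_poly \<gamma> n) y))"
    by (simp add: algebra_simps)
  also have "\<dots> = (LINT y|W_meas (\<gamma> + 1/2). poly (pJ_poly \<gamma> n) y * poly r y)
      + (LINT y|W_meas (\<gamma> + 1/2). t * (poly (pJ_poly \<gamma> n) y * poly (pJ_poly \<gamma> n) y))"
    using \<gamma> by (intro Bochner_Integration.integral_add integrable_W_meas_continuous continuous_intros) auto
  also have "\<dots> = t / (2 * pi)" by (simp add: 0 pJ_poly_norm[OF \<gamma>])
  finally show ?thesis by (simp add: t_def)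
qed

text \<open>A sign change of \<open>y\<close> swaps the two linear factors up to sign; with equal
  parameters the coefficients are symmetric under exchanging \<open>s\<close> and
  \<open>n - s\<close>.\<close>

lemma jacobiP_minus: "jacobiP l l n (- y) = (-1) ^ n * jacobiP l l n y"
proof -
  have "((- y - 1) / 2) ^ s * ((- y + 1) / 2) ^ (n - s) = (-1) ^ n * (((y - 1) / 2) ^ (n - s) * ((y + 1) / 2) ^ s)"
    if "s \<le> n" for s
  proof -
    have "(- y - 1) / 2 = - ((y + 1) / 2)" "(- y + 1) / 2 = - ((y - 1) / 2)" by (simp_all add: field_simps)
    then have "((- y - 1) / 2) ^ s * ((- y + 1) / 2) ^ (n - s)
       = ((-1) ^ s * (-1) ^ (n - s)) * (((y - 1) / 2) ^ (n - s) * ((y + 1) / 2) ^ s)"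
      by (simp only: power_minus[of "(y + 1) / 2"] power_minus[of "(y - 1) / 2"] mult_ac)
    then show ?thesis using that by (simp add: power_add[symmetric])
  qed
  then have "jacobiP l l n (- y) = (\<Sum>s=0..n. (-1) ^ n * (((real n + l) gchoose (n - s)) * ((real n + l) gchoose s)
      * ((y - 1) / 2) ^ (n - s) * ((y + 1) / 2) ^ s))"
    unfolding jacobiP_def by (intro sum.cong) (auto simp: mult.assoc)
  also have "\<dots> = (\<Sum>s=0..n. (-1) ^ n * (((real n + l) gchoose (n - s)) * ((real n + l) gchoose s)
      * ((y - 1) / 2) ^ s * ((y + 1) / 2) ^ (n - s)))"
    by (subst sum.atLeastAtMost_rev) (auto intro!: sum.cong simp: mult_ac)
  finally show ?thesis by (simp add: jacobiP_def sum_distrib_left)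
qed

lemma pJ_minus: "pJ \<gamma> n (- y) = (-1) ^ n * pJ \<gamma> n y"
  by (simp add: pJ_def jacobiP_minus)

lemma measurable_pJ [measurable]: "pJ \<gamma> n \<in> borel_measurable borel"
  unfolding poly_pJ_poly[symmetric, abs_def] by (intro borel_measurable_continuous_onI continuous_intros)

section \<open>Density of polynomials in weighted L2 spaces\<close>

lemma lin_combs_L2: "S \<subseteq> L2 M \<Longrightarrow> lin_combs S \<subseteq> L2 M"
  unfolding lin_combs_def by (auto intro!: L2_lincomb)

lemma cl_spanE:
  assumes "g \<in> cl_span M V S" "\<epsilon> > 0"
  obtains h where "h \<in> lin_combs S" "L2norm M (\<lambda>x. g x - h x) < \<epsilon>"
  using assms unfolding cl_span_def by (elim CollectE conjE allE impE bexE)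

lemma cl_spanD: "g \<in> cl_span M V S \<Longrightarrow> g \<in> V"
  by (simp add: cl_span_def)

lemma cl_span_L2_limit:
  assumes S: "S \<subseteq> L2 M" and g: "g \<in> L2 M"
    and lim: "\<And>\<epsilon>. \<epsilon> > 0 \<Longrightarrow> \<exists>f \<in> cl_span M (L2 M) S. L2norm M (\<lambda>x. g x - f x) < \<epsilon>"
  shows "g \<in> cl_span M (L2 M) S"
  unfolding cl_span_def
proof (intro CollectI conjI g allI impI)
  fix \<epsilon> :: real assume "\<epsilon> > 0"
  then have e2: "\<epsilon> / 2 > 0" by simp
  from lim[OF e2] obtain f where f: "f \<in> cl_span M (L2 M) S" "L2norm M (\<lambda>x. g x - f x) < \<epsilon> / 2"
    by (rule bexE)
  have fL: "f \<in> L2 M" by (rule cl_spanD[OF f(1)])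
  obtain h where h: "h \<in> lin_combs S" "L2norm M (\<lambda>x. f x - h x) < \<epsilon> / 2"
    by (rule cl_spanE[OF f(1) e2])
  have "h \<in> L2 M" using h(1) lin_combs_L2[OF S] by (rule rev_subsetD)
  have "L2norm M (\<lambda>x. g x - h x) < \<epsilon>"
    using L2norm_triangle_diff[OF g fL \<open>h \<in> L2 M\<close>] f(2) h(2) by linarith
  then show "\<exists>h\<in>lin_combs S. L2norm M (\<lambda>x. g x - h x) < \<epsilon>" by (intro bexI[of _ h] h(1))
qed

lemma cl_span_L2_add:
  assumes S: "S \<subseteq> L2 M" and f: "f \<in> cl_span M (L2 M) S" and g: "g \<in> cl_span M (L2 M) S"
  shows "(\<lambda>x. f x + g x) \<in> cl_span M (L2 M) S"
proof -
  have fL: "f \<in> L2 M" and gL: "g \<in> L2 M" using f g by (auto simp: cl_span_def)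
  show ?thesis
    unfolding cl_span_def
  proof (intro CollectI conjI allI impI)
    show "(\<lambda>x. f x + g x) \<in> L2 M" by (rule L2_add[OF fL gL])
    fix \<epsilon> :: real assume "\<epsilon> > 0"
    then have e2: "\<epsilon> / 2 > 0" by simp
    obtain h where h: "h \<in> lin_combs S" "L2norm M (\<lambda>x. f x - h x) < \<epsilon> / 2"
      by (rule cl_spanE[OF f e2])
    obtain k where k: "k \<in> lin_combs S" "L2norm M (\<lambda>x. g x - k x) < \<epsilon> / 2"
      by (rule cl_spanE[OF g e2])
    have hk: "h \<in> L2 M" "k \<in> L2 M" using h(1) k(1) lin_combs_L2[OF S] by auto
    have "L2norm M (\<lambda>x. (f x - h x) + (g x - k x)) < \<epsilon>"
      using L2norm_triangle[OF L2_diff[OF fL hk(1)] L2_diff[OF gL hk(2)]] h(2) k(2) by linarith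
    then have "L2norm M (\<lambda>x. f x + g x - (h x + k x)) < \<epsilon>" by (simp only: add_diff_add)
    then show "\<exists>h\<in>lin_combs S. L2norm M (\<lambda>x. f x + g x - h x) < \<epsilon>"
      by (rule bexI[of _ "\<lambda>x. h x + k x"]) (rule lin_combs_add[OF h(1) k(1)])
  qed
qed

lemma cl_span_L2_scale:
  assumes f: "f \<in> cl_span M (L2 M) S"
  shows "(\<lambda>x. c * f x) \<in> cl_span M (L2 M) S"
  unfolding cl_span_def
proof (intro CollectI conjI allI impI)
  show "(\<lambda>x. c * f x) \<in> L2 M" using f by (intro L2_scale) (simp add: cl_span_def)
  fix \<epsilon> :: real assume \<epsilon>: "\<epsilon> > 0"
  define d where "d = \<epsilon> / (cmod c + 1)"
  have c1: "cmod c + 1 > 0" using norm_ge_zero[of c] by linarith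
  then have "d > 0" using \<epsilon> by (simp add: d_def)
  then obtain h where h: "h \<in> lin_combs S" "L2norm M (\<lambda>x. f x - h x) < d"
    by (rule cl_spanE[OF f])
  have "L2norm M (\<lambda>x. c * f x - c * h x) = cmod c * L2norm M (\<lambda>x. f x - h x)"
    by (simp only: right_diff_distrib[symmetric] L2norm_scale)
  also have "\<dots> \<le> cmod c * d" using h(2) by (intro mult_left_mono) auto
  also have "\<dots> < (cmod c + 1) * d" using \<open>d > 0\<close> by (intro mult_strict_right_mono) auto
  also have "\<dots> = \<epsilon>" using c1 by (simp add: d_def)
  finally show "\<exists>h\<in>lin_combs S. L2norm M (\<lambda>x. c * f x - h x) < \<epsilon>"
    by (rule bexI[of _ "\<lambda>x. c * h x"]) (rule lin_combs_scale[OF h(1)])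
qed

lemma cl_span_L2_zero: "(\<lambda>_. 0) \<in> cl_span M (L2 M) S"
  unfolding cl_span_def by (auto intro!: bexI[of _ "\<lambda>_. 0"] lin_combs_zero)

lemma cl_span_L2_sum:
  assumes "S \<subseteq> L2 M" "\<And>i. i \<in> I \<Longrightarrow> f i \<in> cl_span M (L2 M) S"
  shows "(\<lambda>x. \<Sum>i\<in>I. c i * f i x) \<in> cl_span M (L2 M) S"
  using assms(2)
proof (induction I rule: infinite_finite_induct)
  case (insert i I)
  then have "(\<lambda>x. c i * f i x + (\<Sum>i\<in>I. c i * f i x)) \<in> cl_span M (L2 M) S"
    by (intro cl_span_L2_add[OF assms(1)] cl_span_L2_scale) auto
  then show ?case using insert by simp
qed (simp_all add: cl_span_L2_zero)

lemma L2norm_dominated_convergence: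
  fixes f :: "'a \<Rightarrow> complex"
  assumes [measurable]: "f \<in> borel_measurable M" "\<And>i. s i \<in> borel_measurable M"
    and w: "integrable M (\<lambda>x. (w x)\<^sup>2)"
    and bound: "\<And>i x. x \<in> space M \<Longrightarrow> cmod (f x - s i x) \<le> w x"
    and lim: "\<And>x. x \<in> space M \<Longrightarrow> (\<lambda>i. s i x) \<longlonglongrightarrow> f x"
  shows "(\<lambda>i. L2norm M (\<lambda>x. f x - s i x)) \<longlonglongrightarrow> 0"
proof -
  have "(\<lambda>i. LINT x|M. (cmod (f x - s i x))\<^sup>2) \<longlonglongrightarrow> (LINT x|M. (0::real))"
  proof (rule integral_dominated_convergence[OF _ _ w])
    show "AE x in M. (\<lambda>i. (cmod (f x - s i x))\<^sup>2) \<longlonglongrightarrow> 0"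
    proof (rule AE_I2)
      fix x assume "x \<in> space M"
      then have "(\<lambda>i. (cmod (f x - s i x))\<^sup>2) \<longlonglongrightarrow> (cmod (f x - f x))\<^sup>2"
        by (intro tendsto_intros lim)
      then show "(\<lambda>i. (cmod (f x - s i x))\<^sup>2) \<longlonglongrightarrow> 0" by simp
    qed
    show "AE x in M. norm ((cmod (f x - s i x))\<^sup>2) \<le> (w x)\<^sup>2" for i
      by (rule AE_I2) (use bound in \<open>auto intro!: power_mono\<close>)
  qed measurable
  then have "(\<lambda>i. sqrt (LINT x|M. (cmod (f x - s i x))\<^sup>2)) \<longlonglongrightarrow> sqrt 0"
    by (intro tendsto_real_sqrt) simp
  then show ?thesis by (simp add: L2norm_def)
qed

lemma cl_span_L2_tendsto:
  assumes S: "S \<subseteq> L2 M" and f: "f \<in> L2 M" and s: "\<And>i. s i \<in> cl_span M (L2 M) S"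
    and lim: "(\<lambda>i. L2norm M (\<lambda>x. f x - s i x)) \<longlonglongrightarrow> 0"
  shows "f \<in> cl_span M (L2 M) S"
proof (rule cl_span_L2_limit[OF S f])
  fix \<epsilon> :: real assume "\<epsilon> > 0"
  then have "eventually (\<lambda>i. L2norm M (\<lambda>x. f x - s i x) < \<epsilon>) sequentially"
    using lim by (rule order_tendstoD(2)[rotated])
  then obtain i where "L2norm M (\<lambda>x. f x - s i x) < \<epsilon>"
    by (auto simp: eventually_sequentially)
  then show "\<exists>f'\<in>cl_span M (L2 M) S. L2norm M (\<lambda>x. f x - f' x) < \<epsilon>"
    by (intro bexI[of _ "s i"] s)
qed

text \<open>Density of \<open>S\<close> is reduced to approximating continuous real functions: these
  give indicators of open sets, then of Borel sets, then simple functions, and finally all of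
  L2.\<close>

context
  fixes M :: "'a :: euclidean_space measure" and S :: "('a \<Rightarrow> complex) set"
  assumes fin: "finite_measure M" and sets_M: "sets M = sets borel" and S: "S \<subseteq> L2 M"
    and cont: "\<And>f :: 'a \<Rightarrow> real. continuous_on UNIV f \<Longrightarrow> (\<lambda>x. of_real (f x)) \<in> cl_span M (L2 M) S"
begin

interpretation finite_measure M by (rule fin)

lemma space_M: "space M = UNIV"
  using sets_eq_imp_space_eq[OF sets_M] by simp

text \<open>The continuous functions \<open>min 1 (n * infdist x (- U))\<close> converge to the
  indicator of \<open>U\<close>. The case \<open>U = UNIV\<close> is separate because
  \<open>infdist\<close> to the empty set is 0.\<close>

lemma indicator_open_in_cl_span:
  assumes "open U"
  shows "(\<lambda>x. of_real (indicator U x)) \<in> cl_span M (L2 M) S"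
proof (cases "U = UNIV")
  case True
  then show ?thesis using cont[of "\<lambda>_. 1"] by simp
next
  case False
  define d where "d n x = min 1 (real n * infdist x (- U))" for n x
  note [measurable_cong] = sets_M
  have cd: "continuous_on UNIV (d n)" for n
    unfolding d_def by (intro continuous_intros)
  have [measurable]: "d n \<in> borel_measurable M" for n
    using borel_measurable_continuous_onI[OF cd] measurable_cong_sets[OF sets_M refl] by blast
  have [measurable]: "U \<in> sets M" using assms sets_M by simp
  have lim: "(\<lambda>n. d n x) \<longlonglongrightarrow> indicator U x" for x
  proof (cases "x \<in> U")
    case True
    then have "infdist x (- U) > 0"
      using False assms by (intro infdist_pos_not_in_closed) (auto simp: closed_def)
    then obtain N where N: "real N * infdist x (- U) > 1" using reals_Archimedean3 by blast
    have "d n x = 1" if "n \<ge> N" for n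
    proof -
      have "real N * infdist x (- U) \<le> real n * infdist x (- U)"
        using that by (intro mult_right_mono infdist_nonneg) simp
      then show ?thesis using N by (simp add: d_def)
    qed
    then have "eventually (\<lambda>n. d n x = indicator U x) sequentially"
      using True by (auto simp: eventually_sequentially)
    then show ?thesis by (rule tendsto_eventually)
  next
    case x: False
    then have "infdist x (- U) = 0" by (intro infdist_zero) simp
    then show ?thesis using x by (simp add: d_def)
  qed
  have d01: "0 \<le> d n x" "d n x \<le> 1" for n x
    by (auto simp: d_def infdist_nonneg)
  have "cmod (of_real (indicator U x) - of_real (d n x)) \<le> 1" for n x
    using d01[of n x] by (simp only: of_real_diff[symmetric] norm_of_real) (auto simp: indicator_def)
  then have "(\<lambda>n. L2norm M (\<lambda>x. of_real (indicator U x) - of_real (d n x))) \<longlonglongrightarrow> 0"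
    by (intro L2norm_dominated_convergence[where w = "\<lambda>_. 1"] tendsto_of_real lim) auto
  moreover have "(\<lambda>x. of_real (indicator U x)) \<in> L2 M"
    by (rule L2_bounded[where C = 1]) (auto simp: indicator_def)
  ultimately show ?thesis
    by (rule cl_span_L2_tendsto[OF S, rotated 2]) (rule cont[OF cd])
qed

text \<open>Dynkin induction over the intersection-stable generator of open sets; countable disjoint
  unions are limits of finite ones by dominated convergence.\<close>

lemma indicator_in_cl_span:
  assumes "A \<in> sets borel"
  shows "(\<lambda>x. of_real (indicator A x)) \<in> cl_span M (L2 M) S"
proof -
  have iL2: "(\<lambda>x. of_real (indicator A x)) \<in> L2 M" if "A \<in> sets borel" for A
    using that sets_M by (intro L2_bounded[where C = 1]) (auto simp: indicator_def)
  have "Int_stable {U :: 'a set. open U}" by (auto simp: Int_stable_def)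
  moreover have "{U :: 'a set. open U} \<subseteq> Pow UNIV" by simp
  moreover have "A \<in> sigma_sets UNIV {U. open U}" using assms by (simp add: borel_def)
  ultimately show ?thesis
  proof (induction rule: sigma_sets_induct_disjoint)
    case (basic A)
    then show ?case by (auto intro: indicator_open_in_cl_span)
  next
    case empty
    then show ?case by (simp add: cl_span_L2_zero)
  next
    case (compl A)
    have "(\<lambda>x. of_real 1 + (-1) * of_real (indicator A x)) \<in> cl_span M (L2 M) S"
      by (intro cl_span_L2_add[OF S] cl_span_L2_scale compl cont continuous_intros)
    also have "(\<lambda>x. of_real 1 + (-1) * of_real (indicator A x)) = (\<lambda>x. complex_of_real (indicator (UNIV - A) x))"
      by (auto simp: indicator_def)
    finally show ?case .
  next
    case (union A)
    have A: "A i \<in> sets borel" for i using union(2) by (auto simp: borel_def)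
    then have UA: "(\<Union>i. A i) \<in> sets borel" by auto
    define s where "s n x = (\<Sum>i<n. 1 * complex_of_real (indicator (A i) x))" for n x
    have s: "s n \<in> cl_span M (L2 M) S" for n
      unfolding s_def by (intro cl_span_L2_sum[OF S] union)
    have s_eq: "s n x = of_real (indicator (\<Union>i<n. A i) x)" for n x
    proof -
      have "indicator (\<Union>i<n. A i) x = (\<Sum>i<n. indicator (A i) x :: real)"
        using union(1) by (intro indicator_UN_disjoint) (auto simp: disjoint_family_on_def)
      then show ?thesis by (simp add: s_def)
    qed
    have lim: "(\<lambda>n. s n x) \<longlonglongrightarrow> of_real (indicator (\<Union>i. A i) x)" for x
      unfolding s_eq by (intro tendsto_of_real LIMSEQ_indicator_UN)
    have "(\<lambda>n. L2norm M (\<lambda>x. of_real (indicator (\<Union>i. A i) x) - s n x)) \<longlonglongrightarrow> 0"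
    proof (rule L2norm_dominated_convergence[where w = "\<lambda>_. 1"])
      show "s i \<in> borel_measurable M" for i using s[of i] by (simp add: cl_span_def L2_def)
      show "cmod (of_real (indicator (\<Union>i. A i) x) - s i x) \<le> 1" for i x
        unfolding s_eq by (auto simp: indicator_def)
    qed (use iL2[OF UA] lim in \<open>auto simp: L2_def\<close>)
    then show ?case
      by (rule cl_span_L2_tendsto[OF S iL2[OF UA] s])
  qed
qed

lemma cl_span_eq_L2: "cl_span M (L2 M) S = L2 M"
proof (intro equalityI subsetI)
  fix g assume g: "g \<in> L2 M"
  then have "g \<in> borel_measurable M" by (rule L2_measurable)
  \<comment> \<open>The simple functions are bounded by \<open>2 * cmod (g x)\<close>, so their
    distance to \<open>g\<close> is dominated by \<open>3 * cmod (g x)\<close>, whose square is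
    integrable.\<close>
  from borel_measurable_implies_sequence_metric[OF this, of 0]
  obtain F where F: "\<And>i. simple_function M (F i)"
    "\<And>x. x \<in> space M \<Longrightarrow> (\<lambda>i. F i x) \<longlonglongrightarrow> g x"
    "\<And>i x. x \<in> space M \<Longrightarrow> dist (F i x) 0 \<le> 2 * dist (g x) 0" by blast
  have Fc: "F i \<in> cl_span M (L2 M) S" for i
  proof -
    have eq: "F i = (\<lambda>x. \<Sum>y\<in>F i ` space M. y * of_real (indicator (F i -` {y} \<inter> space M) x))"
    proof
      fix x
      have "F i x = (\<Sum>y\<in>F i ` space M. indicator (F i -` {y} \<inter> space M) x *\<^sub>R y)"
        by (rule simple_function_indicator_representation_banach[OF F(1)]) (simp add: space_M)
      also have "\<dots> = (\<Sum>y\<in>F i ` space M. y * of_real (indicator (F i -` {y} \<inter> space M) x))"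
        by (simp only: scaleR_conv_of_real mult.commute)
      finally show "F i x = (\<Sum>y\<in>F i ` space M. y * of_real (indicator (F i -` {y} \<inter> space M) x))" .
    qed
    have mem: "(\<lambda>x. \<Sum>y\<in>F i ` space M. y * of_real (indicator (F i -` {y} \<inter> space M) x)) \<in> cl_span M (L2 M) S"
      by (intro cl_span_L2_sum[OF S] indicator_in_cl_span)
        (use F(1)[of i] sets_M in \<open>auto simp: simple_function_def\<close>)
    show ?thesis using mem unfolding eq[symmetric] .
  qed
  have "(\<lambda>i. L2norm M (\<lambda>x. g x - F i x)) \<longlonglongrightarrow> 0"
  proof (rule L2norm_dominated_convergence[where w = "\<lambda>x. 3 * cmod (g x)"])
    show "integrable M (\<lambda>x. (3 * cmod (g x))\<^sup>2)"
      using L2_integrable_norm_sq[OF g] by (simp add: power_mult_distrib)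
    show "cmod (g x - F i x) \<le> 3 * cmod (g x)" if "x \<in> space M" for i x
      using norm_triangle_ineq4[of "g x" "F i x"] F(3)[OF that, of i] by simp
    show "F i \<in> borel_measurable M" for i using Fc[of i] by (simp add: cl_span_def L2_def)
  qed (use g F(2) in \<open>auto simp: L2_def\<close>)
  then show "g \<in> cl_span M (L2 M) S" by (rule cl_span_L2_tendsto[OF S g Fc])
qed (simp add: cl_span_def)

end

text \<open>Stone-Weierstrass approximates continuous functions uniformly on the compact set
  \<open>K\<close> that carries the measure. A uniform error \<open>d\<close> is an L2 error of at
  most \<open>sqrt m * d\<close>, with \<open>m\<close> the finite total mass.\<close>

lemma cl_span_eq_L2_polynomial:
  fixes M :: "'a :: euclidean_space measure"
  assumes fin: "finite_measure M" and sets_M: "sets M = sets borel" and S: "S \<subseteq> L2 M"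
    and K: "compact K" "AE x in M. x \<in> K"
    and poly: "\<And>p. real_polynomial_function p \<Longrightarrow> \<exists>h\<in>lin_combs S. AE x in M. of_real (p x) = h x"
  shows "cl_span M (L2 M) S = L2 M"
proof (rule cl_span_eq_L2[OF fin sets_M S])
  interpret finite_measure M by (rule fin)
  fix f :: "'a \<Rightarrow> real" assume f: "continuous_on UNIV f"
  have fm [measurable]: "f \<in> borel_measurable M"
    using borel_measurable_continuous_onI[OF f] measurable_cong_sets[OF sets_M refl] by blast
  have fK: "continuous_on K f" by (rule continuous_on_subset[OF f]) simp
  have "compact (f ` K)" by (rule compact_continuous_image[OF fK K(1)])
  then obtain B where B: "\<And>x. x \<in> K \<Longrightarrow> \<bar>f x\<bar> \<le> B"
    by (metis bounded_iff compact_imp_bounded imageI real_norm_def)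
  have fL: "(\<lambda>x. complex_of_real (f x)) \<in> L2 M"
  proof (rule L2_bounded)
    show "AE x in M. cmod (complex_of_real (f x)) \<le> B"
      using K(2) by eventually_elim (use B in simp)
  qed measurable
  show "(\<lambda>x. complex_of_real (f x)) \<in> cl_span M (L2 M) S"
    unfolding cl_span_def
  proof (intro CollectI conjI fL allI impI)
    fix \<epsilon> :: real assume \<epsilon>: "\<epsilon> > 0"
    define m where "m = measure M (space M)"
    define d where "d = \<epsilon> / (sqrt m + 1)"
    have m: "sqrt m + 1 > 0" by (simp add: m_def add_nonneg_pos)
    have d: "d > 0" using \<epsilon> m by (simp add: d_def)
    obtain p where p: "real_polynomial_function p" "\<And>x. x \<in> K \<Longrightarrow> \<bar>f x - p x\<bar> < d"
      by (rule Stone_Weierstrass_real_polynomial_function[OF K(1) fK d]) blast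
    obtain h where h: "h \<in> lin_combs S" "AE x in M. of_real (p x) = h x"
      using poly[OF p(1)] by (rule bexE)
    have hL: "h \<in> L2 M" using h(1) lin_combs_L2[OF S] by auto
    have "(LINT x|M. (cmod (of_real (f x) - h x))\<^sup>2) \<le> (LINT x|M. d\<^sup>2)"
    proof (rule integral_mono_AE)
      show "AE x in M. (cmod (of_real (f x) - h x))\<^sup>2 \<le> d\<^sup>2"
        using K(2) h(2)
      proof eventually_elim
        case (elim x)
        have "cmod (of_real (f x) - h x) = \<bar>f x - p x\<bar>"
          unfolding elim(2)[symmetric] of_real_diff[symmetric] norm_of_real ..
        then show ?case using p(2)[OF elim(1)] by (intro power_mono) auto
      qed
    qed (auto intro!: L2_integrable_norm_sq L2_diff fL hL)
    also have "\<dots> = m * d\<^sup>2" by (simp add: m_def)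
    finally have "L2norm M (\<lambda>x. of_real (f x) - h x) \<le> sqrt (m * d\<^sup>2)"
      unfolding L2norm_def by (rule real_sqrt_le_mono)
    also have "\<dots> = sqrt m * d" using d by (simp add: real_sqrt_mult)
    also have "\<dots> < (sqrt m + 1) * d" using d by simp
    also have "\<dots> = \<epsilon>" using m by (simp add: d_def)
    finally show "\<exists>h\<in>lin_combs S. L2norm M (\<lambda>x. of_real (f x) - h x) < \<epsilon>"
      by (intro bexI[of _ h] h(1))
  qed
qed

section \<open>Algebras of approximating functions\<close>

text \<open>Equality is asked only on \<open>X\<close> because the boundary family is closed under
  products only where \<open>v\<close> is nonzero, and its negative powers give conjugates only on
  the unit circle.\<close>

lemma lin_combs_mult:
  assumes mult: "\<And>f g. f \<in> T \<Longrightarrow> g \<in> T \<Longrightarrow> \<exists>h\<in>lin_combs T. \<forall>x\<in>X. f x * g x = h x"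
    and f: "f \<in> lin_combs T" and g: "g \<in> lin_combs T"
  shows "\<exists>h\<in>lin_combs T. \<forall>x\<in>X. f x * g x = h x"
proof -
  obtain F c where F: "F \<subseteq> T" "f = (\<lambda>x. \<Sum>t\<in>F. c t * t x)"
    using f by (auto simp: lin_combs_def)
  obtain G d where G: "G \<subseteq> T" "g = (\<lambda>x. \<Sum>t\<in>G. d t * t x)"
    using g by (auto simp: lin_combs_def)
  have "\<exists>H. \<forall>s\<in>T. \<forall>t\<in>T. H s t \<in> lin_combs T \<and> (\<forall>x\<in>X. s x * t x = H s t x)"
    using mult by metis
  then obtain H where H: "\<And>s t. s \<in> T \<Longrightarrow> t \<in> T \<Longrightarrow> H s t \<in> lin_combs T"
    "\<And>s t x. s \<in> T \<Longrightarrow> t \<in> T \<Longrightarrow> x \<in> X \<Longrightarrow> s x * t x = H s t x" by blast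
  let ?h = "\<lambda>x. \<Sum>s\<in>F. c s * (\<Sum>t\<in>G. d t * H s t x)"
  have hm: "?h \<in> lin_combs T" using F(1) G(1) by (intro lin_combs_sum H) auto
  have he: "f x * g x = ?h x" if "x \<in> X" for x
  proof -
    have "f x * g x = (\<Sum>s\<in>F. \<Sum>t\<in>G. c s * (d t * (s x * t x)))"
      unfolding F(2) G(2) sum_product by (simp add: mult_ac)
    also have "\<dots> = (\<Sum>s\<in>F. \<Sum>t\<in>G. c s * (d t * H s t x))"
      using H(2)[OF subsetD[OF F(1)] subsetD[OF G(1)] that] by (intro sum.cong refl) simp
    finally show ?thesis by (simp add: sum_distrib_left)
  qed
  show ?thesis by (rule bexI[OF _ hm]) (rule ballI, erule he)
qed

lemma real_polynomial_in_lin_combs: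
  fixes T :: "('a :: euclidean_space \<Rightarrow> complex) set"
  assumes mult: "\<And>f g. f \<in> T \<Longrightarrow> g \<in> T \<Longrightarrow> \<exists>h\<in>lin_combs T. \<forall>x\<in>X. f x * g x = h x"
    and const: "(\<lambda>_. 1) \<in> T"
    and linear: "\<And>l :: 'a \<Rightarrow> real. bounded_linear l \<Longrightarrow> \<exists>h\<in>lin_combs T. \<forall>x\<in>X. of_real (l x) = h x"
    and p: "real_polynomial_function p"
  shows "\<exists>h\<in>lin_combs T. \<forall>x\<in>X. of_real (p x) = h x"
  using p
proof induction
  case (linear f)
  then show ?case by (rule assms(3))
next
  case (const c)
  show ?case
    using lin_combs_scale[OF lin_combs_base[OF assms(2)], of "of_real c"] by (intro bexI) auto
next
  case (add f g)
  then obtain h k where "h \<in> lin_combs T" "\<forall>x\<in>X. of_real (f x) = h x"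
    "k \<in> lin_combs T" "\<forall>x\<in>X. of_real (g x) = k x" by blast
  then show ?case by (intro bexI[of _ "\<lambda>x. h x + k x"] lin_combs_add) auto
next
  case (mult f g)
  then obtain h k where hk: "h \<in> lin_combs T" "\<forall>x\<in>X. of_real (f x) = h x"
    "k \<in> lin_combs T" "\<forall>x\<in>X. of_real (g x) = k x" by blast
  from lin_combs_mult[OF assms(1) hk(1,3)] obtain l where
    "l \<in> lin_combs T" "\<forall>x\<in>X. h x * k x = l x" by blast
  then show ?case using hk by (intro bexI[of _ l]) auto
qed

section \<open>Density of the polynomials in \<open>z\<close> and its conjugate\<close>

definition zmono :: "nat \<times> nat \<Rightarrow> complex \<Rightarrow> complex" where
  "zmono ab z = z ^ fst ab * cnj z ^ snd ab"

lemma measurable_zmono [measurable]: "zmono ab \<in> borel_measurable borel"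
  unfolding zmono_def by measurable

lemma zmono_bounded: "cmod z < 1 \<Longrightarrow> cmod (zmono ab z) \<le> 1"
  by (auto simp: zmono_def norm_mult norm_power intro!: mult_le_one power_le_one)

lemma zmono_L2:
  assumes "\<gamma> > -1"
  shows "zmono ab \<in> L2 (E_meas \<gamma>)"
proof -
  interpret finite_measure "E_meas \<gamma>" using assms by (rule finite_measure_E_meas)
  show ?thesis
  proof (rule L2_bounded)
    show "AE z in E_meas \<gamma>. cmod (zmono ab z) \<le> 1"
      using AE_E_meas by eventually_elim (rule zmono_bounded)
  qed measurable
qed

lemma zmono_dense:
  assumes "\<gamma> > -1"
  shows "cl_span (E_meas \<gamma>) (L2 (E_meas \<gamma>)) (range zmono) = L2 (E_meas \<gamma>)"
proof (rule cl_span_eq_L2_polynomial[OF finite_measure_E_meas[OF assms]])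
  show "compact (cball (0::complex) 1)" by simp
  show "AE z in E_meas \<gamma>. z \<in> cball 0 1" using AE_E_meas by eventually_elim simp
  show "range zmono \<subseteq> L2 (E_meas \<gamma>)" using zmono_L2[OF assms] by auto
  fix p :: "complex \<Rightarrow> real" assume p: "real_polynomial_function p"
  have "\<exists>h\<in>lin_combs (range zmono). \<forall>x\<in>UNIV. of_real (p x) = h x"
  proof (rule real_polynomial_in_lin_combs[OF _ _ _ p])
    fix f g assume "f \<in> range zmono" "g \<in> range zmono"
    then obtain a b where ab: "f = zmono a" "g = zmono b" by auto
    have "zmono (fst a + fst b, snd a + snd b) \<in> lin_combs (range zmono)"
      by (intro lin_combs_base rangeI)
    then show "\<exists>h\<in>lin_combs (range zmono). \<forall>x\<in>UNIV. f x * g x = h x"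
      by (rule bexI[rotated]) (auto simp: ab zmono_def power_add)
  next
    have "(\<lambda>_. 1) = zmono (0, 0)" by (auto simp: zmono_def)
    then show "(\<lambda>_. 1) \<in> range zmono" by auto
  next
    fix l :: "complex \<Rightarrow> real" assume "bounded_linear l"
    then interpret l: bounded_linear l .
    let ?h = "\<lambda>z. of_real (l 1 / 2) * (zmono (1, 0) z + zmono (0, 1) z)
        + (- \<i> * of_real (l \<i>) / 2) * (zmono (1, 0) z + (-1) * zmono (0, 1) z)"
    have hm: "?h \<in> lin_combs (range zmono)"
      by (intro lin_combs_add lin_combs_scale lin_combs_base rangeI)
    have he: "of_real (l z) = ?h z" for z
    proof -
      have "z = Re z *\<^sub>R 1 + Im z *\<^sub>R \<i>" by (simp add: complex_eq_iff)
      then have "l z = Re z * l 1 + Im z * l \<i>" by (metis l.add l.scaleR real_scaleR_def)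
      then show ?thesis by (simp add: zmono_def complex_eq_iff)
    qed
    show "\<exists>h\<in>lin_combs (range zmono). \<forall>x\<in>UNIV. of_real (l x) = h x"
      by (rule bexI[OF _ hm]) (rule ballI, rule he)
  qed
  then obtain h where h: "h \<in> lin_combs (range zmono)" "\<And>x. of_real (p x) = h x" by blast
  show "\<exists>h\<in>lin_combs (range zmono). AE x in E_meas \<gamma>. of_real (p x) = h x"
    by (rule bexI[OF _ h(1)]) (rule AE_I2, rule h(2))
qed simp

section \<open>The orthonormal basis on the boundary side\<close>

text \<open>For \<open>fst mn = n - 2 k\<close> this is \<open>psiH\<close> without its power of
  \<open>muH\<close> and in the coordinates of \<open>tauG\<close>; the factor \<open>\<i>\<close>
  is the \<open>pi/2\<close> in the phase of \<open>psiE\<close>. All integers occur as first index,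
  including those of parity opposite to \<open>n\<close>.\<close>

definition eB :: "real \<Rightarrow> int \<times> nat \<Rightarrow> complex \<times> real \<Rightarrow> complex" where
  "eB \<gamma> mn p = (\<i> * fst p) powi (fst mn) * of_real (pJ \<gamma> (snd mn) (snd p))"

lemma measurable_power_int [measurable]:
  "f \<in> borel_measurable M \<Longrightarrow> (\<lambda>x. f x powi m :: complex) \<in> borel_measurable M"
  by (cases "m \<ge> 0") (simp_all add: power_int_def)

lemma measurable_eB [measurable]: "eB \<gamma> mn \<in> borel_measurable (borel \<Otimes>\<^sub>M borel)"
  unfolding eB_def[abs_def] by measurable

lemma norm_power_int_1: "cmod v = 1 \<Longrightarrow> cmod (v powi m) = 1"
  by (simp add: norm_power_int)

lemma pJ_bounded: "\<exists>B. \<forall>y. -1 \<le> y \<and> y \<le> 1 \<longrightarrow> \<bar>pJ \<gamma> n y\<bar> \<le> B"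
proof -
  have "compact ((\<lambda>y. poly (pJ_poly \<gamma> n) y) ` {-1..1})"
    by (intro compact_continuous_image continuous_intros) auto
  then obtain B where "\<forall>x\<in>{-1..1}. \<bar>pJ \<gamma> n x\<bar> \<le> B"
    by (auto simp: poly_pJ_poly dest!: compact_imp_bounded simp: bounded_iff)
  then show ?thesis by (intro exI[of _ B]) auto
qed

lemma eB_bounded: "\<exists>B. \<forall>p. cmod (fst p) = 1 \<and> -1 \<le> snd p \<and> snd p \<le> 1 \<longrightarrow> cmod (eB \<gamma> mn p) \<le> B"
proof -
  obtain B where "\<forall>y. -1 \<le> y \<and> y \<le> 1 \<longrightarrow> \<bar>pJ \<gamma> (snd mn) y\<bar> \<le> B" using pJ_bounded by blast
  then show ?thesis
    by (intro exI[of _ B]) (auto simp: eB_def norm_mult norm_power_int_1)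
qed

lemma eB_L2:
  assumes "\<gamma> > -1"
  shows "eB \<gamma> mn \<in> L2 (B_meas \<gamma>)"
proof -
  interpret finite_measure "B_meas \<gamma>" using assms by (rule finite_measure_B_meas)
  obtain B where B: "\<And>p. cmod (fst p) = 1 \<Longrightarrow> -1 \<le> snd p \<Longrightarrow> snd p \<le> 1 \<Longrightarrow> cmod (eB \<gamma> mn p) \<le> B"
    using eB_bounded[of \<gamma> mn] by blast
  show ?thesis
  proof (rule L2_bounded)
    show "AE p in B_meas \<gamma>. cmod (eB \<gamma> mn p) \<le> B"
      using AE_B_meas by eventually_elim (use B in auto)
  qed measurable
qed

lemma integrable_C_meas_bounded:
  fixes f :: "complex \<Rightarrow> complex"
  assumes "f \<in> borel_measurable borel" "\<And>v. cmod v = 1 \<Longrightarrow> cmod (f v) \<le> B"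
  shows "integrable C_meas f"
proof (rule C_meas.integrable_const_bound)
  show "AE v in C_meas. norm (f v) \<le> B" using AE_C_meas by eventually_elim (use assms in auto)
qed (use assms in simp)

text \<open>For \<open>m\<close> nonzero, rotation by a number with \<open>m\<close>-th power
  \<open>-1\<close> preserves the measure and negates the integrand.\<close>

lemma integral_C_meas_power_int:
  "(LINT v|C_meas. v powi m) = (if m = 0 then 2 * pi else 0)"
proof (cases "m = 0")
  case True
  then show ?thesis by (simp add: scaleR_conv_of_real)
next
  case False
  define c where "c = cis (pi / of_int m)"
  have c: "cmod c = 1" "c powi m = -1"
    using False by (simp_all add: c_def cis_power_int)
  have "(LINT v|C_meas. v powi m) = (LINT v|distr C_meas C_meas (\<lambda>w. c * w). v powi m)"
    by (simp only: distr_C_meas_mult[OF c(1)])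
  also have "\<dots> = (LINT v|C_meas. (c * v) powi m)"
    by (subst integral_distr) auto
  also have "\<dots> = - (LINT v|C_meas. v powi m)"
    by (simp add: power_int_mult_distrib c(2))
  finally show ?thesis using False by simp
qed

lemma integral_B_meas_product:
  fixes f :: "complex \<Rightarrow> complex" and g :: "real \<Rightarrow> complex"
  assumes \<gamma>: "\<gamma> > -1" and f [measurable]: "f \<in> borel_measurable borel" and fB: "\<And>v. cmod v = 1 \<Longrightarrow> cmod (f v) \<le> B"
    and g: "continuous_on UNIV g"
  shows "(LINT p|B_meas \<gamma>. f (fst p) * g (snd p)) = (LINT v|C_meas. f v) * (LINT y|W_meas (\<gamma> + 1/2). g y)"
proof -
  have \<gamma>': "\<gamma> + 1/2 > -1" using \<gamma> by simp
  interpret W: finite_measure "W_meas (\<gamma> + 1/2)" by (rule finite_measure_W_meas[OF \<gamma>'])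
  interpret B: finite_measure "B_meas \<gamma>" by (rule finite_measure_B_meas[OF \<gamma>])
  interpret P: pair_sigma_finite C_meas "W_meas (\<gamma> + 1/2)" ..
  have gm [measurable]: "g \<in> borel_measurable borel" by (rule borel_measurable_continuous_onI[OF g])
  have "compact (g ` {-1..1})"
    by (intro compact_continuous_image continuous_on_subset[OF g]) auto
  then obtain D where D: "\<And>y. y \<in> {-1..1} \<Longrightarrow> cmod (g y) \<le> D"
    by (metis bounded_iff compact_imp_bounded imageI)
  have "integrable (B_meas \<gamma>) (\<lambda>p. f (fst p) * g (snd p))"
  proof (rule B.integrable_const_bound)
    show "AE p in B_meas \<gamma>. norm (f (fst p) * g (snd p)) \<le> B * D"
      using AE_B_meas
    proof eventually_elim
      case (elim p)
      then show ?case unfolding norm_mult using fB[of "fst p"] D[of "snd p"]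
        by (intro mult_mono) (auto intro: order.trans[OF norm_ge_zero])
    qed
  qed measurable
  then have "(LINT p|B_meas \<gamma>. f (fst p) * g (snd p)) = (LINT v|C_meas. (LINT y|W_meas (\<gamma> + 1/2). f v * g y))"
    unfolding B_meas_def using P.integral_fst' by fastforce
  then show ?thesis by simp
qed

lemma cnj_power_int_unit:
  assumes "cmod v = 1"
  shows "cnj (v powi m) = v powi (- m)"
proof -
  have "v * cnj v = 1" using complex_norm_square[of v] assms by simp
  then have "cnj v = inverse v" by (simp add: inverse_unique)
  moreover have "cnj (v powi m) = cnj v powi m"
    by (simp add: power_int_def)
  ultimately show ?thesis by (simp add: power_int_minus power_int_inverse)
qed

text \<open>The integral splits over circle and weight; the circle length \<open>2 * pi\<close>
  cancels against the normalization of p_n.\<close>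

lemma eB_orthonormal:
  assumes \<gamma>: "\<gamma> > -1"
  shows "L2inner (B_meas \<gamma>) (eB \<gamma> mn) (eB \<gamma> mn') = (if mn = mn' then 1 else 0)"
proof -
  obtain m n m' n' where mn: "mn = (m, n)" "mn' = (m', n')" by (metis surj_pair)
  have i: "\<i> powi m * cnj (\<i> powi m) = 1" for m
    using complex_norm_square[of "\<i> powi m"] by (simp add: norm_power_int_1)
  have "L2inner (B_meas \<gamma>) (eB \<gamma> mn) (eB \<gamma> mn')
      = (LINT p|B_meas \<gamma>. (\<i> powi m * cnj (\<i> powi m') * (fst p powi (m - m'))) * of_real (poly (pJ_poly \<gamma> n) (snd p) * poly (pJ_poly \<gamma> n') (snd p)))"
    unfolding L2inner_def
  proof (rule integral_cong_AE)
    show "AE p in B_meas \<gamma>. eB \<gamma> mn p * cnj (eB \<gamma> mn' p)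
      = (\<i> powi m * cnj (\<i> powi m') * (fst p powi (m - m'))) * of_real (poly (pJ_poly \<gamma> n) (snd p) * poly (pJ_poly \<gamma> n') (snd p))"
      using AE_B_meas
    proof eventually_elim
      case (elim p)
      then have "fst p \<noteq> 0" by auto
      then have "fst p powi (m - m') = fst p powi m * cnj (fst p powi m')"
        unfolding cnj_power_int_unit[OF conjunct1[OF elim]] by (simp add: power_int_add[symmetric])
      then show ?case by (simp add: eB_def mn poly_pJ_poly power_int_mult_distrib mult_ac)
    qed
    show "(\<lambda>p. (\<i> powi m * cnj (\<i> powi m') * (fst p powi (m - m'))) * of_real (poly (pJ_poly \<gamma> n) (snd p) * poly (pJ_poly \<gamma> n') (snd p))) \<in> borel_measurable (B_meas \<gamma>)"
      unfolding poly_pJ_poly by measurable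
  qed measurable
  also have "\<dots> = (LINT v|C_meas. \<i> powi m * cnj (\<i> powi m') * (v powi (m - m')))
      * (LINT y|W_meas (\<gamma> + 1/2). of_real (poly (pJ_poly \<gamma> n) y * poly (pJ_poly \<gamma> n') y))"
  proof (rule integral_B_meas_product[OF \<gamma>, where B = 1])
    show "cmod (\<i> powi m * cnj (\<i> powi m') * v powi (m - m')) \<le> 1" if "cmod v = 1" for v
      using that by (simp add: norm_mult norm_power_int_1)
  qed (auto intro!: continuous_intros)
  also have "\<dots> = \<i> powi m * cnj (\<i> powi m') * (if m = m' then 2 * pi else 0)
      * of_real (LINT y|W_meas (\<gamma> + 1/2). poly (pJ_poly \<gamma> n) y * poly (pJ_poly \<gamma> n') y)"
    by (subst integral_complex_of_real) (simp add: integral_C_meas_power_int)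
  also have "\<dots> = (if mn = mn' then 1 else 0)"
  proof (cases "m = m'")
    case True
    consider "n = n'" | "n < n'" | "n > n'" by linarith
    then show ?thesis
    proof cases
      case 1
      then show ?thesis using True i[of m] pJ_poly_norm[OF \<gamma>, of n]
        by (simp add: mn mult.assoc[symmetric] del: power_int_of_nat)
    next
      case 2
      then have "(LINT y|W_meas (\<gamma> + 1/2). poly (pJ_poly \<gamma> n') y * poly (pJ_poly \<gamma> n) y) = 0"
        using degree_pJ_poly_le[of \<gamma> n] by (intro pJ_poly_orthogonal[OF \<gamma>]) simp
      then show ?thesis using 2 by (simp add: mn mult.commute)
    next
      case 3
      then have "(LINT y|W_meas (\<gamma> + 1/2). poly (pJ_poly \<gamma> n) y * poly (pJ_poly \<gamma> n') y) = 0"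
        using degree_pJ_poly_le[of \<gamma> n'] by (intro pJ_poly_orthogonal[OF \<gamma>]) simp
      then show ?thesis using 3 by (simp add: mn)
    qed
  qed (simp add: mn)
  finally show ?thesis .
qed

definition vmono :: "int \<times> nat \<Rightarrow> complex \<times> real \<Rightarrow> complex" where
  "vmono mj p = fst p powi (fst mj) * of_real (snd p ^ snd mj)"

text \<open>p_j has exact degree \<open>j\<close>, so it can be solved for \<open>y ^ j\<close>
  modulo lower powers of \<open>y\<close>.\<close>

lemma vmono_in_lin_combs:
  assumes \<gamma>: "\<gamma> > -1"
  shows "vmono (m, j) \<in> lin_combs (range (eB \<gamma>))"
proof (induction j rule: less_induct)
  case (less j)
  let ?P = "pJ_poly \<gamma> j"
  have k: "coeff ?P j \<noteq> 0" using coeff_pJ_poly_pos[OF \<gamma>, of j] by simp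
  have p: "pJ \<gamma> j y = coeff ?P j * y ^ j + (\<Sum>i<j. coeff ?P i * y ^ i)" for y
  proof -
    have "degree ?P = j" using degree_pJ_poly_le[of \<gamma> j] le_degree[OF k] by simp
    then have "pJ \<gamma> j y = (\<Sum>i\<le>j. coeff ?P i * y ^ i)"
      by (simp add: poly_pJ_poly[symmetric] poly_altdef)
    then show ?thesis by (simp add: lessThan_Suc_atMost[symmetric])
  qed
  have i: "\<i> powi (- m) * \<i> powi m = 1" by (simp add: power_int_add[symmetric])
  let ?h = "\<lambda>p. inverse (of_real (coeff ?P j)) * (\<i> powi (- m) * eB \<gamma> (m, j) p + (-1) * (\<Sum>i<j. of_real (coeff ?P i) * vmono (m, i) p))"
  have "?h \<in> lin_combs (range (eB \<gamma>))"
    using less by (intro lin_combs_scale lin_combs_add lin_combs_sum) (auto intro: lin_combs_base)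
  moreover have "?h = vmono (m, j)"
  proof
    fix q :: "complex \<times> real"
    have "\<i> powi (- m) * eB \<gamma> (m, j) q = (\<i> powi (- m) * \<i> powi m) * (fst q powi m * of_real (pJ \<gamma> j (snd q)))"
      by (simp add: eB_def power_int_mult_distrib mult_ac)
    also have "\<dots> = of_real (coeff ?P j) * vmono (m, j) q + (\<Sum>i<j. of_real (coeff ?P i) * vmono (m, i) q)"
      unfolding i p by (simp add: vmono_def sum_distrib_left algebra_simps)
    finally show "?h q = vmono (m, j) q" using k by simp
  qed
  ultimately show ?case by simp
qed

text \<open>On the unit circle Re and Im of \<open>v\<close> are combinations of \<open>v\<close>
  and its inverse, so every real polynomial agrees there with a combination of Laurent monomials in
  \<open>v\<close> times powers of \<open>y\<close>, and these lie in the span of the basis.\<close>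

lemma eB_dense:
  assumes \<gamma>: "\<gamma> > -1"
  shows "cl_span (B_meas \<gamma>) (L2 (B_meas \<gamma>)) (range (eB \<gamma>)) = L2 (B_meas \<gamma>)"
proof (rule cl_span_eq_L2_polynomial[OF finite_measure_B_meas[OF \<gamma>]])
  show "sets (B_meas \<gamma>) = sets borel" by (simp only: sets_B_meas borel_prod)
  show "compact (sphere (0::complex) 1 \<times> {-1..1::real})" by (intro compact_Times) auto
  show "AE p in B_meas \<gamma>. p \<in> sphere 0 1 \<times> {-1..1}"
    using AE_B_meas by eventually_elim (auto simp: mem_Times_iff)
  show "range (eB \<gamma>) \<subseteq> L2 (B_meas \<gamma>)" using eB_L2[OF \<gamma>] by auto
  fix p :: "complex \<times> real \<Rightarrow> real" assume p: "real_polynomial_function p"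
  have "\<exists>h\<in>lin_combs (range vmono). \<forall>x\<in>sphere 0 1 \<times> UNIV. of_real (p x) = h x"
  proof (rule real_polynomial_in_lin_combs[OF _ _ _ p])
    fix f g assume "f \<in> range vmono" "g \<in> range vmono"
    then obtain a b where ab: "f = vmono a" "g = vmono b" by auto
    have "vmono (fst a + fst b, snd a + snd b) \<in> lin_combs (range vmono)"
      by (intro lin_combs_base rangeI)
    moreover have "f x * g x = vmono (fst a + fst b, snd a + snd b) x" if "x \<in> sphere 0 1 \<times> UNIV" for x
    proof -
      have "fst x \<noteq> 0" using that by auto
      then show ?thesis by (simp add: ab vmono_def power_add power_int_add)
    qed
    ultimately show "\<exists>h\<in>lin_combs (range vmono). \<forall>x\<in>sphere 0 1 \<times> UNIV. f x * g x = h x"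
      by (intro bexI[of _ "vmono (fst a + fst b, snd a + snd b)"] ballI)
  next
    have "(\<lambda>_. 1) = vmono (0, 0)" by (auto simp: vmono_def)
    then show "(\<lambda>_. 1) \<in> range vmono" by auto
  next
    fix l :: "complex \<times> real \<Rightarrow> real" assume "bounded_linear l"
    then interpret l: bounded_linear l .
    let ?h = "\<lambda>z. of_real (l (1, 0) / 2) * (vmono (1, 0) z + vmono (-1, 0) z)
        + (- \<i> * of_real (l (\<i>, 0)) / 2) * (vmono (1, 0) z + (-1) * vmono (-1, 0) z)
        + of_real (l (0, 1)) * vmono (0, 1) z"
    have hm: "?h \<in> lin_combs (range vmono)"
      by (intro lin_combs_add lin_combs_scale lin_combs_base rangeI)
    have he: "of_real (l q) = ?h q" if "q \<in> sphere 0 1 \<times> UNIV" for q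
    proof -
      obtain v y where q: "q = (v, y)" by (cases q)
      have v: "cmod v = 1" using that by (simp add: q)
      have "(v, y) = Re v *\<^sub>R (1, 0) + Im v *\<^sub>R (\<i>, 0) + y *\<^sub>R (0, 1)" by (simp add: complex_eq_iff)
      then have "l (v, y) = Re v * l (1, 0) + Im v * l (\<i>, 0) + y * l (0, 1)"
        by (metis l.add l.scaleR real_scaleR_def)
      moreover have "v powi (-1) = cnj v" using cnj_power_int_unit[OF v, of 1] by simp
      ultimately show ?thesis by (simp add: vmono_def q complex_eq_iff)
    qed
    show "\<exists>h\<in>lin_combs (range vmono). \<forall>x\<in>sphere 0 1 \<times> UNIV. of_real (l x) = h x"
      by (rule bexI[OF _ hm]) (rule ballI, erule he)
  qed
  then obtain h where h: "h \<in> lin_combs (range vmono)" "\<forall>x\<in>sphere 0 1 \<times> UNIV. of_real (p x) = h x" by blast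
  have "range vmono \<subseteq> lin_combs (range (eB \<gamma>))" using vmono_in_lin_combs[OF \<gamma>] by auto
  then have "h \<in> lin_combs (range (eB \<gamma>))" using h(1) lin_combs_trans by blast
  moreover have "AE x in B_meas \<gamma>. of_real (p x) = h x"
    using AE_B_meas by eventually_elim (use h(2) in \<open>auto simp: mem_Times_iff\<close>)
  ultimately show "\<exists>h\<in>lin_combs (range (eB \<gamma>)). AE x in B_meas \<gamma>. of_real (p x) = h x" by blast
qed

section \<open>The X-ray transform of the disk and its backprojection\<close>

definition KE :: "real \<Rightarrow> (complex \<Rightarrow> complex) \<Rightarrow> complex \<times> real \<Rightarrow> complex" where
  "KE \<gamma> F p = (LINT u|W_meas \<gamma>. F (chord (p, u)))"

text \<open>\<open>Im (- cnj v * z)\<close> is the signed distance of the chord through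
  \<open>z\<close> with direction \<open>- v\<close>, so this integrates \<open>eB\<close> over all
  oriented chords through \<open>z\<close>.\<close>

definition Zm :: "real \<Rightarrow> int \<times> nat \<Rightarrow> complex \<Rightarrow> complex" where
  "Zm \<gamma> mn z = (LINT v|C_meas. eB \<gamma> mn (v, Im (- cnj v * z)))"

lemma measurable_KE [measurable]:
  assumes [measurable]: "F \<in> borel_measurable borel"
  shows "KE \<gamma> F \<in> borel_measurable (borel \<Otimes>\<^sub>M borel)"
  unfolding KE_def[abs_def] by measurable

lemma measurable_Zm [measurable]: "Zm \<gamma> mn \<in> borel_measurable borel"
proof -
  interpret C: sigma_finite_measure C_meas ..
  show ?thesis unfolding Zm_def[abs_def] by measurable
qed

lemma nn_integral_Santalo:
  assumes \<gamma>: "\<gamma> > -1" and [measurable]: "h \<in> borel_measurable (borel \<Otimes>\<^sub>M borel)"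
  shows "(\<integral>\<^sup>+q. h (fst (fst q), chord q) \<partial>(B_meas \<gamma> \<Otimes>\<^sub>M W_meas \<gamma>)) = (\<integral>\<^sup>+p. h p \<partial>(C_meas \<Otimes>\<^sub>M E_meas \<gamma>))"
proof -
  have "(\<integral>\<^sup>+p. h p \<partial>(C_meas \<Otimes>\<^sub>M E_meas \<gamma>))
     = (\<integral>\<^sup>+p. h p \<partial>distr (B_meas \<gamma> \<Otimes>\<^sub>M W_meas \<gamma>) (C_meas \<Otimes>\<^sub>M E_meas \<gamma>) (\<lambda>q. (fst (fst q), chord q)))"
    by (simp only: Santalo[OF \<gamma>])
  also have "\<dots> = (\<integral>\<^sup>+q. h (fst (fst q), chord q) \<partial>(B_meas \<gamma> \<Otimes>\<^sub>M W_meas \<gamma>))"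
    by (rule nn_integral_distr) measurable
  finally show ?thesis by simp
qed

text \<open>Cauchy-Schwarz against the constant 1. Extended reals cover the chords on which
  \<open>F\<close> is not square-integrable: there the right side is infinite because the mass of
  \<open>W_meas\<close> is nonzero.\<close>

lemma KE_norm_sq_le:
  assumes \<gamma>: "\<gamma> > -1" and [measurable]: "F \<in> borel_measurable borel"
  shows "ennreal ((cmod (KE \<gamma> F p))\<^sup>2) \<le> emeasure (W_meas \<gamma>) UNIV * (\<integral>\<^sup>+u. ennreal ((cmod (F (chord (p, u))))\<^sup>2) \<partial>W_meas \<gamma>)"
proof -
  interpret W: finite_measure "W_meas \<gamma>" by (rule finite_measure_W_meas[OF \<gamma>])
  let ?f = "\<lambda>u. F (chord (p, u))"
  have [measurable]: "?f \<in> borel_measurable (W_meas \<gamma>)"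
    unfolding chord_def fst_conv snd_conv by measurable
  show ?thesis
  proof (cases "?f \<in> L2 (W_meas \<gamma>)")
    case True
    have one: "(\<lambda>_. 1) \<in> L2 (W_meas \<gamma>)" by (rule W.L2_bounded[where C = 1]) auto
    have "cmod (KE \<gamma> F p) \<le> L2norm (W_meas \<gamma>) ?f * L2norm (W_meas \<gamma>) (\<lambda>_. 1)"
      using L2_Cauchy_Schwarz[OF True one] by (simp add: L2inner_def KE_def)
    then have "(cmod (KE \<gamma> F p))\<^sup>2 \<le> (L2norm (W_meas \<gamma>) ?f * L2norm (W_meas \<gamma>) (\<lambda>_. 1))\<^sup>2"
      by (intro power_mono) auto
    also have "\<dots> = measure (W_meas \<gamma>) UNIV * (LINT u|W_meas \<gamma>. (cmod (?f u))\<^sup>2)"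
      by (simp add: power_mult_distrib L2norm_sq)
    finally have "ennreal ((cmod (KE \<gamma> F p))\<^sup>2) \<le> ennreal (measure (W_meas \<gamma>) UNIV * (LINT u|W_meas \<gamma>. (cmod (?f u))\<^sup>2))"
      by (rule ennreal_leI)
    also have "\<dots> = emeasure (W_meas \<gamma>) UNIV * (\<integral>\<^sup>+u. ennreal ((cmod (?f u))\<^sup>2) \<partial>W_meas \<gamma>)"
      using True by (subst nn_integral_eq_integral)
        (auto simp: ennreal_mult W.emeasure_eq_measure L2_def integral_nonneg_AE)
    finally show ?thesis .
  next
    case False
    then have "(\<integral>\<^sup>+u. ennreal ((cmod (?f u))\<^sup>2) \<partial>W_meas \<gamma>) = \<infinity>"
      by (simp add: L2_iff_nn_integral less_top[symmetric])
    moreover have "emeasure (W_meas \<gamma>) UNIV \<noteq> 0"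
      using W_meas_nontrivial[OF \<gamma>] by (subst (asm) AE_iff_measurable[of UNIV]) auto
    ultimately show ?thesis by (simp add: ennreal_mult_top)
  qed
qed

lemma L2_E_meas_measurable: "F \<in> L2 (E_meas \<gamma>) \<Longrightarrow> F \<in> borel_measurable borel"
  using measurable_cong_sets[OF sets_E_meas refl] by (auto simp: L2_def)

text \<open>Integrating the bound of \<open>KE_norm_sq_le\<close> over all chords, Santalo's formula
  turns the right side into a constant times the squared norm of \<open>F\<close>.\<close>

lemma KE_L2:
  assumes \<gamma>: "\<gamma> > -1" and F: "F \<in> L2 (E_meas \<gamma>)"
  shows "KE \<gamma> F \<in> L2 (B_meas \<gamma>)"
proof -
  interpret W: finite_measure "W_meas \<gamma>" by (rule finite_measure_W_meas[OF \<gamma>])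
  interpret E: finite_measure "E_meas \<gamma>" by (rule finite_measure_E_meas[OF \<gamma>])
  have [measurable]: "F \<in> borel_measurable borel" by (rule L2_E_meas_measurable[OF F])
  have "(\<integral>\<^sup>+p. ennreal ((cmod (KE \<gamma> F p))\<^sup>2) \<partial>B_meas \<gamma>)
     \<le> (\<integral>\<^sup>+p. emeasure (W_meas \<gamma>) UNIV * (\<integral>\<^sup>+u. ennreal ((cmod (F (chord (p, u))))\<^sup>2) \<partial>W_meas \<gamma>) \<partial>B_meas \<gamma>)"
    by (intro nn_integral_mono KE_norm_sq_le[OF \<gamma>]) measurable
  also have "\<dots> = emeasure (W_meas \<gamma>) UNIV * (\<integral>\<^sup>+p. (\<integral>\<^sup>+u. ennreal ((cmod (F (chord (p, u))))\<^sup>2) \<partial>W_meas \<gamma>) \<partial>B_meas \<gamma>)"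
    by (rule nn_integral_cmult) measurable
  also have "(\<integral>\<^sup>+p. (\<integral>\<^sup>+u. ennreal ((cmod (F (chord (p, u))))\<^sup>2) \<partial>W_meas \<gamma>) \<partial>B_meas \<gamma>)
     = (\<integral>\<^sup>+q. ennreal ((cmod (F (chord q)))\<^sup>2) \<partial>(B_meas \<gamma> \<Otimes>\<^sub>M W_meas \<gamma>))"
    by (rule W_meas.nn_integral_fst) measurable
  also have "\<dots> = (\<integral>\<^sup>+p. ennreal ((cmod (F (snd p)))\<^sup>2) \<partial>(C_meas \<Otimes>\<^sub>M E_meas \<gamma>))"
    using nn_integral_Santalo[OF \<gamma>, of "\<lambda>p. ennreal ((cmod (F (snd p)))\<^sup>2)"] by simp
  also have "\<dots> = (\<integral>\<^sup>+v. \<integral>\<^sup>+z. ennreal ((cmod (F z))\<^sup>2) \<partial>E_meas \<gamma> \<partial>C_meas)"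
    by (subst E.nn_integral_fst[symmetric]) auto
  also have "\<dots> = (\<integral>\<^sup>+z. ennreal ((cmod (F z))\<^sup>2) \<partial>E_meas \<gamma>) * emeasure C_meas UNIV"
    by simp
  also have "emeasure (W_meas \<gamma>) UNIV * \<dots> < \<infinity>"
    using F C_meas.emeasure_finite[of UNIV] W.emeasure_finite[of UNIV]
    by (auto simp: L2_iff_nn_integral ennreal_mult_eq_top_iff less_top[symmetric])
  finally show ?thesis by (simp add: L2_iff_nn_integral)
qed

lemma Im_chord: "cmod v = 1 \<Longrightarrow> Im (- cnj v * chord ((v, y), u)) = y"
proof -
  assume v: "cmod v = 1"
  have "cnj v * v = 1" using complex_norm_square[of v] v by (simp add: mult.commute)
  then have "- cnj v * chord ((v, y), u) = Complex (u * sqrt (1 - y\<^sup>2)) y"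
    by (simp add: chord_def mult.assoc[symmetric])
  then show ?thesis by simp
qed

text \<open>By \<open>Im_chord\<close> the coordinate \<open>y\<close> can be read off from
  \<open>v\<close> and a point of the chord, so the integrand depends only on direction and point.
  Santalo's formula and Fubini then exchange the integral over chords for one over the disk.\<close>

lemma KE_inner:
  assumes \<gamma>: "\<gamma> > -1" and F: "F \<in> L2 (E_meas \<gamma>)"
  shows "L2inner (B_meas \<gamma>) (KE \<gamma> F) (eB \<gamma> mn) = L2inner (E_meas \<gamma>) F (Zm \<gamma> mn)"
proof -
  interpret W: finite_measure "W_meas \<gamma>" by (rule finite_measure_W_meas[OF \<gamma>])
  interpret E: finite_measure "E_meas \<gamma>" by (rule finite_measure_E_meas[OF \<gamma>])
  interpret B: finite_measure "B_meas \<gamma>" by (rule finite_measure_B_meas[OF \<gamma>])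
  interpret BW: pair_sigma_finite "B_meas \<gamma>" "W_meas \<gamma>" ..
  interpret CE: pair_sigma_finite C_meas "E_meas \<gamma>" ..
  have [measurable]: "F \<in> borel_measurable borel" by (rule L2_E_meas_measurable[OF F])
  define H where "H p = F (snd p) * cnj (eB \<gamma> mn (fst p, Im (- cnj (fst p) * snd p)))" for p
  have H [measurable]: "H \<in> borel_measurable (borel \<Otimes>\<^sub>M borel)" unfolding H_def by measurable
  obtain D where D: "\<And>p. cmod (fst p) = 1 \<Longrightarrow> -1 \<le> snd p \<Longrightarrow> snd p \<le> 1 \<Longrightarrow> cmod (eB \<gamma> mn p) \<le> D"
    using eB_bounded[of \<gamma> mn] by blast
  have aeCE: "AE p in C_meas \<Otimes>\<^sub>M E_meas \<gamma>. cmod (fst p) = 1 \<and> cmod (snd p) < 1"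
  proof (rule CE.AE_pair_measure)
    show "AE v in C_meas. AE z in E_meas \<gamma>. cmod (fst (v, z)) = 1 \<and> cmod (snd (v, z)) < 1"
      using AE_C_meas by eventually_elim (use AE_E_meas in simp)
  qed measurable
  have aeBW: "AE q in B_meas \<gamma> \<Otimes>\<^sub>M W_meas \<gamma>. cmod (fst (fst q)) = 1"
  proof (rule BW.AE_pair_measure)
    show "AE p in B_meas \<gamma>. AE u in W_meas \<gamma>. cmod (fst (fst (p, u))) = 1"
      using AE_B_meas by eventually_elim simp
  qed measurable
  have Fint: "integrable (C_meas \<Otimes>\<^sub>M E_meas \<gamma>) (\<lambda>p. F (snd p))"
  proof (rule integrableI_bounded)
    have "(\<integral>\<^sup>+p. ennreal (cmod (F (snd p))) \<partial>(C_meas \<Otimes>\<^sub>M E_meas \<gamma>)) = (\<integral>\<^sup>+v. \<integral>\<^sup>+z. ennreal (cmod (F z)) \<partial>E_meas \<gamma> \<partial>C_meas)"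
      by (subst E.nn_integral_fst[symmetric]) auto
    also have "\<dots> < \<infinity>"
      using E.L2_integrable[OF F] C_meas.emeasure_finite[of UNIV]
      by (auto simp: integrable_iff_bounded ennreal_mult_eq_top_iff less_top[symmetric])
    finally show "(\<integral>\<^sup>+p. ennreal (norm (F (snd p))) \<partial>(C_meas \<Otimes>\<^sub>M E_meas \<gamma>)) < \<infinity>" .
  qed measurable
  have Hint: "integrable (C_meas \<Otimes>\<^sub>M E_meas \<gamma>) H"
  proof (rule Bochner_Integration.integrable_bound[OF integrable_mult_right[OF integrable_norm[OF Fint], of D]])
    show "AE p in C_meas \<Otimes>\<^sub>M E_meas \<gamma>. norm (H p) \<le> norm (D * norm (F (snd p)))"
      using aeCE
    proof eventually_elim
      case (elim p)
      have "\<bar>Im (- cnj (fst p) * snd p)\<bar> \<le> 1"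
        using abs_Im_le_cmod[of "- cnj (fst p) * snd p"] elim by (simp add: norm_mult)
      then have "cmod (eB \<gamma> mn (fst p, Im (- cnj (fst p) * snd p))) \<le> D"
        using elim by (intro D) auto
      from mult_left_mono[OF this norm_ge_zero[of "F (snd p)"]]
      have "norm (H p) \<le> D * norm (F (snd p))"
        unfolding H_def norm_mult complex_mod_cnj by (simp only: mult.commute)
      then show ?case by (rule order.trans) simp
    qed
  qed measurable
  have m: "(\<lambda>q. (fst (fst q), chord q)) \<in> B_meas \<gamma> \<Otimes>\<^sub>M W_meas \<gamma> \<rightarrow>\<^sub>M C_meas \<Otimes>\<^sub>M E_meas \<gamma>" by measurable
  have eqH: "AE q in B_meas \<gamma> \<Otimes>\<^sub>M W_meas \<gamma>. F (chord q) * cnj (eB \<gamma> mn (fst q)) = H (fst (fst q), chord q)"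
    using aeBW
  proof eventually_elim
    case (elim q)
    then have "Im (- cnj (fst (fst q)) * chord q) = snd (fst q)"
      using Im_chord[of "fst (fst q)" "snd (fst q)" "snd q"] by (simp only: prod.collapse)
    then show ?case unfolding H_def fst_conv snd_conv by (simp only: prod.collapse)
  qed
  have HBW: "integrable (B_meas \<gamma> \<Otimes>\<^sub>M W_meas \<gamma>) (\<lambda>q. H (fst (fst q), chord q))"
    using integrable_distr_eq[OF m, of H] Hint unfolding Santalo[OF \<gamma>] by simp
  then have int: "integrable (B_meas \<gamma> \<Otimes>\<^sub>M W_meas \<gamma>) (\<lambda>q. F (chord q) * cnj (eB \<gamma> mn (fst q)))"
    by (subst integrable_cong_AE[OF _ _ eqH]) auto
  have "L2inner (B_meas \<gamma>) (KE \<gamma> F) (eB \<gamma> mn)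
      = (LINT p|B_meas \<gamma>. (LINT u|W_meas \<gamma>. F (chord (p, u)) * cnj (eB \<gamma> mn p)))"
    by (simp add: L2inner_def KE_def)
  also have "\<dots> = (LINT q|(B_meas \<gamma> \<Otimes>\<^sub>M W_meas \<gamma>). F (chord q) * cnj (eB \<gamma> mn (fst q)))"
    using BW.integral_fst'[OF int] by simp
  also have "\<dots> = (LINT q|(B_meas \<gamma> \<Otimes>\<^sub>M W_meas \<gamma>). H (fst (fst q), chord q))"
    by (rule integral_cong_AE[OF _ _ eqH]) measurable
  also have "\<dots> = (LINT p|distr (B_meas \<gamma> \<Otimes>\<^sub>M W_meas \<gamma>) (C_meas \<Otimes>\<^sub>M E_meas \<gamma>) (\<lambda>q. (fst (fst q), chord q)). H p)"
    by (rule integral_distr[symmetric, OF m]) measurable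
  also have "\<dots> = (LINT p|(C_meas \<Otimes>\<^sub>M E_meas \<gamma>). H p)"
    by (simp only: Santalo[OF \<gamma>])
  also have "\<dots> = (LINT z|E_meas \<gamma>. (LINT v|C_meas. H (v, z)))"
    using CE.integral_snd[of "\<lambda>v z. H (v, z)"] Hint by (simp add: case_prod_beta)
  also have "\<dots> = L2inner (E_meas \<gamma>) F (Zm \<gamma> mn)"
    unfolding L2inner_def Zm_def H_def fst_conv snd_conv
    by (simp only: integral_mult_right_zero Bochner_Integration.integral_cnj)
  finally show ?thesis .
qed

section \<open>The X-ray transform of monomials\<close>

lemma nn_integral_W_meas_uminus:
  assumes [measurable]: "h \<in> borel_measurable borel"
  shows "(\<integral>\<^sup>+y. h (- y) \<partial>W_meas c) = (\<integral>\<^sup>+y. h y \<partial>W_meas c)"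
proof -
  have "(\<integral>\<^sup>+y. h y \<partial>W_meas c) = (\<integral>\<^sup>+u. ennreal (indicator {-1<..<1} u * (1 - u\<^sup>2) powr c) * h u \<partial>lborel)"
    by (rule nn_integral_W_meas) measurable
  also have "\<dots> = (\<integral>\<^sup>+u. ennreal (indicator {-1<..<1} u * (1 - u\<^sup>2) powr c) * h (- u) \<partial>lborel)"
    by (subst nn_integral_real_affine[where c = "-1" and t = 0]) (auto simp: indicator_def intro!: nn_integral_cong)
  also have "\<dots> = (\<integral>\<^sup>+y. h (- y) \<partial>W_meas c)"
    by (rule nn_integral_W_meas[symmetric]) measurable
  finally show ?thesis by simp
qed

lemma distr_W_meas_uminus: "distr (W_meas c) (W_meas c) uminus = W_meas c"
  by (rule measure_eqI_nn_integral) (auto simp: nn_integral_distr nn_integral_W_meas_uminus)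

lemma integral_W_meas_odd:
  assumes "odd j"
  shows "(LINT u|W_meas c. u ^ j) = (0::real)"
proof -
  have "(LINT u|W_meas c. u ^ j) = (LINT u|distr (W_meas c) (W_meas c) uminus. u ^ j)"
    by (simp only: distr_W_meas_uminus)
  also have "\<dots> = (LINT u|W_meas c. (- u) ^ j)" by (rule integral_distr) auto
  also have "\<dots> = - (LINT u|W_meas c. u ^ j)" using assms by simp
  finally show ?thesis by simp
qed

text \<open>The integral over a chord of the monomial \<open>z^a * cnj z^b\<close> is a polynomial in the
  signed distance \<open>y\<close> of the chord to the origin: odd powers of \<open>u\<close> integrate to zero, and
  \<open>sqrt (1 - y\<^sup>2)\<close> then only occurs to even powers.\<close>

definition hom_poly :: "nat \<Rightarrow> nat \<Rightarrow> real poly" where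
  "hom_poly a b = [:1, 1:] ^ a * [:-1, 1:] ^ b"

definition chord_poly :: "real \<Rightarrow> nat \<Rightarrow> nat \<Rightarrow> real poly" where
  "chord_poly \<gamma> a b = (\<Sum>j\<le>a+b. smult (coeff (hom_poly a b) j * (LINT u|W_meas \<gamma>. u ^ j) * (-1) ^ (j div 2))
     (monom 1 (a + b - j) * [:1, 0, -1:] ^ (j div 2)))"

text \<open>Homogenizing a polynomial with a second variable \<open>t\<close> is multiplicative;
  this is the case of one linear factor.\<close>

lemma homogenization_linear_factor:
  fixes s t :: complex
  assumes "degree p \<le> N"
  shows "(\<Sum>j\<le>Suc N. of_real (coeff ([:c, 1:] * p) j) * s ^ j * t ^ (Suc N - j))
    = (s + of_real c * t) * (\<Sum>j\<le>N. of_real (coeff p j) * s ^ j * t ^ (N - j))"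
proof -
  have co: "coeff ([:c, 1:] * p) j = c * coeff p j + coeff (pCons 0 p) j" for j by simp
  have "(\<Sum>j\<le>Suc N. of_real (c * coeff p j) * s ^ j * t ^ (Suc N - j))
      = (\<Sum>j\<le>N. of_real (c * coeff p j) * s ^ j * t ^ (Suc N - j))"
    using assms by (simp add: coeff_eq_0)
  also have "\<dots> = of_real c * t * (\<Sum>j\<le>N. of_real (coeff p j) * s ^ j * t ^ (N - j))"
    unfolding sum_distrib_left by (intro sum.cong refl) (simp add: Suc_diff_le)
  finally have 1: "(\<Sum>j\<le>Suc N. of_real (c * coeff p j) * s ^ j * t ^ (Suc N - j))
      = of_real c * t * (\<Sum>j\<le>N. of_real (coeff p j) * s ^ j * t ^ (N - j))" .
  have 2: "(\<Sum>j\<le>Suc N. of_real (coeff (pCons 0 p) j) * s ^ j * t ^ (Suc N - j))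
      = s * (\<Sum>j\<le>N. of_real (coeff p j) * s ^ j * t ^ (N - j))"
    unfolding sum.atMost_Suc_shift sum_distrib_left by (simp add: mult_ac)
  show ?thesis
    unfolding co of_real_add distrib_right sum.distrib 1 2 by (simp add: algebra_simps)
qed

lemma degree_hom_poly: "degree (hom_poly a b) \<le> a + b"
proof -
  have "degree (hom_poly a b) \<le> 1 * a + 1 * b"
    unfolding hom_poly_def
    by (intro order.trans[OF degree_mult_le] add_mono order.trans[OF degree_power_le]) auto
  then show ?thesis by simp
qed

lemma homogenization:
  fixes s t :: complex
  shows "(s + t) ^ a * (s - t) ^ b = (\<Sum>j\<le>a+b. of_real (coeff (hom_poly a b) j) * s ^ j * t ^ (a + b - j))"
proof (induction a)
  case 0
  show ?case
  proof (induction b)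
    case (Suc b)
    have "hom_poly 0 (Suc b) = [:-1, 1:] * hom_poly 0 b" by (simp add: hom_poly_def)
    then show ?case
      using homogenization_linear_factor[of "hom_poly 0 b" b "-1" s t] degree_hom_poly[of 0 b] Suc
      by simp
  qed (simp add: hom_poly_def)
next
  case (Suc a)
  have "hom_poly (Suc a) b = [:1, 1:] * hom_poly a b" by (simp only: hom_poly_def power_Suc mult.assoc)
  then show ?case
    using homogenization_linear_factor[of "hom_poly a b" "a + b" 1 s t] degree_hom_poly[of a b] Suc
    by (simp add: mult.assoc)
qed

lemma degree_chord_poly: "degree (chord_poly \<gamma> a b) \<le> a + b"
  unfolding chord_poly_def
proof (intro degree_sum_le order.trans[OF degree_smult_le])
  fix j assume "j \<in> {..a + b}"
  have "degree (monom 1 (a + b - j) * [:1, 0, -1:] ^ (j div 2) :: real poly) \<le> (a + b - j) + 2 * (j div 2)"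
    by (intro order.trans[OF degree_mult_le] add_mono order.trans[OF degree_power_le])
      (auto simp: degree_monom_le)
  also have "\<dots> \<le> a + b" using \<open>j \<in> {..a + b}\<close> by auto
  finally show "degree (monom 1 (a + b - j) * [:1, 0, -1:] ^ (j div 2) :: real poly) \<le> a + b" .
qed simp

lemma poly_eq_sum_le:
  fixes p :: "real poly"
  assumes "degree p \<le> N"
  shows "poly p x = (\<Sum>i\<le>N. coeff p i * x ^ i)"
  unfolding poly_altdef using assms
  by (intro sum.mono_neutral_left) (auto simp: coeff_eq_0 not_le)

text \<open>The top coefficient of \<open>(1 - y\<^sup>2) ^ l\<close> is \<open>(-1) ^ l\<close> and
  cancels the sign in \<open>chord_poly\<close>. What remains is the weighted integral of
  \<open>(1 + u) ^ a * (u - 1) ^ b\<close>, a Beta integral.\<close>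

lemma coeff_chord_poly:
  assumes \<gamma>: "\<gamma> > -1"
  shows "coeff (chord_poly \<gamma> a b) (a + b)
    = (-1) ^ b * (2 powr (real (a + b) + 2 * \<gamma> + 1) * Beta (real b + \<gamma> + 1) (real a + \<gamma> + 1))"
proof -
  have lead: "coeff ([:1, 0, -1:] ^ l :: real poly) (2 * l) = (-1) ^ l" for l
  proof -
    have "degree ([:1, 0, -1:] ^ l :: real poly) = 2 * l" by (simp add: degree_power_eq)
    then show ?thesis using lead_coeff_power[of "[:1, 0, -1 :: real:]" l] by simp
  qed
  have "coeff (chord_poly \<gamma> a b) (a + b) = (\<Sum>j\<le>a+b. coeff (hom_poly a b) j * (LINT u|W_meas \<gamma>. u ^ j))"
    unfolding chord_poly_def coeff_sum
  proof (intro sum.cong refl)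
    fix j assume j: "j \<in> {..a + b}"
    show "coeff (smult (coeff (hom_poly a b) j * (LINT u|W_meas \<gamma>. u ^ j) * (-1) ^ (j div 2))
        (monom 1 (a + b - j) * [:1, 0, -1:] ^ (j div 2))) (a + b) = coeff (hom_poly a b) j * (LINT u|W_meas \<gamma>. u ^ j)"
    proof (cases "even j")
      case True
      then have "coeff (monom 1 (a + b - j) * [:1, 0, -1:] ^ (j div 2) :: real poly) (a + b) = (-1) ^ (j div 2)"
        using j lead[of "j div 2"] by (simp add: coeff_monom_mult)
      then show ?thesis by (simp add: mult.assoc power_mult_distrib[symmetric])
    next
      case False
      then show ?thesis by (simp add: integral_W_meas_odd)
    qed
  qed
  also have "\<dots> = (LINT u|W_meas \<gamma>. (\<Sum>j\<le>a+b. coeff (hom_poly a b) j * u ^ j))"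
    by (subst Bochner_Integration.integral_sum)
      (auto intro!: integrable_W_meas_continuous \<gamma> continuous_intros)
  also have "(\<lambda>u. \<Sum>j\<le>a+b. coeff (hom_poly a b) j * u ^ j) = (\<lambda>u. (-1) ^ b * ((1 - u) ^ b * (1 + u) ^ a))"
  proof
    fix u :: real
    have "(\<Sum>j\<le>a+b. coeff (hom_poly a b) j * u ^ j) = poly (hom_poly a b) u"
      by (rule poly_eq_sum_le[symmetric, OF degree_hom_poly])
    also have "\<dots> = (-1) ^ b * ((1 - u) ^ b * (1 + u) ^ a)"
      by (simp add: hom_poly_def power_mult_distrib[symmetric] mult.assoc[symmetric])
    finally show "(\<Sum>j\<le>a+b. coeff (hom_poly a b) j * u ^ j) = (-1) ^ b * ((1 - u) ^ b * (1 + u) ^ a)" .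
  qed
  also have "(LINT u|W_meas \<gamma>. (-1) ^ b * ((1 - u) ^ b * (1 + u) ^ a))
     = (-1) ^ b * (2 powr (real b + real a + 2 * \<gamma> + 1) * Beta (real b + \<gamma> + 1) (real a + \<gamma> + 1))"
    using has_bochner_integral_integral_eq[OF has_bochner_integral_W_meas_Beta[OF \<gamma>, of b a]] by simp
  finally show ?thesis by (simp add: add_ac)
qed

text \<open>On the chord, \<open>z\<close> and \<open>cnj z\<close> are \<open>- v\<close> and
  \<open>- cnj v\<close> times \<open>u * C + \<i> * y\<close> and \<open>u * C - \<i> * y\<close>.
  The homogeneous expansion separates the powers of \<open>u\<close>, and only even ones survive the
  integration.\<close>

lemma KE_zmono:
  assumes \<gamma>: "\<gamma> > -1" and v: "cmod v = 1" and y: "-1 < y" "y < 1"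
  shows "KE \<gamma> (zmono (a, b)) (v, y) = (- v) ^ a * (- cnj v) ^ b * (\<i> ^ (a + b) * of_real (poly (chord_poly \<gamma> a b) y))"
proof -
  define C where "C = sqrt (1 - y\<^sup>2)"
  have "y\<^sup>2 < 1" using y by (simp add: abs_square_less_1 abs_less_iff)
  then have C2: "C\<^sup>2 = 1 - y\<^sup>2" by (simp add: C_def)
  let ?r = "coeff (hom_poly a b)"
  have z: "zmono (a, b) (chord ((v, y), u)) = (- v) ^ a * (- cnj v) ^ b *
      (\<Sum>j\<le>a+b. (of_real (?r j) * of_real C ^ j * (\<i> * of_real y) ^ (a + b - j)) * of_real (u ^ j))" for u
  proof -
    have "chord ((v, y), u) = - v * (of_real (u * C) + \<i> * of_real y)"
      "cnj (chord ((v, y), u)) = - cnj v * (of_real (u * C) - \<i> * of_real y)"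
      by (simp_all add: chord_def C_def Complex_eq)
    then have "zmono (a, b) (chord ((v, y), u)) = (- v) ^ a * (- cnj v) ^ b *
        ((of_real (u * C) + \<i> * of_real y) ^ a * (of_real (u * C) - \<i> * of_real y) ^ b)"
      by (simp only: zmono_def fst_conv snd_conv power_mult_distrib mult_ac)
    then show ?thesis unfolding homogenization by (simp add: power_mult_distrib mult_ac)
  qed
  have "KE \<gamma> (zmono (a, b)) (v, y) = (- v) ^ a * (- cnj v) ^ b *
      (\<Sum>j\<le>a+b. (of_real (?r j) * of_real C ^ j * (\<i> * of_real y) ^ (a + b - j)) * of_real (LINT u|W_meas \<gamma>. u ^ j))"
    unfolding KE_def z integral_complex_of_real[symmetric]
    by (subst integral_mult_right_zero, subst Bochner_Integration.integral_sum)
      (auto intro!: integrable_W_meas_continuous \<gamma> continuous_intros)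
  also have "(\<Sum>j\<le>a+b. (of_real (?r j) * of_real C ^ j * (\<i> * of_real y) ^ (a + b - j)) * of_real (LINT u|W_meas \<gamma>. u ^ j))
     = \<i> ^ (a + b) * of_real (poly (chord_poly \<gamma> a b) y)"
    unfolding chord_poly_def poly_sum of_real_sum sum_distrib_left
  proof (intro sum.cong refl)
    fix j assume j: "j \<in> {..a + b}"
    show "(of_real (?r j) * of_real C ^ j * (\<i> * of_real y) ^ (a + b - j)) * of_real (LINT u|W_meas \<gamma>. u ^ j)
      = \<i> ^ (a + b) * of_real (poly (smult (?r j * (LINT u|W_meas \<gamma>. u ^ j) * (-1) ^ (j div 2)) (monom 1 (a + b - j) * [:1, 0, -1:] ^ (j div 2))) y)"
    proof (cases "even j")
      case True
      then obtain l where l: "j = 2 * l" by auto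
      \<comment> \<open>Factoring out the full power of \<open>\<i>\<close> is the origin of the
        sign \<open>(-1) ^ (j div 2)\<close> in \<open>chord_poly\<close>, which makes that
        polynomial real.\<close>
      have "\<i> ^ (a + b) = \<i> ^ (a + b - j) * \<i> ^ j" using j by (simp add: power_add[symmetric])
      also have "\<i> ^ j = (-1) ^ l" by (simp add: l power_mult)
      finally have i: "\<i> ^ (a + b) = \<i> ^ (a + b - j) * (-1) ^ l" .
      have "C ^ j = (1 - y\<^sup>2) ^ l" by (simp add: l power_mult C2)
      then have c: "complex_of_real C ^ j = of_real ((1 - y\<^sup>2) ^ l)" by (simp only: of_real_power[symmetric])
      have p: "poly [:1, 0, -1:] y = 1 - y\<^sup>2" by (simp add: power2_eq_square)
      have s: "(-1) ^ l * ((-1) ^ l * x) = x" for x :: complex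
        by (simp add: mult.assoc[symmetric] power_mult_distrib[symmetric])
      have jl: "j div 2 = l" by (simp add: l)
      show ?thesis
        unfolding i c jl poly_smult poly_mult poly_power p poly_monom of_real_mult power_mult_distrib of_real_power of_real_minus of_real_1 mult_1
        by (simp only: mult_ac s)
    next
      case False
      then show ?thesis by (simp add: integral_W_meas_odd)
    qed
  qed
  finally show ?thesis .
qed

text \<open>The circle integral selects \<open>m = a - b\<close>; the integral in \<open>y\<close>
  sees only the coefficient of degree \<open>n\<close>, because \<open>chord_poly\<close> has degree
  at most \<open>a + b \<le> n\<close>.\<close>

lemma KE_zmono_inner:
  assumes \<gamma>: "\<gamma> > -1" and ab: "a + b \<le> n"
  shows "L2inner (B_meas \<gamma>) (KE \<gamma> (zmono (a, b))) (eB \<gamma> (m, n))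
    = (-1) ^ (a + b) * cnj (\<i> powi m) * \<i> ^ (a + b) * (if int a - int b = m then 1 else 0)
      * of_real (coeff (chord_poly \<gamma> a b) n / coeff (pJ_poly \<gamma> n) n)"
proof -
  let ?c = "(-1) ^ (a + b) * cnj (\<i> powi m) * \<i> ^ (a + b)"
  let ?Q = "chord_poly \<gamma> a b" and ?P = "pJ_poly \<gamma> n"
  have [measurable]: "(\<lambda>y. poly ?Q y) \<in> borel_measurable borel" "(\<lambda>y. poly ?P y) \<in> borel_measurable borel"
    by (intro borel_measurable_continuous_onI continuous_intros)+
  have [measurable]: "KE \<gamma> (zmono (a, b)) \<in> borel_measurable (borel \<Otimes>\<^sub>M borel)" by measurable
  have "L2inner (B_meas \<gamma>) (KE \<gamma> (zmono (a, b))) (eB \<gamma> (m, n))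
     = (LINT p|B_meas \<gamma>. (?c * fst p powi (int a - int b - m)) * of_real (poly ?P (snd p) * poly ?Q (snd p)))"
    unfolding L2inner_def
  proof (rule integral_cong_AE)
    show "AE p in B_meas \<gamma>. KE \<gamma> (zmono (a, b)) p * cnj (eB \<gamma> (m, n) p)
       = (?c * fst p powi (int a - int b - m)) * of_real (poly ?P (snd p) * poly ?Q (snd p))"
      using AE_B_meas
    proof eventually_elim
      case (elim p)
      obtain v y where p: "p = (v, y)" by (cases p)
      have v: "cmod v = 1" "v \<noteq> 0" and y: "-1 < y" "y < 1" using elim by (auto simp: p)
      have "cnj v = v powi (-1)" using cnj_power_int_unit[OF v(1), of 1] by simp
      then have "cnj v ^ b = v powi (- int b)"
        by (metis mult_minus1 power_int_mult power_int_of_nat)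
      moreover have "cnj (v powi m) = v powi (- m)" by (rule cnj_power_int_unit[OF v(1)])
      moreover have "v powi (int a - int b - m) = v ^ a * v powi (- int b) * v powi (- m)"
        using v(2) by (simp add: power_int_add[symmetric] flip: power_int_of_nat)
      ultimately have pw: "v powi (int a - int b - m) = v ^ a * cnj v ^ b * cnj (v powi m)" by (simp only:)
      have "(- v) ^ a * (- cnj v) ^ b = (-1) ^ (a + b) * (v ^ a * cnj v ^ b)"
        by (simp add: power_minus[of v] power_minus[of "cnj v"] power_add mult_ac)
      then show ?case
        unfolding p KE_zmono[OF \<gamma> v(1) y] pw eB_def fst_conv snd_conv poly_pJ_poly[symmetric]
          power_int_mult_distrib complex_cnj_mult complex_cnj_complex_of_real of_real_mult
        by (simp only: mult_ac)
    qed
  qed measurable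
  also have "\<dots> = (LINT v|C_meas. ?c * v powi (int a - int b - m))
      * (LINT y|W_meas (\<gamma> + 1/2). of_real (poly ?P y * poly ?Q y))"
  proof (rule integral_B_meas_product[OF \<gamma>, where B = 1])
    show "cmod (?c * v powi (int a - int b - m)) \<le> 1" if "cmod v = 1" for v
      using that by (simp add: norm_mult norm_power norm_power_int_1)
  qed (auto intro!: continuous_intros)
  also have "(LINT v|C_meas. ?c * v powi (int a - int b - m)) = ?c * of_real (if int a - int b = m then 2 * pi else 0)"
    unfolding integral_mult_right_zero integral_C_meas_power_int by simp
  also have "(LINT y|W_meas (\<gamma> + 1/2). complex_of_real (poly ?P y * poly ?Q y)) = of_real (coeff ?Q n / (2 * pi * coeff ?P n))"
    unfolding integral_complex_of_real using pJ_poly_integral[OF \<gamma>, of ?Q n] degree_chord_poly[of \<gamma> a b] ab by simp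
  finally show ?thesis by simp
qed

section \<open>Backprojections: expansion, leading term and inner products\<close>

lemma zmono_inner_Zm:
  assumes "\<gamma> > -1" "a + b \<le> n"
  shows "L2inner (E_meas \<gamma>) (zmono (a, b)) (Zm \<gamma> (m, n))
    = (-1) ^ (a + b) * cnj (\<i> powi m) * \<i> ^ (a + b) * (if int a - int b = m then 1 else 0)
      * of_real (coeff (chord_poly \<gamma> a b) n / coeff (pJ_poly \<gamma> n) n)"
  using KE_inner[OF assms(1) zmono_L2[OF assms(1)]] KE_zmono_inner[OF assms] by simp

lemma zmono_inner_Zm_lower:
  assumes "\<gamma> > -1" "a + b < n"
  shows "L2inner (E_meas \<gamma>) (zmono (a, b)) (Zm \<gamma> (m, n)) = 0"
  using zmono_inner_Zm[of \<gamma> a b n m] assms degree_chord_poly[of \<gamma> a b]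
  by (simp add: coeff_eq_0)

text \<open>Write \<open>Im w\<close> as \<open>(w - cnj w) / (2 * \<i>)\<close> and expand
  binomially; integration over the circle keeps the terms in which the total power of
  \<open>v\<close> is zero.\<close>

lemma integral_C_meas_Im_power:
  "(LINT v|C_meas. (\<i> * v) powi m * of_real (Im (- cnj v * z) ^ j))
    = (\<Sum>l\<le>j. (if m + 2 * int l = int j then 2 * pi * \<i> powi m * (1 / (2 * \<i>)) ^ j * of_nat (j choose l) * (-1) ^ (j - l) else 0)
        * zmono (j - l, l) z)"
proof -
  let ?c = "\<lambda>l. \<i> powi m * (1 / (2 * \<i>)) ^ j * of_nat (j choose l) * (-1) ^ (j - l) * zmono (j - l, l) z"
  have "(LINT v|C_meas. (\<i> * v) powi m * of_real (Im (- cnj v * z) ^ j))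
     = (LINT v|C_meas. (\<Sum>l\<le>j. ?c l * v powi (m + 2 * int l - int j)))"
  proof (rule integral_cong_AE)
    show "AE v in C_meas. (\<i> * v) powi m * of_real (Im (- cnj v * z) ^ j) = (\<Sum>l\<le>j. ?c l * v powi (m + 2 * int l - int j))"
      using AE_C_meas
    proof eventually_elim
      case (elim v)
      then have v0: "v \<noteq> 0" by auto
      have cv: "cnj v = v powi (-1)" using cnj_power_int_unit[OF elim, of 1] by simp
      have "complex_of_real (Im w) = 1 / (2 * \<i>) * (w - cnj w)" for w
        by (simp add: complex_eq_iff)
      from this[of "- cnj v * z"] have "complex_of_real (Im (- cnj v * z)) = 1 / (2 * \<i>) * (v * cnj z + (-1) * cnj v * z)"
        by (simp add: add.commute)
      then have "complex_of_real (Im (- cnj v * z) ^ j) = (1 / (2 * \<i>)) ^ j * (v * cnj z + (-1) * cnj v * z) ^ j"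
        by (simp only: of_real_power power_mult_distrib)
      also have "\<dots> = (\<Sum>l\<le>j. (1 / (2 * \<i>)) ^ j * (of_nat (j choose l) * (v * cnj z) ^ l * ((-1) * cnj v * z) ^ (j - l)))"
        unfolding binomial_ring sum_distrib_left ..
      finally have *: "(\<i> * v) powi m * of_real (Im (- cnj v * z) ^ j)
         = (\<Sum>l\<le>j. (\<i> powi m * v powi m) * ((1 / (2 * \<i>)) ^ j * (of_nat (j choose l) * (v * cnj z) ^ l * ((-1) * cnj v * z) ^ (j - l))))"
        by (simp only: sum_distrib_left power_int_mult_distrib)
      show ?case unfolding *
      proof (intro sum.cong refl)
        fix l assume "l \<in> {..j}"
        then have l: "l \<le> j" by simp
        have "cnj v ^ (j - l) = v powi (- int (j - l))" unfolding cv
          by (metis mult_minus1 power_int_mult power_int_of_nat)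
        then have "v powi m * (v ^ l * cnj v ^ (j - l)) = v powi (m + (int l - int (j - l)))"
          using v0 by (simp add: power_int_add power_int_diff power_int_minus divide_inverse)
        also have "m + (int l - int (j - l)) = m + 2 * int l - int j" using l by (simp add: of_nat_diff)
        finally have **: "v powi (m + 2 * int l - int j) = v powi m * (v ^ l * cnj v ^ (j - l))" by simp
        show "(\<i> powi m * v powi m) * ((1 / (2 * \<i>)) ^ j * (of_nat (j choose l) * (v * cnj z) ^ l * ((-1) * cnj v * z) ^ (j - l)))
          = ?c l * v powi (m + 2 * int l - int j)"
          unfolding ** zmono_def fst_conv snd_conv power_mult_distrib by (simp only: mult_ac)
      qed
    qed
  qed measurable
  also have "\<dots> = (\<Sum>l\<le>j. (LINT v|C_meas. ?c l * v powi (m + 2 * int l - int j)))"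
    by (intro Bochner_Integration.integral_sum integrable_mult_right integrable_C_meas_bounded[where B = 1])
      (auto simp: norm_power_int_1)
  also have "\<dots> = (\<Sum>l\<le>j. (if m + 2 * int l = int j then 2 * pi * \<i> powi m * (1 / (2 * \<i>)) ^ j * of_nat (j choose l) * (-1) ^ (j - l) else 0)
        * zmono (j - l, l) z)"
    unfolding integral_mult_right_zero integral_C_meas_power_int
    by (intro sum.cong refl) auto
  finally show ?thesis .
qed

lemma Zm_expand:
  "Zm \<gamma> (m, n) z = (\<Sum>j\<le>n. of_real (coeff (pJ_poly \<gamma> n) j) *
     (\<Sum>l\<le>j. (if m + 2 * int l = int j then 2 * pi * \<i> powi m * (1 / (2 * \<i>)) ^ j * of_nat (j choose l) * (-1) ^ (j - l) else 0)
        * zmono (j - l, l) z))"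
proof -
  have p: "complex_of_real (pJ \<gamma> n y) = (\<Sum>j\<le>n. of_real (coeff (pJ_poly \<gamma> n) j) * of_real (y ^ j))" for y
    unfolding poly_pJ_poly[symmetric] poly_eq_sum_le[OF degree_pJ_poly_le] by simp
  have "Zm \<gamma> (m, n) z = (LINT v|C_meas. (\<Sum>j\<le>n. of_real (coeff (pJ_poly \<gamma> n) j) * ((\<i> * v) powi m * of_real (Im (- cnj v * z) ^ j))))"
    unfolding Zm_def eB_def fst_conv snd_conv p sum_distrib_left by (simp only: mult_ac)
  also have "\<dots> = (\<Sum>j\<le>n. (LINT v|C_meas. of_real (coeff (pJ_poly \<gamma> n) j) * ((\<i> * v) powi m * of_real (Im (- cnj v * z) ^ j))))"
  proof (intro Bochner_Integration.integral_sum integrable_mult_right integrable_C_meas_bounded)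
    fix j v assume "cmod v = 1"
    then have "\<bar>Im (- cnj v * z)\<bar> ^ j \<le> cmod z ^ j"
      using abs_Im_le_cmod[of "- cnj v * z"] by (intro power_mono) (auto simp: norm_mult)
    then show "cmod ((\<i> * v) powi m * of_real (Im (- cnj v * z) ^ j)) \<le> cmod z ^ j"
      using \<open>cmod v = 1\<close> by (simp add: norm_mult norm_power_int_1 norm_power power_abs del: of_real_power flip: of_real_power)
  qed measurable
  finally show ?thesis unfolding integral_mult_right_zero integral_C_meas_Im_power .
qed

text \<open>A surviving term needs \<open>m = j - 2 * l\<close> with
  \<open>l \<le> j \<le> n\<close>, so the modulus of \<open>m\<close> is at most \<open>n\<close>;
  but \<open>n - 2 * k\<close> has modulus greater than \<open>n\<close> for these
  \<open>k\<close>.\<close>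

lemma Zm_eq_0:
  assumes "k < 0 \<or> k > int n"
  shows "Zm \<gamma> (int n - 2 * k, n) z = 0"
  unfolding Zm_expand
proof (rule sum.neutral, rule ballI)
  fix j assume "j \<in> {..n}"
  then have "int n - 2 * k + 2 * int l \<noteq> int j" if "l \<in> {..j}" for l using assms that by auto
  then show "of_real (coeff (pJ_poly \<gamma> n) j) * (\<Sum>l\<le>j. (if int n - 2 * k + 2 * int l = int j
      then 2 * pi * \<i> powi (int n - 2 * k) * (1 / (2 * \<i>)) ^ j * of_nat (j choose l) * (-1) ^ (j - l) else 0) * zmono (j - l, l) z) = 0"
    by (simp add: sum.neutral)
qed

text \<open>The term \<open>j = n\<close>, \<open>l = k\<close> of \<open>Zm_expand\<close>.\<close>

definition Zlead :: "real \<Rightarrow> nat \<Rightarrow> nat \<Rightarrow> complex" where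
  "Zlead \<gamma> n k = of_real (coeff (pJ_poly \<gamma> n) n) *
     (2 * pi * \<i> powi (int n - 2 * int k) * (1 / (2 * \<i>)) ^ n * of_nat (n choose k) * (-1) ^ (n - k))"

text \<open>For \<open>j = n\<close> the selection rule leaves only \<open>l = k\<close>; the terms
  with \<open>j < n\<close> consist of monomials of degree below \<open>n\<close>.\<close>

lemma Zm_leading_term:
  assumes k: "k \<le> n"
  shows "\<exists>h\<in>lin_combs (zmono ` {(a, b). a + b < n}). Zm \<gamma> (int n - 2 * int k, n) = (\<lambda>z. Zlead \<gamma> n k * zmono (n - k, k) z + h z)"
proof -
  let ?m = "int n - 2 * int k"
  let ?c = "\<lambda>j l. (if ?m + 2 * int l = int j then 2 * pi * \<i> powi ?m * (1 / (2 * \<i>)) ^ j * of_nat (j choose l) * (-1) ^ (j - l) else 0)"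
  let ?h = "\<lambda>z. \<Sum>j<n. of_real (coeff (pJ_poly \<gamma> n) j) * (\<Sum>l\<le>j. ?c j l * zmono (j - l, l) z)"
  have h: "?h \<in> lin_combs (zmono ` {(a, b). a + b < n})"
    by (intro lin_combs_sum lin_combs_base imageI) auto
  have "Zm \<gamma> (?m, n) z = Zlead \<gamma> n k * zmono (n - k, k) z + ?h z" for z
  proof -
    have "(\<Sum>l\<le>n. ?c n l * zmono (n - l, l) z) = (\<Sum>l\<le>n. if l = k then ?c n k * zmono (n - k, k) z else 0)"
      by (intro sum.cong refl) auto
    also have "\<dots> = ?c n k * zmono (n - k, k) z" using k by simp
    finally have top: "(\<Sum>l\<le>n. ?c n l * zmono (n - l, l) z) = ?c n k * zmono (n - k, k) z" .
    have "{..n} = insert n {..<n}" by auto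
    then have "Zm \<gamma> (?m, n) z = of_real (coeff (pJ_poly \<gamma> n) n) * (\<Sum>l\<le>n. ?c n l * zmono (n - l, l) z) + ?h z"
      unfolding Zm_expand by (simp only: sum.insert finite_lessThan lessThan_iff less_irrefl not_False_eq_True)
    then show ?thesis unfolding top Zlead_def by (simp add: mult.assoc)
  qed
  then show ?thesis using h by (intro bexI[OF _ h] ext)
qed

text \<open>The leading coefficients are nonzero, so the triangular system is inverted by induction
  on the total degree.\<close>

lemma zmono_in_span_Zm:
  assumes \<gamma>: "\<gamma> > -1"
  shows "zmono (a, b) \<in> lin_combs ((\<lambda>(n, k). Zm \<gamma> (int n - 2 * int k, n)) ` {(n, k). k \<le> n})"
proof (induction "a + b" arbitrary: a b rule: less_induct)
  case less
  let ?S = "(\<lambda>(n, k). Zm \<gamma> (int n - 2 * int k, n)) ` {(n, k). k \<le> n}"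
  let ?n = "a + b"
  obtain h where h: "h \<in> lin_combs (zmono ` {(a, b). a + b < ?n})"
    "Zm \<gamma> (int ?n - 2 * int b, ?n) = (\<lambda>z. Zlead \<gamma> ?n b * zmono (?n - b, b) z + h z)"
    using Zm_leading_term[of b ?n \<gamma>] by auto
  have "zmono ` {(a, b). a + b < ?n} \<subseteq> lin_combs ?S" using less by auto
  then have hS: "h \<in> lin_combs ?S" using h(1) lin_combs_trans by blast
  have nz: "Zlead \<gamma> ?n b \<noteq> 0"
    using coeff_pJ_poly_pos[OF \<gamma>, of ?n] by (simp add: Zlead_def)
  have Z: "Zm \<gamma> (int ?n - 2 * int b, ?n) \<in> lin_combs ?S"
    by (intro lin_combs_base image_eqI[of _ _ "(?n, b)"]) auto
  have "(\<lambda>z. inverse (Zlead \<gamma> ?n b) * (Zm \<gamma> (int ?n - 2 * int b, ?n) z + (-1) * h z)) \<in> lin_combs ?S"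
    by (intro lin_combs_scale lin_combs_add Z hS)
  also have "(\<lambda>z. inverse (Zlead \<gamma> ?n b) * (Zm \<gamma> (int ?n - 2 * int b, ?n) z + (-1) * h z)) = zmono (a, b)"
    unfolding h(2) using nz by auto
  finally show ?case .
qed

lemma Zm_L2:
  assumes \<gamma>: "\<gamma> > -1" and k: "k \<le> n"
  shows "Zm \<gamma> (int n - 2 * int k, n) \<in> L2 (E_meas \<gamma>)"
proof -
  obtain h where h: "h \<in> lin_combs (zmono ` {(a, b). a + b < n})"
    "Zm \<gamma> (int n - 2 * int k, n) = (\<lambda>z. Zlead \<gamma> n k * zmono (n - k, k) z + h z)"
    using Zm_leading_term[OF k] by blast
  have "zmono ` {(a, b). a + b < n} \<subseteq> L2 (E_meas \<gamma>)" using zmono_L2[OF \<gamma>] by auto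
  then have "h \<in> L2 (E_meas \<gamma>)" using h(1) lin_combs_L2 by blast
  then show ?thesis unfolding h(2) by (intro L2_add L2_scale zmono_L2[OF \<gamma>])
qed

lemma lin_combs_inner_zero:
  assumes "S \<subseteq> L2 M" "g \<in> L2 M" "h \<in> lin_combs S" "\<And>f. f \<in> S \<Longrightarrow> L2inner M f g = 0"
  shows "L2inner M h g = 0"
proof -
  obtain F c where F: "F \<subseteq> S" "h = (\<lambda>x. \<Sum>f\<in>F. c f * f x)" using assms(3) by (auto simp: lin_combs_def)
  have "L2inner M h g = (\<Sum>f\<in>F. c f * L2inner M f g)"
    unfolding F(2) using assms F(1) by (intro L2inner_lincomb_left) auto
  also have "\<dots> = 0" using assms(4) F(1) by (intro sum.neutral) auto
  finally show ?thesis .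
qed

text \<open>Since \<open>n \<le> n'\<close>, the lower-degree part of the first argument is
  orthogonal to the second, and so is the leading monomial if \<open>n < n'\<close>. For
  \<open>n = n'\<close> the circle integral separates \<open>k\<close> from
  \<open>k'\<close>.\<close>

lemma Zm_inner_le:
  assumes \<gamma>: "\<gamma> > -1" and k: "k \<le> n" and k': "k' \<le> n'" and n: "n \<le> n'"
  shows "L2inner (E_meas \<gamma>) (Zm \<gamma> (int n - 2 * int k, n)) (Zm \<gamma> (int n' - 2 * int k', n'))
    = (if (n, k) = (n', k') then of_real (sigma_sq \<gamma> n (int k)) else 0)"
proof -
  let ?Z = "Zm \<gamma> (int n' - 2 * int k', n')"
  have Z: "?Z \<in> L2 (E_meas \<gamma>)" by (rule Zm_L2[OF \<gamma> k'])
  obtain h where h: "h \<in> lin_combs (zmono ` {(a, b). a + b < n})"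
    "Zm \<gamma> (int n - 2 * int k, n) = (\<lambda>z. Zlead \<gamma> n k * zmono (n - k, k) z + h z)"
    using Zm_leading_term[OF k] by blast
  have sub: "zmono ` {(a, b). a + b < n} \<subseteq> L2 (E_meas \<gamma>)" using zmono_L2[OF \<gamma>] by auto
  then have hL: "h \<in> L2 (E_meas \<gamma>)" using h(1) lin_combs_L2 by blast
  have "L2inner (E_meas \<gamma>) h ?Z = 0"
    by (rule lin_combs_inner_zero[OF sub Z h(1)]) (use n in \<open>auto intro!: zmono_inner_Zm_lower[OF \<gamma>]\<close>)
  then have "L2inner (E_meas \<gamma>) (Zm \<gamma> (int n - 2 * int k, n)) ?Z = Zlead \<gamma> n k * L2inner (E_meas \<gamma>) (zmono (n - k, k)) ?Z"
    unfolding h(2) by (simp add: L2inner_add_left L2_scale zmono_L2[OF \<gamma>] hL Z L2inner_scale_left)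
  also have "\<dots> = (if (n, k) = (n', k') then of_real (sigma_sq \<gamma> n (int k)) else 0)"
  proof (cases "n = n'")
    case False
    then show ?thesis using n k zmono_inner_Zm_lower[OF \<gamma>, of "n - k" k n'] by simp
  next
    case True
    let ?m = "int n - 2 * int k'"
    have "L2inner (E_meas \<gamma>) (zmono (n - k, k)) ?Z = (-1) ^ n * cnj (\<i> powi ?m) * \<i> ^ n * (if int (n - k) - int k = ?m then 1 else 0)
      * of_real (coeff (chord_poly \<gamma> (n - k) k) n / coeff (pJ_poly \<gamma> n) n)"
      using zmono_inner_Zm[OF \<gamma>, of "n - k" k n ?m] k True by simp
    moreover have "int (n - k) - int k = ?m \<longleftrightarrow> k = k'" using k by (auto simp: of_nat_diff)
    moreover have "Zlead \<gamma> n k * ((-1) ^ n * cnj (\<i> powi (int n - 2 * int k)) * \<i> ^ n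
      * of_real (coeff (chord_poly \<gamma> (n - k) k) n / coeff (pJ_poly \<gamma> n) n)) = of_real (sigma_sq \<gamma> n (int k))"
    proof -
      define t where "t = \<i> powi (int n - 2 * int k)"
      have tt: "t * cnj t = 1" using complex_norm_square[of t] by (simp add: t_def norm_power_int_1)
      have ii: "(1 / (2 * \<i>)) ^ n * \<i> ^ n = of_real (1 / 2 ^ n)"
        by (simp add: power_mult_distrib[symmetric] power_divide)
      define \<kappa> where "\<kappa> = coeff (pJ_poly \<gamma> n) n"
      have \<kappa>: "\<kappa> \<noteq> 0" using coeff_pJ_poly_pos[OF \<gamma>, of n] by (simp add: \<kappa>_def)
      \<comment> \<open>Absolute value of the leading coefficient of \<open>chord_poly\<close>; its
        sign \<open>(-1) ^ k\<close> is absorbed into the product of signs in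
        \<open>sg\<close>.\<close>
      define Q where "Q = 2 powr (real n + 2 * \<gamma> + 1) * Beta (real k + \<gamma> + 1) (real (n - k) + \<gamma> + 1)"
      have co: "coeff (chord_poly \<gamma> (n - k) k) n = (-1) ^ k * Q"
        using coeff_chord_poly[OF \<gamma>, of "n - k" k] k by (simp add: Q_def)
      have sg: "(-1) ^ (n - k) * (-1) ^ n * (-1) ^ k = (1 :: complex)"
        using k by (simp add: power_add[symmetric])
      have "Zlead \<gamma> n k * ((-1) ^ n * cnj t * \<i> ^ n * of_real (coeff (chord_poly \<gamma> (n - k) k) n / \<kappa>))
        = (t * cnj t) * ((1 / (2 * \<i>)) ^ n * \<i> ^ n) * ((-1) ^ (n - k) * (-1) ^ n * (-1) ^ k)
          * (complex_of_real \<kappa> * (complex_of_real (2 * pi) * of_nat (n choose k)) * complex_of_real (Q / \<kappa>))"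
        unfolding Zlead_def co t_def[symmetric] \<kappa>_def[symmetric] times_divide_eq_right[symmetric] of_real_mult of_real_power of_real_minus of_real_1
        by (simp only: mult_ac)
      also have "\<dots> = of_real (1 / 2 ^ n * (2 * pi * real (n choose k)) * Q)"
        unfolding tt ii sg using \<kappa> by simp
      \<comment> \<open>The integer Beta value is the reciprocal of
        \<open>(n + 1) * (n choose k)\<close>, which brings in the denominator of
        \<open>sigma_sq\<close>. The \<open>2 ^ n\<close> cancels against \<open>Q\<close>, and
        \<open>2 * pi\<close> supplies the last factor 2.\<close>
      also have "1 / 2 ^ n * (2 * pi * real (n choose k)) * Q = sigma_sq \<gamma> n (int k)"
      proof -
        have "Beta (real n - real k + 1) (real k + 1) = fact (n - k) * fact k / fact (Suc n)"
        proof -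
          have "Gamma (real (n - k) + 1) = fact (n - k)" "Gamma (real k + 1) = fact k" "Gamma (real (Suc n) + 1) = fact (Suc n)"
            by (simp_all only: Gamma_fact[symmetric] add.commute)
          moreover have "real n - real k + 1 = real (n - k) + 1" "real n - real k + 1 + (real k + 1) = real (Suc n) + 1"
            using k by (simp_all add: of_nat_diff)
          ultimately show ?thesis unfolding Beta_def by (simp only:)
        qed
        also have "fact (Suc n) = (real n + 1) * fact n" by (simp add: add.commute)
        finally have be: "Beta (real n - real k + 1) (real k + 1) = fact (n - k) * fact k / ((real n + 1) * fact n)" .
        have "1 / x / (D / (x * f)) = f / D" if "x \<noteq> 0" "f \<noteq> 0" for x D f :: real
          using that by (simp add: field_simps)
        from this[of "real n + 1" "fact n" "fact (n - k) * fact k"]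
        have b1: "1 / (real n + 1) / Beta (real n - real k + 1) (real k + 1) = real (n choose k)"
          using binomial_fact[OF k, where 'a = real] unfolding be by (simp add: mult.commute)
        have b2: "Beta (real n - real k + 1 + \<gamma>) (real k + 1 + \<gamma>) = Beta (real k + \<gamma> + 1) (real (n - k) + \<gamma> + 1)"
          using k by (subst Beta_commute) (simp add: of_nat_diff add_ac diff_add_eq)
        have b3: "2 powr (real n + 2 * \<gamma> + 1) = 2 ^ n * 2 powr (2 * \<gamma> + 1)" "2 powr (2 * \<gamma> + 2) = 2 * 2 powr (2 * \<gamma> + 1)"
          by (simp_all add: powr_add powr_realpow)
        have "1 / p * (2 * pi * (1 / x / D)) * (p * P * C) = 2 * P * pi / x * (C / D)" if "p \<noteq> 0" for p x D P C :: real
          using that by simp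
        then show ?thesis
          unfolding sigma_sq_def Q_def of_int_of_nat_eq b2 b3 b1[symmetric] by simp
      qed
      finally show ?thesis unfolding t_def \<kappa>_def .
    qed
    ultimately show ?thesis using True by auto
  qed
  finally show ?thesis .
qed

lemma Zm_inner:
  assumes \<gamma>: "\<gamma> > -1" and k: "k \<le> n" and k': "k' \<le> n'"
  shows "L2inner (E_meas \<gamma>) (Zm \<gamma> (int n - 2 * int k, n)) (Zm \<gamma> (int n' - 2 * int k', n'))
    = (if (n, k) = (n', k') then of_real (sigma_sq \<gamma> n (int k)) else 0)"
proof (cases "n \<le> n'")
  case True
  then show ?thesis by (rule Zm_inner_le[OF \<gamma> k k'])
next
  case False
  then have "L2inner (E_meas \<gamma>) (Zm \<gamma> (int n' - 2 * int k', n')) (Zm \<gamma> (int n - 2 * int k, n)) = 0"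
    using Zm_inner_le[OF \<gamma> k' k] by auto
  then show ?thesis
    using L2inner_cnj[of "E_meas \<gamma>" "Zm \<gamma> (int n' - 2 * int k', n')" "Zm \<gamma> (int n - 2 * int k, n)"] False by auto
qed

lemma sigma_sq_pos:
  assumes "\<gamma> > -1" "k \<le> n"
  shows "sigma_sq \<gamma> n (int k) > 0"
  unfolding sigma_sq_def using assms by (intro mult_pos_pos divide_pos_pos Beta_real_pos) auto

lemma Zm_dense:
  assumes \<gamma>: "\<gamma> > -1"
  shows "cl_span (E_meas \<gamma>) (L2 (E_meas \<gamma>)) ((\<lambda>(n, k). Zm \<gamma> (int n - 2 * int k, n)) ` {(n, k). k \<le> n}) = L2 (E_meas \<gamma>)"
proof -
  have "range zmono \<subseteq> lin_combs ((\<lambda>(n, k). Zm \<gamma> (int n - 2 * int k, n)) ` {(n, k). k \<le> n})"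
    using zmono_in_span_Zm[OF \<gamma>] by auto
  then have "lin_combs (range zmono) \<subseteq> lin_combs ((\<lambda>(n, k). Zm \<gamma> (int n - 2 * int k, n)) ` {(n, k). k \<le> n})"
    by (rule lin_combs_trans)
  then have "cl_span (E_meas \<gamma>) (L2 (E_meas \<gamma>)) (range zmono)
     \<subseteq> cl_span (E_meas \<gamma>) (L2 (E_meas \<gamma>)) ((\<lambda>(n, k). Zm \<gamma> (int n - 2 * int k, n)) ` {(n, k). k \<le> n})"
    unfolding cl_span_def by blast
  then show ?thesis unfolding zmono_dense[OF \<gamma>] by (auto simp: cl_span_def)
qed

section \<open>Transfer to the hyperbolic side\<close>

text \<open>If \<open>T\<close> pushes the measure with density \<open>\<rho>\<^sup>2\<close>
  forward to \<open>N\<close>, then sending \<open>F\<close> to \<open>\<rho>\<close> times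
  \<open>F\<close> composed with \<open>T\<close> preserves inner products. The instances are
  \<open>tauG\<close> with weight \<open>rhoG\<close>, and \<open>Phi\<close> with weight 1.\<close>

context
  fixes M :: "'a measure" and N :: "'b measure" and \<rho> :: "'a \<Rightarrow> real" and T :: "'a \<Rightarrow> 'b"
  assumes distr: "distr (density M (\<lambda>x. ennreal ((\<rho> x)\<^sup>2))) N T = N"
    and T [measurable]: "T \<in> M \<rightarrow>\<^sub>M N" and \<rho> [measurable]: "\<rho> \<in> borel_measurable M"
begin

lemma L2_transfer_iff:
  assumes [measurable]: "F \<in> borel_measurable N"
  shows "(\<lambda>x. of_real (\<rho> x) * F (T x)) \<in> L2 M \<longleftrightarrow> F \<in> L2 N"
proof -
  have "(\<integral>\<^sup>+y. ennreal ((cmod (F y))\<^sup>2) \<partial>N) = (\<integral>\<^sup>+y. ennreal ((cmod (F y))\<^sup>2) \<partial>distr (density M (\<lambda>x. ennreal ((\<rho> x)\<^sup>2))) N T)"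
    by (simp only: distr)
  also have "\<dots> = (\<integral>\<^sup>+x. ennreal ((\<rho> x)\<^sup>2) * ennreal ((cmod (F (T x)))\<^sup>2) \<partial>M)"
    by (subst nn_integral_distr) (auto simp: nn_integral_density)
  also have "\<dots> = (\<integral>\<^sup>+x. ennreal ((cmod (of_real (\<rho> x) * F (T x)))\<^sup>2) \<partial>M)"
    by (simp add: norm_mult power_mult_distrib ennreal_mult)
  finally show ?thesis by (simp add: L2_iff_nn_integral)
qed

lemma L2inner_transfer:
  assumes [measurable]: "F \<in> borel_measurable N" "G \<in> borel_measurable N"
  shows "L2inner M (\<lambda>x. of_real (\<rho> x) * F (T x)) (\<lambda>x. of_real (\<rho> x) * G (T x)) = L2inner N F G"
proof -
  have "L2inner N F G = (LINT y|distr (density M (\<lambda>x. ennreal ((\<rho> x)\<^sup>2))) N T. F y * cnj (G y))"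
    unfolding L2inner_def by (simp only: distr)
  also have "\<dots> = (LINT x|M. (\<rho> x)\<^sup>2 *\<^sub>R (F (T x) * cnj (G (T x))))"
    by (subst integral_distr) (auto simp: integral_density)
  also have "\<dots> = L2inner M (\<lambda>x. of_real (\<rho> x) * F (T x)) (\<lambda>x. of_real (\<rho> x) * G (T x))"
    unfolding L2inner_def by (simp add: scaleR_conv_of_real power2_eq_square mult_ac)
  finally show ?thesis by simp
qed

lemma L2norm_transfer:
  assumes "F \<in> borel_measurable N"
  shows "L2norm M (\<lambda>x. of_real (\<rho> x) * F (T x)) = L2norm N F"
proof -
  have "complex_of_real ((L2norm M (\<lambda>x. of_real (\<rho> x) * F (T x)))\<^sup>2) = of_real ((L2norm N F)\<^sup>2)"
    using L2inner_transfer[OF assms assms] unfolding L2inner_self .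
  then have "(L2norm M (\<lambda>x. of_real (\<rho> x) * F (T x)))\<^sup>2 = (L2norm N F)\<^sup>2"
    by (simp only: of_real_eq_iff)
  then show ?thesis by (simp add: power2_eq_iff_nonneg)
qed

text \<open>As \<open>\<rho>\<close> has no zeros, the density does not change which sets are
  null.\<close>

lemma AE_transfer:
  assumes [measurable]: "Measurable.pred N P" and "\<And>x. \<rho> x \<noteq> 0"
  shows "(AE y in N. P y) \<longleftrightarrow> (AE x in M. P (T x))"
proof -
  have "(AE y in N. P y) \<longleftrightarrow> (AE y in distr (density M (\<lambda>x. ennreal ((\<rho> x)\<^sup>2))) N T. P y)"
    by (simp only: distr)
  also have "\<dots> \<longleftrightarrow> (AE x in density M (\<lambda>x. ennreal ((\<rho> x)\<^sup>2)). P (T x))"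
    by (rule AE_distr_iff) (auto simp: pred_def[symmetric])
  also have "\<dots> \<longleftrightarrow> (AE x in M. P (T x))"
    using assms(2) by (subst AE_density) auto
  finally show ?thesis .
qed

end

text \<open>The part of x^(2 + 2 gamma) that is constant along a geodesic; its square is also the
  density that turns \<open>G_meas\<close> into \<open>B_meas\<close>.\<close>

definition rhoG :: "real \<Rightarrow> complex \<times> real \<Rightarrow> real" where
  "rhoG \<gamma> p = muH (snd p) powr (2*\<gamma>+2)"

lemma measurable_rhoG [measurable]: "rhoG \<gamma> \<in> borel_measurable (borel \<Otimes>\<^sub>M borel)"
  unfolding rhoG_def[abs_def] by measurable

lemma rhoG_nonzero: "rhoG \<gamma> p \<noteq> 0"
  unfolding rhoG_def by (metis muH_pos less_irrefl powr_eq_0_iff)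

lemma G_B: "distr (density (G_meas \<gamma>) (\<lambda>p. ennreal ((rhoG \<gamma> p)\<^sup>2))) (B_meas \<gamma>) tauG = B_meas \<gamma>"
  "tauG \<in> G_meas \<gamma> \<rightarrow>\<^sub>M B_meas \<gamma>" "rhoG \<gamma> \<in> borel_measurable (G_meas \<gamma>)"
  unfolding rhoG_def using B_meas_tauG by (simp, measurable)

lemma D_E: "distr (density (D_meas \<gamma>) (\<lambda>x. ennreal ((1::real)\<^sup>2))) (E_meas \<gamma>) Phi = E_meas \<gamma>"
  "Phi \<in> D_meas \<gamma> \<rightarrow>\<^sub>M E_meas \<gamma>" "(\<lambda>_. 1) \<in> borel_measurable (D_meas \<gamma>)"
  using E_meas_Phi by (simp add: density_1, measurable)

text \<open>The angle \<open>beta + pi + 2 alpha\<close> combined with the new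
  \<open>- alpha\<close> gives \<open>beta + alpha + pi\<close>. The scattering relation thus
  reverses a chord, which is the antipodal map in chord coordinates.\<close>

lemma tauG_SAH: "tauG (SAH p) = - tauG p"
proof -
  have "cis (pi + 2 * arctan a) * cis (- arctan a) = - cis (arctan a)" for a
    unfolding cis_mult by (simp add: complex_eq_iff cos_add sin_add flip: mult_2)
  then show ?thesis
    by (auto simp: tauG_def SAH_def case_prod_beta muH_def arctan_minus mult.assoc)
qed

lemma rhoG_SAH: "rhoG \<gamma> (SAH p) = rhoG \<gamma> p"
  by (simp add: rhoG_def SAH_def muH_def)

lemma measurable_uminus_B [measurable]: "uminus \<in> (borel \<Otimes>\<^sub>M borel :: (complex \<times> real) measure) \<rightarrow>\<^sub>M borel \<Otimes>\<^sub>M borel"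
proof -
  have "(\<lambda>p :: complex \<times> real. (- fst p, - snd p)) \<in> borel \<Otimes>\<^sub>M borel \<rightarrow>\<^sub>M borel \<Otimes>\<^sub>M borel" by measurable
  moreover have "uminus = (\<lambda>p :: complex \<times> real. (- fst p, - snd p))" by (auto simp: fun_eq_iff)
  ultimately show ?thesis by (simp only:)
qed

lemma B_meas_uminus: "distr (B_meas \<gamma>) (B_meas \<gamma>) uminus = B_meas \<gamma>"
proof (rule measure_eqI_nn_integral)
  fix h :: "complex \<times> real \<Rightarrow> ennreal"
  assume "h \<in> borel_measurable (distr (B_meas \<gamma>) (B_meas \<gamma>) uminus)"
  then have h [measurable]: "h \<in> borel_measurable (borel \<Otimes>\<^sub>M borel)"
    by (simp add: measurable_def space_pair_measure sets_B_meas)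
  have um: "uminus \<in> B_meas \<gamma> \<rightarrow>\<^sub>M B_meas \<gamma>" by measurable
  have "(\<integral>\<^sup>+p. h p \<partial>distr (B_meas \<gamma>) (B_meas \<gamma>) uminus) = (\<integral>\<^sup>+p. h (- p) \<partial>B_meas \<gamma>)"
    by (rule nn_integral_distr[OF um]) measurable
  also have "\<dots> = (\<integral>\<^sup>+p. h (- fst p, - snd p) \<partial>B_meas \<gamma>)" by (simp add: uminus_prod_def)
  also have "\<dots> = (\<integral>\<^sup>+v. \<integral>\<^sup>+y. h (- v, - y) \<partial>W_meas (\<gamma> + 1/2) \<partial>C_meas)"
    by (subst nn_integral_B_meas) auto
  also have "\<dots> = (\<integral>\<^sup>+v. \<integral>\<^sup>+y. h (- v, y) \<partial>W_meas (\<gamma> + 1/2) \<partial>C_meas)"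
    by (intro nn_integral_cong nn_integral_W_meas_uminus[where h = "\<lambda>y. h (_, y)"]) measurable
  also have "\<dots> = (\<integral>\<^sup>+v. \<integral>\<^sup>+y. h (v, y) \<partial>W_meas (\<gamma> + 1/2) \<partial>C_meas)"
    using nn_integral_C_meas_mult[of "-1" "\<lambda>v. \<integral>\<^sup>+y. h (v, y) \<partial>W_meas (\<gamma> + 1/2)"] by simp
  also have "\<dots> = (\<integral>\<^sup>+p. h p \<partial>B_meas \<gamma>)" by (simp add: nn_integral_B_meas)
  finally show "(\<integral>\<^sup>+p. h p \<partial>distr (B_meas \<gamma>) (B_meas \<gamma>) uminus) = (\<integral>\<^sup>+p. h p \<partial>B_meas \<gamma>)" .
qed simp

lemma eB_uminus: "eB \<gamma> (m, n) (- p) = (-1) powi (m + int n) * eB \<gamma> (m, n) p"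
proof -
  have "(\<i> * - fst p) powi m = ((-1) * (\<i> * fst p)) powi m" by simp
  also have "\<dots> = (-1) powi m * (\<i> * fst p) powi m" by (rule power_int_mult_distrib)
  finally show ?thesis by (simp add: eB_def pJ_minus power_int_add)
qed

text \<open>The antipodal map preserves \<open>B_meas\<close> and the function \<open>G\<close>, but
  negates \<open>eB\<close>, so the inner product equals its own negative.\<close>

lemma inner_eB_odd_zero:
  assumes G [measurable]: "G \<in> borel_measurable (borel \<Otimes>\<^sub>M borel)" and sym: "AE p in B_meas \<gamma>. G (- p) = G p"
    and odd: "odd (m + int n)"
  shows "L2inner (B_meas \<gamma>) G (eB \<gamma> (m, n)) = 0"
proof -
  have m1: "(-1) powi (m + int n) = (-1 :: complex)"
    using odd by (simp add: power_int_minus_left)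
  have "L2inner (B_meas \<gamma>) G (eB \<gamma> (m, n)) = (LINT p|distr (B_meas \<gamma>) (B_meas \<gamma>) uminus. G p * cnj (eB \<gamma> (m, n) p))"
    unfolding L2inner_def by (simp only: B_meas_uminus)
  also have "\<dots> = (LINT p|B_meas \<gamma>. G (- p) * cnj (eB \<gamma> (m, n) (- p)))"
    by (rule integral_distr) measurable
  also have "\<dots> = (LINT p|B_meas \<gamma>. - (G p * cnj (eB \<gamma> (m, n) p)))"
    by (rule integral_cong_AE) (use sym in \<open>auto simp: eB_uminus m1\<close>)
  also have "\<dots> = - L2inner (B_meas \<gamma>) G (eB \<gamma> (m, n))" by (simp add: L2inner_def)
  finally show ?thesis by simp
qed

text \<open>\<open>liftB\<close> divides by the weight and composes with the inverse of \<open>tauG\<close>; the factor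
  \<open>Complex (sqrt (1 - y\<^sup>2)) (- y)\<close> is \<open>cis (- arcsin y)\<close>.\<close>

definition liftB :: "real \<Rightarrow> (complex \<times> real \<Rightarrow> complex) \<Rightarrow> complex \<times> real \<Rightarrow> complex" where
  "liftB \<gamma> g p = g (fst p * Complex (sqrt (1 - (snd p)\<^sup>2)) (- snd p), snd p / sqrt (1 - (snd p)\<^sup>2))
     / of_real ((1 - (snd p)\<^sup>2) powr (\<gamma> + 1))"

lemma liftB_tauG: "of_real (rhoG \<gamma> q) * liftB \<gamma> g (tauG q) = g q"
proof -
  obtain w a where q: "q = (w, a)" by (cases q)
  have mu: "muH a > 0" by simp
  have sq: "1 - (a * muH a)\<^sup>2 = (muH a)\<^sup>2" by (rule muH_sq[symmetric])
  have s: "sqrt (1 - (a * muH a)\<^sup>2) = muH a" unfolding sq by (simp add: abs_of_pos)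
  have "Complex (muH a) (- (a * muH a)) = cis (- arctan a)"
    by (simp add: complex_eq_iff sin_arctan_muH cos_arctan_muH)
  then have e: "w * cis (arctan a) * Complex (muH a) (- (a * muH a)) = w"
    by (simp add: mult.assoc cis_mult)
  have pw: "(muH a)\<^sup>2 powr (\<gamma> + 1) = muH a powr (2*\<gamma>+2)"
  proof -
    have "(muH a)\<^sup>2 powr (\<gamma> + 1) = (muH a powr 2) powr (\<gamma> + 1)"
      using muH_pos[of a, THEN less_imp_le] by simp
    then show ?thesis by (simp only: powr_powr) (simp add: algebra_simps)
  qed
  have nz: "muH a \<noteq> 0" using mu by (rule less_imp_neq[symmetric])
  have "liftB \<gamma> g (tauG q) = g (w, a) / of_real (muH a powr (2*\<gamma>+2))"
    unfolding liftB_def q tauG_def prod.case fst_conv snd_conv unfolding s unfolding sq e pw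
    by (simp add: nz)
  then show ?thesis using rhoG_nonzero[of \<gamma> q] unfolding q rhoG_def snd_conv by simp
qed

lemma measurable_liftB [measurable]:
  assumes [measurable]: "g \<in> borel_measurable (borel \<Otimes>\<^sub>M borel)"
  shows "liftB \<gamma> g \<in> borel_measurable (borel \<Otimes>\<^sub>M borel)"
  unfolding liftB_def[abs_def] by measurable

lemma G_meas_borel: "g \<in> borel_measurable (G_meas \<gamma>) \<longleftrightarrow> g \<in> borel_measurable (borel \<Otimes>\<^sub>M borel)"
  using measurable_cong_sets[OF sets_G_meas refl] by blast

lemma liftB_L2plus:
  assumes g: "g \<in> L2plus \<gamma>"
  shows "liftB \<gamma> g \<in> L2 (B_meas \<gamma>)" "AE p in B_meas \<gamma>. liftB \<gamma> g (- p) = liftB \<gamma> g p"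
proof -
  have gL: "g \<in> L2 (G_meas \<gamma>)" and sym: "AE p in G_meas \<gamma>. g (SAH p) = g p"
    using g by (auto simp: L2plus_def)
  have [measurable]: "g \<in> borel_measurable (borel \<Otimes>\<^sub>M borel)"
    using gL by (simp add: L2_def G_meas_borel)
  have bm: "liftB \<gamma> g \<in> borel_measurable (B_meas \<gamma>)" by measurable
  show "liftB \<gamma> g \<in> L2 (B_meas \<gamma>)"
    using gL L2_transfer_iff[OF G_B bm] by (simp add: liftB_tauG)
  have "AE p in G_meas \<gamma>. liftB \<gamma> g (- tauG p) = liftB \<gamma> g (tauG p)"
    using sym
  proof eventually_elim
    case (elim p)
    have "of_real (rhoG \<gamma> p) * liftB \<gamma> g (- tauG p) = of_real (rhoG \<gamma> p) * liftB \<gamma> g (tauG p)"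
      using liftB_tauG[of \<gamma> "SAH p" g] liftB_tauG[of \<gamma> p g] elim by (simp add: rhoG_SAH tauG_SAH)
    then show ?case using rhoG_nonzero[of \<gamma> p] by simp
  qed
  moreover have "Measurable.pred (B_meas \<gamma>) (\<lambda>p. liftB \<gamma> g (- p) = liftB \<gamma> g p)" by measurable
  ultimately show "AE p in B_meas \<gamma>. liftB \<gamma> g (- p) = liftB \<gamma> g p"
    using AE_transfer[OF G_B] rhoG_nonzero by blast
qed

text \<open>\<open>Arg\<close> is continuous off the nonpositive real axis and on that axis takes
  only the values \<open>pi\<close> and, at the origin, 0.\<close>

lemma measurable_Arg [measurable]: "Arg \<in> borel_measurable borel"
proof -
  have "(\<lambda>z. if z \<in> - \<real>\<^sub>\<le>\<^sub>0 then Arg z else pi) \<in> borel_measurable borel"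
    by (rule borel_measurable_continuous_on_if) (auto intro!: continuous_on_Arg continuous_intros)
  then have "(\<lambda>z. if z = 0 then 0 else if z \<in> - \<real>\<^sub>\<le>\<^sub>0 then Arg z else pi) \<in> borel_measurable borel"
    by measurable
  moreover have "(if z = 0 then 0 else if z \<in> - \<real>\<^sub>\<le>\<^sub>0 then Arg z else pi) = Arg z" for z
    by (cases "z = 0") (simp add: Arg_zero, auto simp: complex_nonpos_Reals_iff Arg_eq_pi eq_commute[of pi "Arg z"] complex_eq_iff order_le_less)
  ultimately show ?thesis by (simp only:)
qed

section \<open>The family \<open>psiH\<close>: orthonormality and completeness among invariant
  functions\<close>

lemma measurable_psiH [measurable]: "psiH \<gamma> n k \<in> borel_measurable (borel \<Otimes>\<^sub>M borel)"
  unfolding psiH_def[abs_def] psiE_def by measurable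

text \<open>\<open>Arg\<close> takes values in a period different from the \<open>{0..2*pi}\<close>
  used for \<open>G_meas\<close>; this is harmless because the phase multiplies the angle by an
  integer. One factor \<open>muH\<close> raises the exponent \<open>2*\<gamma>+1\<close> to that of
  \<open>rhoG\<close>.\<close>

lemma psiH_eq:
  assumes w: "cmod (fst q) = 1"
  shows "psiH \<gamma> n k q = of_real (rhoG \<gamma> q) * eB \<gamma> (int n - 2 * k, n) (tauG q)"
proof -
  obtain w a where q: "q = (w, a)" by (cases q)
  have "cis (Arg w) = w" using w by (subst cis_Arg) (auto simp: q sgn_div_norm)
  then have "\<i> * (w * cis (arctan a)) = cis (pi/2) * (cis (Arg w) * cis (arctan a))" by simp
  also have "\<dots> = cis (Arg w + arctan a + pi/2)" by (simp only: cis_mult add_ac)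
  finally have "(\<i> * (w * cis (arctan a))) powi (int n - 2 * k) = cis (of_int (int n - 2 * k) * (Arg w + arctan a + pi/2))"
    by (simp add: cis_power_int)
  moreover have "muH a * muH a powr (2*\<gamma>+1) = muH a powr (2*\<gamma>+2)"
    using powr_mult_base[OF less_imp_le[OF muH_pos], of a "2*\<gamma>+1"] by (simp add: add_ac)
  then have "complex_of_real (muH a) * of_real (muH a powr (2*\<gamma>+1)) = of_real (muH a powr (2*\<gamma>+2))"
    by (simp only: of_real_mult[symmetric])
  ultimately show ?thesis
    unfolding q psiH_def psiE_def rhoG_def eB_def tauG_def prod.case fst_conv snd_conv sin_arctan_muH cos_arctan_muH
    by (simp only: mult.assoc[symmetric])
qed

lemma AE_psiH: "AE q in G_meas \<gamma>. psiH \<gamma> n k q = of_real (rhoG \<gamma> q) * eB \<gamma> (int n - 2 * k, n) (tauG q)"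
  using AE_G_meas by eventually_elim (rule psiH_eq)

lemma L2_cong_AE:
  assumes "AE x in M. f x = g x" "f \<in> borel_measurable M" "g \<in> borel_measurable M"
  shows "f \<in> L2 M \<longleftrightarrow> g \<in> L2 M"
proof -
  have "(\<integral>\<^sup>+x. ennreal ((cmod (f x))\<^sup>2) \<partial>M) = (\<integral>\<^sup>+x. ennreal ((cmod (g x))\<^sup>2) \<partial>M)"
    by (rule nn_integral_cong_AE) (use assms(1) in auto)
  then show ?thesis using assms by (simp add: L2_iff_nn_integral)
qed

lemma psiH_L2plus:
  assumes \<gamma>: "\<gamma> > -1"
  shows "psiH \<gamma> n k \<in> L2plus \<gamma>"
proof -
  have "(\<lambda>q. of_real (rhoG \<gamma> q) * eB \<gamma> (int n - 2 * k, n) (tauG q)) \<in> L2 (G_meas \<gamma>)"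
    using eB_L2[OF \<gamma>] by (subst L2_transfer_iff[OF G_B]) auto
  then have "psiH \<gamma> n k \<in> L2 (G_meas \<gamma>)"
    by (subst L2_cong_AE[OF AE_psiH]) measurable
  moreover have "AE q in G_meas \<gamma>. psiH \<gamma> n k (SAH q) = psiH \<gamma> n k q"
    using AE_G_meas
  proof eventually_elim
    case (elim q)
    then have "cmod (fst (SAH q)) = 1" by (simp add: SAH_def norm_mult)
    moreover have "(-1) powi (int n - 2 * k + int n) = (1 :: complex)"
      by (simp add: power_int_minus_left)
    ultimately show ?case
      using elim by (simp add: psiH_eq rhoG_SAH tauG_SAH eB_uminus)
  qed
  ultimately show ?thesis by (simp add: L2plus_def)
qed

lemma inner_G_transfer:
  assumes "g \<in> borel_measurable (borel \<Otimes>\<^sub>M borel)" "g' \<in> borel_measurable (borel \<Otimes>\<^sub>M borel)"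
    and [measurable]: "F \<in> borel_measurable (borel \<Otimes>\<^sub>M borel)" "F' \<in> borel_measurable (borel \<Otimes>\<^sub>M borel)"
    and "AE q in G_meas \<gamma>. g q = of_real (rhoG \<gamma> q) * F (tauG q)"
    and "AE q in G_meas \<gamma>. g' q = of_real (rhoG \<gamma> q) * F' (tauG q)"
  shows "L2inner (G_meas \<gamma>) g g' = L2inner (B_meas \<gamma>) F F'"
proof -
  have "L2inner (G_meas \<gamma>) g g' = L2inner (G_meas \<gamma>) (\<lambda>q. of_real (rhoG \<gamma> q) * F (tauG q)) (\<lambda>q. of_real (rhoG \<gamma> q) * F' (tauG q))"
    by (rule L2inner_cong_AE[OF assms(5,6)]) (auto simp: G_meas_borel assms)
  also have "\<dots> = L2inner (B_meas \<gamma>) F F'"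
    by (rule L2inner_transfer[OF G_B]) measurable
  finally show ?thesis .
qed

lemma psiH_orthonormal:
  assumes \<gamma>: "\<gamma> > -1"
  shows "L2inner (G_meas \<gamma>) (psiH \<gamma> n k) (psiH \<gamma> n' k') = (if (n, k) = (n', k') then 1 else 0)"
  by (subst inner_G_transfer[OF _ _ _ _ AE_psiH AE_psiH]) (auto simp: eB_orthonormal[OF \<gamma>])

lemma psiH_approximable:
  assumes \<gamma>: "\<gamma> > -1" and g: "g \<in> L2plus \<gamma>"
  shows "approximable (G_meas \<gamma>) (\<lambda>(n, k). psiH \<gamma> n k) UNIV g"
proof -
  let ?J = "{(m, n). odd (m + int n)}"
  define G where "G = liftB \<gamma> g"
  have gb [measurable]: "g \<in> borel_measurable (borel \<Otimes>\<^sub>M borel)"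
    using g by (simp add: L2plus_def L2_def G_meas_borel)
  have GL: "G \<in> L2 (B_meas \<gamma>)" and Gs: "AE p in B_meas \<gamma>. G (- p) = G p"
    using liftB_L2plus[OF g] by (simp_all add: G_def)
  have Gb [measurable]: "G \<in> borel_measurable (borel \<Otimes>\<^sub>M borel)" unfolding G_def by measurable
  have "approximable (B_meas \<gamma>) (eB \<gamma>) UNIV G"
    using eB_dense[OF \<gamma>] GL unfolding cl_span_image by blast
  then have ap: "approximable (B_meas \<gamma>) (eB \<gamma>) (UNIV - ?J) G"
    by (rule approximable_orthogonal_part[rotated 3])
      (auto simp: eB_L2[OF \<gamma>] eB_orthonormal[OF \<gamma>] GL intro!: inner_eB_odd_zero[OF Gb Gs])
  show ?thesis
    unfolding approximable_def
  proof (intro allI impI)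
    fix \<epsilon> :: real assume "\<epsilon> > 0"
    then obtain F c where F: "finite F" "F \<subseteq> UNIV - ?J"
      and less: "L2norm (B_meas \<gamma>) (\<lambda>x. G x - (\<Sum>i\<in>F. c i * eB \<gamma> i x)) < \<epsilon>"
      by (rule approximableE[OF ap])
    \<comment> \<open>Solves \<open>m = n - 2 * k\<close> for \<open>k\<close>; the division is
      exact because \<open>m + n\<close> is even on \<open>F\<close>.\<close>
    define \<phi> where "\<phi> = (\<lambda>(m, n :: nat). (n, (int n - m) div 2))"
    have \<phi>: "(int (fst (\<phi> i)) - 2 * snd (\<phi> i), fst (\<phi> i)) = i" if "i \<in> F" for i
    proof -
      obtain m n where i: "i = (m, n)" by (cases i)
      have "even (m + int n)" using F(2) that by (auto simp: i)
      then have "even (int n - m)" by presburger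
      then show ?thesis by (simp add: i \<phi>_def)
    qed
    have inj: "inj_on \<phi> F" by (rule inj_on_inverseI[where g = "\<lambda>(n, k). (int n - 2 * k, n)"]) (use \<phi> in \<open>simp add: case_prod_beta\<close>)
    let ?c = "\<lambda>(n, k). c (int n - 2 * k, n)"
    let ?s = "\<lambda>x. \<Sum>i\<in>\<phi> ` F. ?c i * (case i of (n, k) \<Rightarrow> psiH \<gamma> n k) x"
    have "AE q in G_meas \<gamma>. g q - ?s q = of_real (rhoG \<gamma> q) * (G (tauG q) - (\<Sum>i\<in>F. c i * eB \<gamma> i (tauG q)))"
      using AE_G_meas
    proof eventually_elim
      case (elim q)
      have "?s q = (\<Sum>i\<in>F. ?c (\<phi> i) * (case \<phi> i of (n, k) \<Rightarrow> psiH \<gamma> n k) q)"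
        by (simp add: sum.reindex[OF inj])
      also have "\<dots> = (\<Sum>i\<in>F. of_real (rhoG \<gamma> q) * (c i * eB \<gamma> i (tauG q)))"
        using \<phi> by (intro sum.cong refl) (simp add: case_prod_beta psiH_eq[OF elim])
      finally have "?s q = of_real (rhoG \<gamma> q) * (\<Sum>i\<in>F. c i * eB \<gamma> i (tauG q))"
        by (simp add: sum_distrib_left)
      then show ?case
        using liftB_tauG[of \<gamma> q g] by (simp add: G_def right_diff_distrib)
    qed
    then have "L2norm (G_meas \<gamma>) (\<lambda>q. g q - ?s q)
       = L2norm (G_meas \<gamma>) (\<lambda>q. of_real (rhoG \<gamma> q) * (G (tauG q) - (\<Sum>i\<in>F. c i * eB \<gamma> i (tauG q))))"
      by (rule L2norm_cong_AE) (auto simp: case_prod_beta)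
    also have "\<dots> = L2norm (B_meas \<gamma>) (\<lambda>x. G x - (\<Sum>i\<in>F. c i * eB \<gamma> i x))"
      by (rule L2norm_transfer[OF G_B]) measurable
    finally have "L2norm (G_meas \<gamma>) (\<lambda>q. g q - ?s q) < \<epsilon>" using less by simp
    moreover have "finite (\<phi> ` F)" using F(1) by simp
    ultimately show "\<exists>F c. finite F \<and> F \<subseteq> UNIV \<and> L2norm (G_meas \<gamma>) (\<lambda>x. g x - (\<Sum>i\<in>F. c i * (case i of (n, k) \<Rightarrow> psiH \<gamma> n k) x)) < \<epsilon>"
      by (intro exI[of _ "\<phi> ` F"] exI[of _ ?c] conjI subset_UNIV)
  qed
qed

section \<open>Geodesics as chords and the factorization of the hyperbolic transform\<close>

lemma measurable_geodH [measurable]: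
  "(\<lambda>(p, t). geodH (fst p) (snd p) t) \<in> borel_measurable ((borel \<Otimes>\<^sub>M borel) \<Otimes>\<^sub>M borel)"
  unfolding geodH_def by measurable

text \<open>\<open>tanh (t / 2) = (exp t - 1) / (exp t + 1)\<close>; numerator and denominator then
  share the factor \<open>2 / (exp t + 1)\<close>.\<close>

lemma geodH_exp:
  "geodH w a t = w * (of_real (exp t - 1) + \<i> * of_real (a * exp t)) / (\<i> * of_real (a * exp t) - of_real (exp t + 1))"
proof -
  define E where "E = exp t"
  have E: "E + 1 > 0" by (simp add: E_def add_pos_pos)
  have th: "tanh (t / 2) = (E - 1) / (E + 1)"
  proof -
    have "tanh (t / 2) = tanh (ln (sqrt E))" by (simp add: E_def ln_sqrt)
    also have "\<dots> = ((sqrt E)\<^sup>2 - 1) / ((sqrt E)\<^sup>2 + 1)" by (rule tanh_ln_real) (simp add: E_def)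
    finally show ?thesis by (simp add: E_def)
  qed
  define e where "e = complex_of_real (E + 1)"
  have e: "e \<noteq> 0" using E by (simp add: e_def del: of_real_add)
  have T: "complex_of_real (tanh (t / 2)) = of_real (E - 1) / e"
    by (simp add: th e_def)
  have a1: "(2 + \<i> * of_real a) * (of_real (E - 1) / e) + \<i> * of_real a = 2 / e * (of_real (E - 1) + \<i> * of_real (a * E))"
    using e by (simp add: field_simps) (simp add: e_def algebra_simps)
  have a2: "\<i> * of_real a * (of_real (E - 1) / e) - 2 + \<i> * of_real a = 2 / e * (\<i> * of_real (a * E) - of_real (E + 1))"
    using e by (simp add: field_simps) (simp add: e_def algebra_simps)
  have c: "2 / e \<noteq> 0" using e by simp
  show ?thesis
    unfolding geodH_def T E_def[symmetric] a1 a2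
    by (simp only: mult_divide_mult_cancel_left[OF c] times_divide_eq_right)
qed

text \<open>The chord carries the position \<open>tanh\<close> of arc length measured from its
  midpoint, and the shift \<open>ln (sqrt (1 + a\<^sup>2))\<close> places that midpoint relative to
  the parameter \<open>t\<close> of \<open>geodH\<close>.\<close>

lemma geodH_Klein:
  fixes a t :: real
  assumes w: "cmod w = 1"
  shows "cmod (geodH w a t) < 1"
    and "Phi (geodH w a t) = chord (tauG (w, a), tanh (t + ln (sqrt (1 + a\<^sup>2))))"
proof -
  define u where "u = (\<lambda>t. tanh (t + ln (sqrt (1 + a\<^sup>2))))"
  define E where "E = exp t"
  have E: "E > 0" by (simp add: E_def)
  define n where "n = complex_of_real (E - 1) + \<i> * of_real (a * E)"
  define d where "d = \<i> * complex_of_real (a * E) - of_real (E + 1)"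
  have g: "geodH w a t = w * n / d" by (simp add: geodH_exp n_def d_def E_def)
  have n2: "(cmod n)\<^sup>2 = (E - 1)\<^sup>2 + (a * E)\<^sup>2" by (simp add: n_def cmod_power2)
  have d2: "(cmod d)\<^sup>2 = (E + 1)\<^sup>2 + (a * E)\<^sup>2" by (simp add: d_def cmod_power2 power2_commute add.commute[of 1 E])
  \<comment> \<open>The difference \<open>4 * E\<close> puts the geodesic inside the disk; the sum
    of the same two squares gives the denominator of \<open>Phi\<close>.\<close>
  have dn: "(cmod d)\<^sup>2 = (cmod n)\<^sup>2 + 4 * E" unfolding n2 d2 by (simp add: power2_eq_square algebra_simps)
  have "(cmod n)\<^sup>2 < (cmod d)\<^sup>2" using E dn by simp
  then have nd: "cmod n < cmod d" by (rule power2_less_imp_less) simp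
  then have d0: "cmod d > 0" by (rule le_less_trans[OF norm_ge_zero])
  show "cmod (geodH w a t) < 1"
    using nd d0 w by (simp add: g norm_mult norm_divide)
  define R where "R = 1 + a\<^sup>2"
  have R: "R > 0" by (simp add: R_def add_pos_nonneg)
  define q where "q = 1 + R * E\<^sup>2"
  have q: "q > 0" using R by (simp add: q_def add_pos_nonneg)
  have sum: "(cmod d)\<^sup>2 + (cmod n)\<^sup>2 = 2 * q"
    unfolding n2 d2 q_def R_def by (simp add: power2_eq_square algebra_simps)
  have "1 + (cmod (geodH w a t))\<^sup>2 = 2 * q / (cmod d)\<^sup>2"
    using d0 w by (simp add: g norm_mult norm_divide power_divide sum[symmetric] add_divide_distrib)
  then have "Phi (geodH w a t) = 2 * (w * n / d) / of_real (2 * q / (cmod d)\<^sup>2)"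
    unfolding Phi_def by (simp only: g)
  also have "\<dots> = w * n * cnj d / of_real q"
    using d0 q complex_norm_square[of d] by (simp add: field_simps)
  finally have P: "Phi (geodH w a t) = w * (n * cnj d) / of_real q" by (simp add: mult.assoc)
  \<comment> \<open>\<open>j\<close> is \<open>cis (arctan a)\<close> up to the factor
    \<open>muH a\<close>. Moreover \<open>n = E * j - 1\<close> and
    \<open>cnj d = - (E * j + 1)\<close>, so their product is a difference of squares.\<close>
  define j where "j = 1 + \<i> * complex_of_real a"
  have jj: "j * cnj j = of_real R" by (simp add: j_def R_def complex_eq_iff power2_eq_square)
  have ncd: "n * cnj d = 1 - of_real (E\<^sup>2) * j\<^sup>2"
    by (simp add: n_def d_def j_def complex_eq_iff power2_eq_square algebra_simps)
  have mu2: "(muH a)\<^sup>2 = 1 / R" using R by (simp add: muH_def R_def power_divide)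
  have s: "sqrt (1 - (a * muH a)\<^sup>2) = muH a" by (simp add: muH_sq[symmetric] abs_of_pos)
  \<comment> \<open>The exponential of twice the shifted parameter is \<open>R * E\<^sup>2\<close>,
    which is \<open>q - 1\<close>.\<close>
  have ut: "u t = (R * E\<^sup>2 - 1) / q"
  proof -
    have "u t = tanh (ln (E * sqrt R))" using R by (simp add: u_def ln_mult E_def R_def)
    also have "\<dots> = ((E * sqrt R)\<^sup>2 - 1) / ((E * sqrt R)\<^sup>2 + 1)"
      using E R by (intro tanh_ln_real) simp
    also have "(E * sqrt R)\<^sup>2 = R * E\<^sup>2" using R by (simp add: power_mult_distrib)
    finally show ?thesis by (simp add: q_def add.commute)
  qed
  have "cis (arctan a) = of_real (muH a) * j"
    by (simp add: j_def complex_eq_iff sin_arctan_muH cos_arctan_muH mult.commute)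
  moreover have "Complex (u t * muH a) (a * muH a) = of_real (muH a) * (of_real (u t) + \<i> * of_real a)"
    by (simp add: complex_eq_iff mult.commute)
  ultimately have "chord (tauG (w, a), u t) = - w * of_real ((muH a)\<^sup>2) * (j * (of_real (u t) + \<i> * of_real a))"
    unfolding chord_def tauG_def prod.case fst_conv snd_conv s by (simp add: power2_eq_square)
  also have "of_real (u t) + \<i> * of_real a = (of_real (R * E\<^sup>2) * j - cnj j) / of_real q"
  proof -
    have "(of_real (u t) + \<i> * of_real a) * of_real q = of_real (R * E\<^sup>2) * j - cnj j"
      using q by (simp add: ut j_def complex_eq_iff) (simp add: q_def algebra_simps)
    then show ?thesis using q by (simp add: nonzero_eq_divide_eq)
  qed
  also have "j * ((of_real (R * E\<^sup>2) * j - cnj j) / of_real q) = of_real R * (of_real (E\<^sup>2) * j\<^sup>2 - 1) / of_real q"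
    using jj by (simp add: power2_eq_square algebra_simps)
  also have "- w * of_real ((muH a)\<^sup>2) * (of_real R * (of_real (E\<^sup>2) * j\<^sup>2 - 1) / of_real q) = w * (n * cnj d) / of_real q"
    using R unfolding mu2 ncd by (simp add: algebra_simps)
  finally show "Phi (geodH w a t) = chord (tauG (w, a), tanh (t + ln (sqrt (1 + a\<^sup>2))))"
    unfolding P u_def by simp
qed

lemma cmod_chord_sq:
  assumes "cmod v = 1" "y\<^sup>2 \<le> 1"
  shows "1 - (cmod (chord ((v, y), u)))\<^sup>2 = (1 - y\<^sup>2) * (1 - u\<^sup>2)"
proof -
  have "(cmod (chord ((v, y), u)))\<^sup>2 = (u * sqrt (1 - y\<^sup>2))\<^sup>2 + y\<^sup>2"
    using assms(1) by (simp add: chord_def norm_mult cmod_power2)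
  also have "\<dots> = u\<^sup>2 * (1 - y\<^sup>2) + y\<^sup>2" using assms(2) by (simp add: power_mult_distrib)
  finally show ?thesis by (simp add: algebra_simps)
qed

text \<open>On the geodesic \<open>xH\<close> squared equals
  \<open>(muH a)\<^sup>2 * (1 - (u t)\<^sup>2)\<close>. Raised to the power
  \<open>\<gamma> + 1\<close>, the first factor is \<open>rhoG\<close> and leaves the integral; the
  second is the density that \<open>W_meas_tanh\<close> converts into the weight on the
  chord.\<close>

lemma IH_eq_KE:
  assumes w: "cmod w = 1" and f [measurable]: "f \<in> borel_measurable borel"
  shows "IH \<gamma> f (w, a) = of_real (rhoG \<gamma> (w, a)) * KE \<gamma> (\<lambda>z. f (Psi z)) (tauG (w, a))"
proof -
  define d where "d = ln (sqrt (1 + a\<^sup>2))"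
  define u where "u t = tanh (t + d)" for t
  let ?F = "\<lambda>z. f (Psi z)"
  let ?p = "tauG (w, a)"
  have [measurable]: "(\<lambda>u. ?F (chord (?p, u))) \<in> borel_measurable borel"
    unfolding chord_def fst_conv snd_conv by measurable
  have u1: "1 - (u t)\<^sup>2 > 0" for t
    using tanh_real_lt_1[of "t + d"] tanh_real_gt_neg1[of "t + d"] by (simp add: u_def abs_square_less_1 abs_less_iff)
  have x: "xH (geodH w a t) powr (2 + 2*\<gamma>) = rhoG \<gamma> (w, a) * (1 - (u t)\<^sup>2) powr (\<gamma> + 1)" for t
  proof -
    have "(xH (geodH w a t))\<^sup>2 = 1 - (cmod (chord (?p, u t)))\<^sup>2"
      using one_minus_cmod_Phi_sq[of "geodH w a t"] geodH_Klein(2)[OF w, of a t] by (simp add: u_def d_def)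
    also have "\<dots> = (muH a)\<^sup>2 * (1 - (u t)\<^sup>2)"
      using cmod_chord_sq[of "w * cis (arctan a)" "a * muH a" "u t"] w muH_sq[of a] zero_le_power2[of "muH a"]
      by (simp add: tauG_def norm_mult)
    finally have x2: "(xH (geodH w a t))\<^sup>2 = (muH a)\<^sup>2 * (1 - (u t)\<^sup>2)" .
    have xp: "xH (geodH w a t) > 0" by (rule xH_pos[OF geodH_Klein(1)[OF w]])
    have "xH (geodH w a t) powr (2 + 2*\<gamma>) = ((xH (geodH w a t))\<^sup>2) powr (\<gamma> + 1)"
    proof -
      have "(xH (geodH w a t))\<^sup>2 = xH (geodH w a t) powr 2" using xp by simp
      then show ?thesis by (simp only: powr_powr) (simp add: algebra_simps)
    qed
    also have "\<dots> = ((muH a)\<^sup>2) powr (\<gamma> + 1) * (1 - (u t)\<^sup>2) powr (\<gamma> + 1)"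
      unfolding x2 using u1[of t] by (simp add: powr_mult)
    also have "((muH a)\<^sup>2) powr (\<gamma> + 1) = muH a powr (2*\<gamma>+2)"
    proof -
      have "(muH a)\<^sup>2 = muH a powr 2" using muH_pos[of a, THEN less_imp_le] by simp
      then show ?thesis by (simp only: powr_powr) (simp add: algebra_simps)
    qed
    finally show ?thesis by (simp add: rhoG_def)
  qed
  have F: "f (geodH w a t) = ?F (chord (?p, u t))" for t
    using geodH_Klein(2)[OF w, of a t] Psi_Phi[OF geodH_Klein(1)[OF w, of a t]] by (simp add: u_def d_def)
  have "KE \<gamma> ?F ?p = (LINT t|density lborel (\<lambda>t. ennreal ((1 - (tanh (t + d))\<^sup>2) powr (\<gamma> + 1))). ?F (chord (?p, tanh (t + d))))"
    unfolding KE_def by (subst W_meas_tanh[where d = d], subst integral_distr) auto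
  also have "\<dots> = (LINT t|lborel. (1 - (u t)\<^sup>2) powr (\<gamma> + 1) *\<^sub>R ?F (chord (?p, u t)))"
    unfolding u_def by (subst integral_density) auto
  finally have K: "KE \<gamma> ?F ?p = (LINT t|lborel. (1 - (u t)\<^sup>2) powr (\<gamma> + 1) *\<^sub>R ?F (chord (?p, u t)))" .
  have "IH \<gamma> f (w, a) = (LINT t|lborel. of_real (rhoG \<gamma> (w, a)) * ((1 - (u t)\<^sup>2) powr (\<gamma> + 1) *\<^sub>R ?F (chord (?p, u t))))"
    unfolding IH_def prod.case x F by (simp add: scaleR_conv_of_real mult.assoc)
  then show ?thesis unfolding K by (simp only: integral_mult_right_zero)
qed

lemma measurable_IH [measurable]:
  assumes [measurable]: "f \<in> borel_measurable borel"
  shows "IH \<gamma> f \<in> borel_measurable (borel \<Otimes>\<^sub>M borel)"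
proof -
  have "(\<lambda>p. LINT t|lborel. of_real (xH (geodH (fst p) (snd p) t) powr (2+2*\<gamma>)) * f (geodH (fst p) (snd p) t))
      \<in> borel_measurable (borel \<Otimes>\<^sub>M borel)" by measurable
  then show ?thesis by (simp add: IH_def case_prod_beta')
qed

text \<open>The antipodal chord is the same segment traversed backwards, and the weight is even in
  \<open>u\<close>.\<close>

lemma KE_uminus:
  assumes [measurable]: "F \<in> borel_measurable borel"
  shows "KE \<gamma> F (- p) = KE \<gamma> F p"
proof -
  have [measurable]: "(\<lambda>u. F (chord (- p, u))) \<in> borel_measurable borel"
    unfolding chord_def fst_conv snd_conv by measurable
  have "chord (- p, - u) = chord (p, u)" for u
    by (simp add: chord_def complex_eq_iff)
  then have "KE \<gamma> F p = (LINT u|W_meas \<gamma>. F (chord (- p, - u)))" by (simp add: KE_def)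
  also have "\<dots> = (LINT u|distr (W_meas \<gamma>) (W_meas \<gamma>) uminus. F (chord (- p, u)))"
    by (rule integral_distr[symmetric]) measurable
  also have "\<dots> = KE \<gamma> F (- p)" by (simp only: distr_W_meas_uminus KE_def)
  finally show ?thesis by simp
qed

lemma L2_D_meas_measurable: "f \<in> L2 (D_meas \<gamma>) \<Longrightarrow> f \<in> borel_measurable borel"
  using measurable_cong_sets[OF sets_D_meas refl] by (auto simp: L2_def)

lemma AE_Psi_Phi: "AE z in D_meas \<gamma>. f z = f (Psi (Phi z))"
  using AE_D_meas by eventually_elim (simp add: Psi_Phi)

lemma L2_Psi:
  assumes f: "f \<in> L2 (D_meas \<gamma>)"
  shows "(\<lambda>z. f (Psi z)) \<in> L2 (E_meas \<gamma>)"
proof -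
  have [measurable]: "f \<in> borel_measurable borel" by (rule L2_D_meas_measurable[OF f])
  have "(\<lambda>z. f (Psi (Phi z))) \<in> L2 (D_meas \<gamma>)"
    using f by (subst L2_cong_AE[OF AE_Psi_Phi, symmetric]) measurable
  then show ?thesis using L2_transfer_iff[OF D_E, of "\<lambda>z. f (Psi z)" \<gamma>] by simp
qed

lemma IH_L2plus:
  assumes \<gamma>: "\<gamma> > -1" and f: "f \<in> L2 (D_meas \<gamma>)"
  shows "IH \<gamma> f \<in> L2plus \<gamma>"
    and "AE q in G_meas \<gamma>. IH \<gamma> f q = of_real (rhoG \<gamma> q) * KE \<gamma> (\<lambda>z. f (Psi z)) (tauG q)"
proof -
  have [measurable]: "f \<in> borel_measurable borel" by (rule L2_D_meas_measurable[OF f])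
  let ?F = "\<lambda>z. f (Psi z)"
  have eq: "IH \<gamma> f q = of_real (rhoG \<gamma> q) * KE \<gamma> ?F (tauG q)" if "cmod (fst q) = 1" for q
    using IH_eq_KE[of "fst q" f \<gamma> "snd q"] that by simp
  show ae: "AE q in G_meas \<gamma>. IH \<gamma> f q = of_real (rhoG \<gamma> q) * KE \<gamma> ?F (tauG q)"
    using AE_G_meas by eventually_elim (rule eq)
  have "(\<lambda>q. of_real (rhoG \<gamma> q) * KE \<gamma> ?F (tauG q)) \<in> L2 (G_meas \<gamma>)"
    using KE_L2[OF \<gamma> L2_Psi[OF f]] by (subst L2_transfer_iff[OF G_B]) auto
  then have "IH \<gamma> f \<in> L2 (G_meas \<gamma>)"
    by (subst L2_cong_AE[OF ae]) measurable
  moreover have "AE q in G_meas \<gamma>. IH \<gamma> f (SAH q) = IH \<gamma> f q"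
    using AE_G_meas
  proof eventually_elim
    case (elim q)
    then have "cmod (fst (SAH q)) = 1" by (simp add: SAH_def norm_mult)
    then show ?case using elim by (simp add: eq rhoG_SAH tauG_SAH KE_uminus)
  qed
  ultimately show "IH \<gamma> f \<in> L2plus \<gamma>" by (simp add: L2plus_def)
qed

text \<open>Stated on the closed disk because \<open>Phi\<close> maps the whole plane there, as the
  measurability of \<open>PhiZ\<close> requires. The two opposite powers stay uncancelled: their
  product is 1 only where the square root is nonzero.\<close>

lemma ZE_integrand:
  assumes "cmod z \<le> 1"
  shows "of_real (muE (beta_in z \<theta>, alpha_in z \<theta>) powr (-2*\<gamma>-1)) * psiE \<gamma> n k (beta_in z \<theta>, alpha_in z \<theta>)
    = of_real (sqrt (1 - (Im (z * cis (- \<theta>)))\<^sup>2) powr (-2*\<gamma>-1)) *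
      (of_real (sqrt (1 - (Im (z * cis (- \<theta>)))\<^sup>2) powr (2*\<gamma>+1)) * cis (of_int (int n - 2*k) * (\<theta> - pi/2))
        * of_real (pJ \<gamma> n (Im (z * cis (- \<theta>)))))"
proof -
  have "\<bar>Im (z * cis (- \<theta>))\<bar> \<le> 1"
    using abs_Im_le_cmod[of "z * cis (- \<theta>)"] assms by (simp add: norm_mult)
  then have y: "-1 \<le> Im (z * cis (- \<theta>))" "Im (z * cis (- \<theta>)) \<le> 1" by linarith+
  have "beta_in z \<theta> + alpha_in z \<theta> + pi/2 = \<theta> - pi/2" by (simp add: beta_in_def)
  moreover have "sin (alpha_in z \<theta>) = Im (z * cis (- \<theta>))"
    unfolding alpha_in_def by (rule sin_arcsin[OF y])
  moreover have "cos (alpha_in z \<theta>) = sqrt (1 - (Im (z * cis (- \<theta>)))\<^sup>2)"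
    unfolding alpha_in_def by (rule cos_arcsin[OF y])
  ultimately show ?thesis
    unfolding muE_def psiE_def fst_conv snd_conv by (simp only:)
qed

lemma measurable_PhiZ [measurable]: "PhiZ \<gamma> n k \<in> borel_measurable borel"
proof -
  have "(\<lambda>z. LINT \<theta>|lborel. indicator {0..2*pi} \<theta> *\<^sub>R
      (of_real (sqrt (1 - (Im (Phi z * cis (- \<theta>)))\<^sup>2) powr (-2*\<gamma>-1)) *
      (of_real (sqrt (1 - (Im (Phi z * cis (- \<theta>)))\<^sup>2) powr (2*\<gamma>+1)) * cis (of_int (int n - 2*k) * (\<theta> - pi/2))
        * of_real (pJ \<gamma> n (Im (Phi z * cis (- \<theta>))))))) \<in> borel_measurable borel"
    by measurable
  then show ?thesis
    unfolding PhiZ_def[abs_def] ZE_def backprojE_def set_lebesgue_integral_def ZE_integrand[OF cmod_Phi_le] .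
qed

lemma integral_C_meas:
  fixes h :: "complex \<Rightarrow> complex"
  assumes [measurable]: "h \<in> borel_measurable borel"
  shows "(LINT v|C_meas. h v) = (LINT \<theta>:{0..2*pi}|lborel. h (cis \<theta>))"
  unfolding C_meas_def set_lebesgue_integral_def
  by (subst integral_distr) (auto simp: integral_density)

text \<open>The backprojection runs over directions \<open>cis \<theta>\<close>, whereas
  \<open>v\<close> is minus the direction; the rotation by \<open>-1\<close> matches them, and
  \<open>\<i> * - cis \<theta>\<close> equals \<open>cis (\<theta> - pi/2)\<close>. In the open disk
  the two powers of the cosine cancel.\<close>

lemma ZE_eq_Zm:
  assumes z: "cmod z < 1"
  shows "ZE \<gamma> n k z = Zm \<gamma> (int n - 2 * k, n) z"
proof -
  have [measurable]: "(\<lambda>v. eB \<gamma> (int n - 2 * k, n) (v, Im (- cnj v * z))) \<in> borel_measurable borel"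
    by measurable
  have "Zm \<gamma> (int n - 2 * k, n) z = (LINT v|distr C_meas C_meas (\<lambda>w. (-1) * w). eB \<gamma> (int n - 2 * k, n) (v, Im (- cnj v * z)))"
    unfolding Zm_def by (subst distr_C_meas_mult) auto
  also have "\<dots> = (LINT v|C_meas. eB \<gamma> (int n - 2 * k, n) (- v, Im (cnj v * z)))"
    by (subst integral_distr) auto
  also have "\<dots> = (LINT \<theta>:{0..2*pi}|lborel. eB \<gamma> (int n - 2 * k, n) (- cis \<theta>, Im (cnj (cis \<theta>) * z)))"
    by (rule integral_C_meas) measurable
  also have "\<dots> = ZE \<gamma> n k z"
    unfolding ZE_def backprojE_def ZE_integrand[OF less_imp_le[OF z]]
  proof (intro arg_cong[where f = "set_lebesgue_integral lborel {0..2*pi}"] ext)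
    fix \<theta> :: real
    let ?y = "Im (z * cis (- \<theta>))"
    have "\<bar>?y\<bar> < 1"
      using abs_Im_le_cmod[of "z * cis (- \<theta>)"] z by (simp add: norm_mult)
    then have s: "sqrt (1 - ?y\<^sup>2) > 0" by (simp add: abs_square_less_1)
    have "sqrt (1 - ?y\<^sup>2) powr (-2*\<gamma>-1) * sqrt (1 - ?y\<^sup>2) powr (2*\<gamma>+1) = 1"
      using s by (simp only: powr_add[symmetric]) simp
    then have one: "complex_of_real (sqrt (1 - ?y\<^sup>2) powr (-2*\<gamma>-1)) * of_real (sqrt (1 - ?y\<^sup>2) powr (2*\<gamma>+1)) = 1"
      by (simp only: of_real_mult[symmetric] of_real_1)
    have "\<i> * - cis \<theta> = cis (\<theta> - pi/2)" by (simp add: complex_eq_iff cos_diff sin_diff)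
    then have "(\<i> * - cis \<theta>) powi (int n - 2 * k) = cis (of_int (int n - 2*k) * (\<theta> - pi/2))"
      by (simp only: cis_power_int)
    moreover have "Im (cnj (cis \<theta>) * z) = ?y" by (simp add: cis_cnj mult.commute)
    ultimately have "eB \<gamma> (int n - 2 * k, n) (- cis \<theta>, Im (cnj (cis \<theta>) * z))
      = cis (of_int (int n - 2*k) * (\<theta> - pi/2)) * of_real (pJ \<gamma> n ?y)"
      unfolding eB_def fst_conv snd_conv by (simp only:)
    also have "\<dots> = (complex_of_real (sqrt (1 - ?y\<^sup>2) powr (-2*\<gamma>-1)) * of_real (sqrt (1 - ?y\<^sup>2) powr (2*\<gamma>+1))) *
       (cis (of_int (int n - 2*k) * (\<theta> - pi/2)) * of_real (pJ \<gamma> n ?y))"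
      unfolding one by simp
    finally show "eB \<gamma> (int n - 2 * k, n) (- cis \<theta>, Im (cnj (cis \<theta>) * z)) =
      of_real (sqrt (1 - ?y\<^sup>2) powr (-2*\<gamma>-1)) * (of_real (sqrt (1 - ?y\<^sup>2) powr (2*\<gamma>+1)) * cis (of_int (int n - 2*k) * (\<theta> - pi/2)) * of_real (pJ \<gamma> n ?y))"
      by (simp only: mult.assoc)
  qed
  finally show ?thesis by simp
qed

lemma AE_PhiZ: "AE z in D_meas \<gamma>. PhiZ \<gamma> n k z = Zm \<gamma> (int n - 2 * k, n) (Phi z)"
  using AE_D_meas by eventually_elim (simp add: PhiZ_def ZE_eq_Zm cmod_Phi_less)

lemma D_meas_borel: "g \<in> borel_measurable (D_meas \<gamma>) \<longleftrightarrow> g \<in> borel_measurable borel"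
  using measurable_cong_sets[OF sets_D_meas refl] by blast

lemma inner_D_transfer:
  assumes "g \<in> borel_measurable borel" "g' \<in> borel_measurable borel"
    and [measurable]: "F \<in> borel_measurable borel" "F' \<in> borel_measurable borel"
    and "AE z in D_meas \<gamma>. g z = F (Phi z)" "AE z in D_meas \<gamma>. g' z = F' (Phi z)"
  shows "L2inner (D_meas \<gamma>) g g' = L2inner (E_meas \<gamma>) F F'"
proof -
  have "L2inner (D_meas \<gamma>) g g' = L2inner (D_meas \<gamma>) (\<lambda>z. F (Phi z)) (\<lambda>z. F' (Phi z))"
    by (rule L2inner_cong_AE[OF assms(5,6)]) (auto simp: D_meas_borel assms)
  also have "\<dots> = L2inner (E_meas \<gamma>) F F'"
    using L2inner_transfer[OF D_E, where F = F and G = F'] by simp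
  finally show ?thesis .
qed

text \<open>The adjoint identity on the hyperbolic side, obtained by conjugating
  \<open>KE_inner\<close> with the two isometries. It holds for every integer \<open>k\<close>;
  outside \<open>0 \<le> k \<le> n\<close> the right side vanishes.\<close>

lemma IH_inner_psiH:
  assumes \<gamma>: "\<gamma> > -1" and f: "f \<in> L2 (D_meas \<gamma>)"
  shows "L2inner (G_meas \<gamma>) (IH \<gamma> f) (psiH \<gamma> n k) = L2inner (D_meas \<gamma>) f (PhiZ \<gamma> n k)"
proof -
  have [measurable]: "f \<in> borel_measurable borel" by (rule L2_D_meas_measurable[OF f])
  have "L2inner (G_meas \<gamma>) (IH \<gamma> f) (psiH \<gamma> n k) = L2inner (B_meas \<gamma>) (KE \<gamma> (\<lambda>z. f (Psi z))) (eB \<gamma> (int n - 2 * k, n))"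
    by (rule inner_G_transfer[OF _ _ _ _ IH_L2plus(2)[OF \<gamma> f] AE_psiH]) measurable
  also have "\<dots> = L2inner (E_meas \<gamma>) (\<lambda>z. f (Psi z)) (Zm \<gamma> (int n - 2 * k, n))"
    by (rule KE_inner[OF \<gamma> L2_Psi[OF f]])
  also have "\<dots> = L2inner (D_meas \<gamma>) f (PhiZ \<gamma> n k)"
    by (rule inner_D_transfer[OF _ _ _ _ AE_Psi_Phi AE_PhiZ, symmetric]) measurable
  finally show ?thesis .
qed

section \<open>Singular value decomposition\<close>

abbreviation psis :: "real \<Rightarrow> nat \<times> int \<Rightarrow> complex \<times> real \<Rightarrow> complex" where
  "psis \<gamma> \<equiv> \<lambda>(n, k). psiH \<gamma> n k"

definition good :: "(nat \<times> int) set" where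
  "good = {(n, k). 0 \<le> k \<and> k \<le> int n}"

lemma PhiZ_L2:
  assumes \<gamma>: "\<gamma> > -1" and k: "0 \<le> k" "k \<le> int n"
  shows "PhiZ \<gamma> n k \<in> L2 (D_meas \<gamma>)"
proof -
  have "Zm \<gamma> (int n - 2 * k, n) \<in> L2 (E_meas \<gamma>)"
    using Zm_L2[OF \<gamma>, of "nat k" n] k by (simp add: nat_le_iff)
  then have "(\<lambda>z. Zm \<gamma> (int n - 2 * k, n) (Phi z)) \<in> L2 (D_meas \<gamma>)"
    using L2_transfer_iff[OF D_E, where F = "Zm \<gamma> (int n - 2 * k, n)"] by simp
  then show ?thesis by (subst L2_cong_AE[OF AE_PhiZ]) measurable
qed

lemma PhiZ_inner:
  assumes \<gamma>: "\<gamma> > -1" and k: "0 \<le> k" "k \<le> int n" and k': "0 \<le> k'" "k' \<le> int n'"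
  shows "L2inner (D_meas \<gamma>) (PhiZ \<gamma> n k) (PhiZ \<gamma> n' k') = (if (n, k) = (n', k') then of_real (sigma_sq \<gamma> n k) else 0)"
proof -
  have "L2inner (D_meas \<gamma>) (PhiZ \<gamma> n k) (PhiZ \<gamma> n' k') = L2inner (E_meas \<gamma>) (Zm \<gamma> (int n - 2 * k, n)) (Zm \<gamma> (int n' - 2 * k', n'))"
    by (rule inner_D_transfer[OF _ _ _ _ AE_PhiZ AE_PhiZ]) measurable
  then show ?thesis
    using Zm_inner[OF \<gamma>, of "nat k" n "nat k'" n'] k k' by (auto simp: nat_le_iff)
qed

lemma PhiZ_inner_bad:
  assumes f: "f \<in> L2 (D_meas \<gamma>)" and k: "k < 0 \<or> k > int n"
  shows "L2inner (D_meas \<gamma>) f (PhiZ \<gamma> n k) = 0"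
proof -
  have "AE z in D_meas \<gamma>. PhiZ \<gamma> n k z = 0"
    using AE_PhiZ[of \<gamma> n k] by eventually_elim (simp add: Zm_eq_0[OF k])
  then have "L2inner (D_meas \<gamma>) f (PhiZ \<gamma> n k) = L2inner (D_meas \<gamma>) f (\<lambda>_. 0)"
    using L2_measurable[OF f] by (intro L2inner_cong_AE) auto
  then show ?thesis by simp
qed

context
  fixes \<gamma> :: real
  assumes \<gamma>: "\<gamma> > -1"
begin

lemma sigma_sq_pos': "0 \<le> k \<Longrightarrow> k \<le> int n \<Longrightarrow> sigma_sq \<gamma> n k > 0"
  using sigma_sq_pos[OF \<gamma>, of "nat k" n] by (simp add: nat_le_iff)

text \<open>This is the singular value: \<open>PhiZ\<close> is the image under the adjoint of the
  unit vector \<open>psiH\<close>.\<close>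

lemma L2norm_PhiZ:
  assumes k: "0 \<le> k" "k \<le> int n"
  shows "L2norm (D_meas \<gamma>) (PhiZ \<gamma> n k) = sqrt (sigma_sq \<gamma> n k)"
proof -
  have "complex_of_real ((L2norm (D_meas \<gamma>) (PhiZ \<gamma> n k))\<^sup>2) = of_real (sigma_sq \<gamma> n k)"
    using PhiZ_inner[OF \<gamma> k k] unfolding L2inner_self by (simp del: of_real_power)
  then have "(L2norm (D_meas \<gamma>) (PhiZ \<gamma> n k))\<^sup>2 = sigma_sq \<gamma> n k" by (simp only: of_real_eq_iff)
  then show ?thesis by (metis L2norm_nonneg real_sqrt_unique)
qed

lemma uhat_eq:
  assumes k: "0 \<le> k" "k \<le> int n"
  shows "uhat \<gamma> n k = (\<lambda>z. inverse (of_real (sqrt (sigma_sq \<gamma> n k))) * PhiZ \<gamma> n k z)"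
  unfolding uhat_def[abs_def] L2norm_PhiZ[OF k] by (simp add: divide_inverse mult.commute)

lemma PhiZ_eq_uhat:
  assumes k: "0 \<le> k" "k \<le> int n"
  shows "PhiZ \<gamma> n k = (\<lambda>z. of_real (sqrt (sigma_sq \<gamma> n k)) * uhat \<gamma> n k z)"
  unfolding uhat_eq[OF k] using sigma_sq_pos'[OF k] by (simp add: mult.assoc[symmetric])

lemma uhat_L2:
  assumes k: "0 \<le> k" "k \<le> int n"
  shows "uhat \<gamma> n k \<in> L2 (D_meas \<gamma>)"
  unfolding uhat_eq[OF k] by (rule L2_scale[OF PhiZ_L2[OF \<gamma> k]])

lemma uhat_inner_PhiZ:
  assumes k: "0 \<le> k" "k \<le> int n" and k': "0 \<le> k'" "k' \<le> int n'"
  shows "L2inner (D_meas \<gamma>) (uhat \<gamma> n k) (PhiZ \<gamma> n' k') = (if (n, k) = (n', k') then of_real (sqrt (sigma_sq \<gamma> n k)) else 0)"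
proof -
  have "inverse (complex_of_real (sqrt s)) * of_real s = of_real (sqrt s)" if "s > 0" for s
    using that by (simp add: divide_inverse[symmetric] mult.commute real_div_sqrt flip: of_real_divide)
  from this[OF sigma_sq_pos'[OF k]] show ?thesis
    unfolding uhat_eq[OF k] L2inner_scale_left PhiZ_inner[OF \<gamma> k k']
    by (cases "(n, k) = (n', k')") auto
qed

lemma uhat_orthonormal:
  assumes k: "0 \<le> k" "k \<le> int n" and k': "0 \<le> k'" "k' \<le> int n'"
  shows "L2inner (D_meas \<gamma>) (uhat \<gamma> n k) (uhat \<gamma> n' k') = (if (n, k) = (n', k') then 1 else 0)"
  unfolding uhat_eq[OF k'] L2inner_scale_right uhat_inner_PhiZ[OF k k']
  using sigma_sq_pos'[OF k] by auto

text \<open>Density of the \<open>Zm\<close> in the Klein model, carried back by \<open>Phi\<close>: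
  a function on the hyperbolic disk is first composed with \<open>Psi\<close>, and the norms of the
  errors agree.\<close>

lemma uhat_dense:
  "cl_span (D_meas \<gamma>) (L2 (D_meas \<gamma>)) {uhat \<gamma> n k | n k. 0 \<le> k \<and> k \<le> int n} = L2 (D_meas \<gamma>)"
proof -
  let ?I = "{(n :: nat, k :: nat). k \<le> n}"
  let ?u = "\<lambda>(n, k). uhat \<gamma> n (int k)" and ?Z = "\<lambda>(n, k). Zm \<gamma> (int n - 2 * int k, n)"
  have S: "{uhat \<gamma> n k | n k. 0 \<le> k \<and> k \<le> int n} = ?u ` ?I"
  proof (intro equalityI subsetI)
    fix f assume "f \<in> {uhat \<gamma> n k | n k. 0 \<le> k \<and> k \<le> int n}"
    then obtain n k where "f = uhat \<gamma> n k" "0 \<le> k" "k \<le> int n" by auto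
    then show "f \<in> ?u ` ?I" by (intro image_eqI[of _ _ "(n, nat k)"]) (auto simp: nat_le_iff)
  next
    fix f assume "f \<in> ?u ` ?I"
    then obtain n k where "f = uhat \<gamma> n (int k)" "k \<le> n" by auto
    then show "f \<in> {uhat \<gamma> n k | n k. 0 \<le> k \<and> k \<le> int n}"
      by (intro CollectI exI[of _ n] exI[of _ "int k"]) auto
  qed
  have ap: "approximable (D_meas \<gamma>) ?u ?I f" if f: "f \<in> L2 (D_meas \<gamma>)" for f
    unfolding approximable_def
  proof (intro allI impI)
    fix \<epsilon> :: real assume \<epsilon>: "\<epsilon> > 0"
    have [measurable]: "f \<in> borel_measurable borel" by (rule L2_D_meas_measurable[OF f])
    have "(\<lambda>z. f (Psi z)) \<in> cl_span (E_meas \<gamma>) (L2 (E_meas \<gamma>)) (?Z ` ?I)"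
      unfolding Zm_dense[OF \<gamma>] by (rule L2_Psi[OF f])
    then have "approximable (E_meas \<gamma>) ?Z ?I (\<lambda>z. f (Psi z))"
      by (simp only: cl_span_image mem_Collect_eq)
    from approximableE[OF this \<epsilon>] obtain F c where F: "finite F" "F \<subseteq> ?I"
      and less: "L2norm (E_meas \<gamma>) (\<lambda>x. f (Psi x) - (\<Sum>i\<in>F. c i * ?Z i x)) < \<epsilon>" .
    \<comment> \<open>The factor undoes the normalization, since \<open>PhiZ\<close> is
      \<open>sqrt (sigma_sq \<gamma> n k)\<close> times \<open>uhat\<close>.\<close>
    let ?d = "\<lambda>(n, k). c (n, k) * of_real (sqrt (sigma_sq \<gamma> n (int k)))"
    have "AE z in D_meas \<gamma>. \<forall>i\<in>F. PhiZ \<gamma> (fst i) (int (snd i)) z = ?Z i (Phi z)"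
      using F(1) by (intro AE_finite_allI) (auto simp: case_prod_beta intro: AE_PhiZ)
    then have ae: "AE z in D_meas \<gamma>. f z - (\<Sum>i\<in>F. ?d i * ?u i z) = f (Psi (Phi z)) - (\<Sum>i\<in>F. c i * ?Z i (Phi z))"
      using AE_Psi_Phi[where \<gamma> = \<gamma> and f = f]
    proof eventually_elim
      case (elim z)
      have "(\<Sum>i\<in>F. ?d i * ?u i z) = (\<Sum>i\<in>F. c i * ?Z i (Phi z))"
      proof (intro sum.cong refl)
        fix i assume i: "i \<in> F"
        obtain n k where nk: "i = (n, k)" by (cases i)
        have "k \<le> n" using F(2) i by (auto simp: nk)
        then have "PhiZ \<gamma> n (int k) z = of_real (sqrt (sigma_sq \<gamma> n (int k))) * uhat \<gamma> n (int k) z"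
          by (subst PhiZ_eq_uhat) auto
        moreover have "PhiZ \<gamma> n (int k) z = ?Z i (Phi z)" using elim(1) i by (auto simp: nk)
        ultimately show "?d i * ?u i z = c i * ?Z i (Phi z)" by (simp add: nk mult.assoc)
      qed
      then show ?case using elim(2) by simp
    qed
    have u: "(\<lambda>z. \<Sum>i\<in>F. ?d i * ?u i z) \<in> L2 (D_meas \<gamma>)"
      using F(2) by (intro L2_lincomb) (auto intro!: uhat_L2)
    have "L2norm (D_meas \<gamma>) (\<lambda>z. f z - (\<Sum>i\<in>F. ?d i * ?u i z))
       = L2norm (D_meas \<gamma>) (\<lambda>z. f (Psi (Phi z)) - (\<Sum>i\<in>F. c i * ?Z i (Phi z)))"
      by (rule L2norm_cong_AE[OF ae L2_measurable[OF L2_diff[OF f u]]]) (auto simp: case_prod_beta)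
    also have "\<dots> = L2norm (E_meas \<gamma>) (\<lambda>x. f (Psi x) - (\<Sum>i\<in>F. c i * ?Z i x))"
    proof -
      have "(\<lambda>x. f (Psi x) - (\<Sum>i\<in>F. c i * ?Z i x)) \<in> borel_measurable (E_meas \<gamma>)"
        unfolding case_prod_beta by measurable
      from L2norm_transfer[OF D_E this] show ?thesis by simp
    qed
    finally have "L2norm (D_meas \<gamma>) (\<lambda>z. f z - (\<Sum>i\<in>F. ?d i * ?u i z)) < \<epsilon>" using less by simp
    with F show "\<exists>F c. finite F \<and> F \<subseteq> ?I \<and> L2norm (D_meas \<gamma>) (\<lambda>z. f z - (\<Sum>i\<in>F. c i * ?u i z)) < \<epsilon>"
      by (intro exI[of _ F] exI[of _ ?d] conjI)
  qed
  show ?thesis unfolding S cl_span_image using ap by (intro equalityI subsetI) simp_all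
qed

lemma L2plus_L2: "g \<in> L2plus \<gamma> \<Longrightarrow> g \<in> L2 (G_meas \<gamma>)"
  by (simp add: L2plus_def)

lemma L2plus_diff:
  assumes "f \<in> L2plus \<gamma>" "g \<in> L2plus \<gamma>"
  shows "(\<lambda>q. f q - c * g q) \<in> L2plus \<gamma>"
proof -
  have "(\<lambda>q. f q - c * g q) \<in> L2 (G_meas \<gamma>)"
    using assms by (intro L2_diff L2_scale) (auto simp: L2plus_def)
  moreover have "AE q in G_meas \<gamma>. f (SAH q) = f q" "AE q in G_meas \<gamma>. g (SAH q) = g q"
    using assms by (simp_all add: L2plus_def)
  then have "AE q in G_meas \<gamma>. f (SAH q) - c * g (SAH q) = f q - c * g q"
    by eventually_elim simp
  ultimately show ?thesis by (simp add: L2plus_def)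
qed

lemma psis_L2: "psis \<gamma> i \<in> L2 (G_meas \<gamma>)"
  using psiH_L2plus[OF \<gamma>] by (cases i) (simp add: L2plus_def)

lemma psis_orthonormal: "L2inner (G_meas \<gamma>) (psis \<gamma> i) (psis \<gamma> j) = (if i = j then 1 else 0)"
  using psiH_orthonormal[OF \<gamma>] by (cases i, cases j) simp

text \<open>The difference is an invariant function whose coefficients against all
  \<open>psiH\<close> vanish by the adjoint identity and orthogonality of the \<open>PhiZ\<close>;
  completeness makes it zero almost everywhere.\<close>

lemma IH_uhat:
  assumes k: "0 \<le> k" "k \<le> int n"
  shows "AE q in G_meas \<gamma>. IH \<gamma> (uhat \<gamma> n k) q - of_real (sqrt (sigma_sq \<gamma> n k)) * psiH \<gamma> n k q = 0"
    and "(\<lambda>q. IH \<gamma> (uhat \<gamma> n k) q - of_real (sqrt (sigma_sq \<gamma> n k)) * psiH \<gamma> n k q) \<in> L2plus \<gamma>"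
proof -
  let ?s = "complex_of_real (sqrt (sigma_sq \<gamma> n k))"
  let ?d = "\<lambda>q. IH \<gamma> (uhat \<gamma> n k) q - ?s * psiH \<gamma> n k q"
  have u: "uhat \<gamma> n k \<in> L2 (D_meas \<gamma>)" by (rule uhat_L2[OF k])
  have I: "IH \<gamma> (uhat \<gamma> n k) \<in> L2plus \<gamma>" by (rule IH_L2plus(1)[OF \<gamma> u])
  show d: "?d \<in> L2plus \<gamma>" by (rule L2plus_diff[OF I psiH_L2plus[OF \<gamma>]])
  have "L2inner (G_meas \<gamma>) ?d (psis \<gamma> i) = 0" for i
  proof -
    obtain n' k' where i: "i = (n', k')" by (cases i)
    have "L2inner (G_meas \<gamma>) (IH \<gamma> (uhat \<gamma> n k)) (psiH \<gamma> n' k') = (if (n, k) = (n', k') then ?s else 0)"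
    proof (cases "0 \<le> k' \<and> k' \<le> int n'")
      case True
      then show ?thesis unfolding IH_inner_psiH[OF \<gamma> u] by (intro uhat_inner_PhiZ k) auto
    next
      case False
      then show ?thesis unfolding IH_inner_psiH[OF \<gamma> u] using k by (subst PhiZ_inner_bad[OF u]) auto
    qed
    moreover have "L2inner (G_meas \<gamma>) ?d (psiH \<gamma> n' k')
        = L2inner (G_meas \<gamma>) (IH \<gamma> (uhat \<gamma> n k)) (psiH \<gamma> n' k') - ?s * L2inner (G_meas \<gamma>) (psiH \<gamma> n k) (psiH \<gamma> n' k')"
      unfolding L2inner_scale_left[symmetric]
      by (intro L2inner_diff_left L2_scale L2plus_L2 I psiH_L2plus \<gamma>)
    ultimately show ?thesis by (simp add: i psiH_orthonormal[OF \<gamma>])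
  qed
  then show "AE q in G_meas \<gamma>. ?d q = 0"
    using approximable_AE_zero[OF _ L2plus_L2[OF d] psiH_approximable[OF \<gamma> d]] psis_L2 by blast
qed

text \<open>Up to null sets \<open>psiH\<close> is a nonzero multiple of the transform of
  \<open>uhat\<close>, and a kernel element is orthogonal to the range of the transform.\<close>

lemma kerAdjH_inner_psiH:
  assumes g: "g \<in> kerAdjH \<gamma>" and k: "0 \<le> k" "k \<le> int n"
  shows "L2inner (G_meas \<gamma>) (psiH \<gamma> n k) g = 0"
proof -
  let ?s = "complex_of_real (sqrt (sigma_sq \<gamma> n k))"
  have gL: "g \<in> L2 (G_meas \<gamma>)" using g by (simp add: kerAdjH_def L2plus_def)
  have u: "uhat \<gamma> n k \<in> L2 (D_meas \<gamma>)" by (rule uhat_L2[OF k])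
  have "0 = L2inner (G_meas \<gamma>) (IH \<gamma> (uhat \<gamma> n k)) g"
    using g u by (simp add: kerAdjH_def adjH_def)
  also have "\<dots> = L2inner (G_meas \<gamma>) (\<lambda>q. ?s * psiH \<gamma> n k q) g"
  proof (rule L2inner_cong_AE)
    show "AE q in G_meas \<gamma>. IH \<gamma> (uhat \<gamma> n k) q = ?s * psiH \<gamma> n k q"
      using IH_uhat(1)[OF k] by eventually_elim simp
    show "IH \<gamma> (uhat \<gamma> n k) \<in> borel_measurable (G_meas \<gamma>)"
      by (rule L2_measurable[OF L2plus_L2[OF IH_L2plus(1)[OF \<gamma> u]]])
    show "(\<lambda>q. ?s * psiH \<gamma> n k q) \<in> borel_measurable (G_meas \<gamma>)"
      by (rule L2_measurable[OF L2_scale[OF L2plus_L2[OF psiH_L2plus[OF \<gamma>]]]])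
  qed (use L2_measurable[OF gL] in auto)
  also have "\<dots> = ?s * L2inner (G_meas \<gamma>) (psiH \<gamma> n k) g" by (rule L2inner_scale_left)
  finally show ?thesis using sigma_sq_pos'[OF k] by simp
qed

text \<open>A kernel element is orthogonal to the \<open>psiH\<close> with
  \<open>0 \<le> k \<le> n\<close>, so these drop out of its approximants. Conversely the other
  \<open>psiH\<close> have vanishing backprojection, hence are orthogonal to the range, and this
  passes to limits.\<close>

lemma kerAdjH_eq:
  "kerAdjH \<gamma> = cl_span (G_meas \<gamma>) (L2plus \<gamma>) {psiH \<gamma> n k | n k. k < 0 \<or> k > int n}"
proof -
  have S: "{psiH \<gamma> n k | n k. k < 0 \<or> k > int n} = psis \<gamma> ` (UNIV - good)"
  proof (intro equalityI subsetI)
    fix f assume "f \<in> {psiH \<gamma> n k | n k. k < 0 \<or> k > int n}"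
    then obtain n k where "f = psiH \<gamma> n k" "k < 0 \<or> k > int n" by auto
    then show "f \<in> psis \<gamma> ` (UNIV - good)"
      by (intro image_eqI[of _ _ "(n, k)"]) (auto simp: good_def)
  next
    fix f assume "f \<in> psis \<gamma> ` (UNIV - good)"
    then obtain n k where "f = psiH \<gamma> n k" "(n, k) \<notin> good" by auto
    then show "f \<in> {psiH \<gamma> n k | n k. k < 0 \<or> k > int n}"
      by (intro CollectI exI[of _ n] exI[of _ k]) (auto simp: good_def)
  qed
  have iff: "g \<in> kerAdjH \<gamma> \<longleftrightarrow> approximable (G_meas \<gamma>) (psis \<gamma>) (UNIV - good) g" if g: "g \<in> L2plus \<gamma>" for g
  proof
    assume ker: "g \<in> kerAdjH \<gamma>"
    show "approximable (G_meas \<gamma>) (psis \<gamma>) (UNIV - good) g"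
    proof (rule approximable_orthogonal_part)
      show "approximable (G_meas \<gamma>) (psis \<gamma>) UNIV g" by (rule psiH_approximable[OF \<gamma> g])
      show "L2inner (G_meas \<gamma>) g (psis \<gamma> i) = 0" if "i \<in> good" for i
      proof -
        have "L2inner (G_meas \<gamma>) (psis \<gamma> i) g = 0"
          using that kerAdjH_inner_psiH[OF ker] by (auto simp: good_def)
        then show ?thesis using L2inner_cnj[of "G_meas \<gamma>" "psis \<gamma> i" g] by simp
      qed
    qed (use g in \<open>simp_all add: psis_L2 psis_orthonormal L2plus_L2\<close>)
  next
    assume ap: "approximable (G_meas \<gamma>) (psis \<gamma>) (UNIV - good) g"
    have "L2inner (G_meas \<gamma>) (IH \<gamma> f) g = 0" if f: "f \<in> L2 (D_meas \<gamma>)" for f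
    proof (rule approximable_inner_zero[OF _ L2plus_L2[OF g] L2plus_L2[OF IH_L2plus(1)[OF \<gamma> f]] ap])
      fix i assume "i \<in> UNIV - good"
      moreover obtain n k where i: "i = (n, k)" by (cases i)
      ultimately have "k < 0 \<or> k > int n" by (auto simp: good_def)
      then show "L2inner (G_meas \<gamma>) (IH \<gamma> f) (psis \<gamma> i) = 0"
        by (simp add: i IH_inner_psiH[OF \<gamma> f] PhiZ_inner_bad[OF f])
    qed (rule psis_L2)
    then show "g \<in> kerAdjH \<gamma>" using g by (simp add: kerAdjH_def adjH_def)
  qed
  have "kerAdjH \<gamma> \<subseteq> L2plus \<gamma>" by (auto simp: kerAdjH_def)
  then show ?thesis unfolding S cl_span_image using iff by (intro equalityI subsetI) auto
qed

text \<open>By \<open>kerAdjH_eq\<close> the remaining \<open>psiH\<close> belong to the kernel, so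
  the set contains the whole complete family.\<close>

lemma psiH_kerAdjH_dense:
  "cl_span (G_meas \<gamma>) (L2plus \<gamma>) ({psiH \<gamma> n k | n k. 0 \<le> k \<and> k \<le> int n} \<union> kerAdjH \<gamma>) = L2plus \<gamma>"
proof (intro equalityI subsetI)
  let ?S = "{psiH \<gamma> n k | n k. 0 \<le> k \<and> k \<le> int n} \<union> kerAdjH \<gamma>"
  fix g assume g: "g \<in> L2plus \<gamma>"
  have "psiH \<gamma> n k \<in> ?S" for n k
  proof (cases "0 \<le> k \<and> k \<le> int n")
    case False
    then have "psiH \<gamma> n k \<in> lin_combs {psiH \<gamma> n k | n k. k < 0 \<or> k > int n}"
      by (intro lin_combs_base CollectI exI[of _ n] exI[of _ k]) auto
    then have "psiH \<gamma> n k \<in> kerAdjH \<gamma>"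
      unfolding kerAdjH_eq cl_span_def using psiH_L2plus[OF \<gamma>, of n k]
      by (auto intro!: bexI[of _ "psiH \<gamma> n k"])
    then show ?thesis by simp
  qed auto
  then have "psis \<gamma> ` UNIV \<subseteq> ?S" by auto
  then have "lin_combs (psis \<gamma> ` UNIV) \<subseteq> lin_combs ?S" by (rule lin_combs_mono)
  moreover have "g \<in> cl_span (G_meas \<gamma>) (L2plus \<gamma>) (psis \<gamma> ` UNIV)"
    unfolding cl_span_image using g psiH_approximable[OF \<gamma> g] by simp
  ultimately show "g \<in> cl_span (G_meas \<gamma>) (L2plus \<gamma>) ?S"
    unfolding cl_span_def by blast
qed (simp add: cl_span_def)

text \<open>The difference vanishes almost everywhere and is therefore in the kernel; the adjoint
  relation is \<open>IH_inner_psiH\<close> with \<open>PhiZ\<close> written as a multiple of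
  \<open>uhat\<close>.\<close>

lemma singular_values:
  assumes k: "0 \<le> k" "k \<le> int n"
  shows "\<exists>\<sigma>::real. \<sigma> > 0 \<and> \<sigma>\<^sup>2 = sigma_sq \<gamma> n k
     \<and> (\<lambda>q. IH \<gamma> (uhat \<gamma> n k) q - of_real \<sigma> * psiH \<gamma> n k q) \<in> kerAdjH \<gamma>
     \<and> adjH \<gamma> (psiH \<gamma> n k) (\<lambda>z. of_real \<sigma> * uhat \<gamma> n k z)"
proof (intro exI[of _ "sqrt (sigma_sq \<gamma> n k)"] conjI)
  let ?s = "sqrt (sigma_sq \<gamma> n k)"
  let ?d = "\<lambda>q. IH \<gamma> (uhat \<gamma> n k) q - of_real ?s * psiH \<gamma> n k q"
  show "?s > 0" "?s\<^sup>2 = sigma_sq \<gamma> n k" using sigma_sq_pos'[OF k] by simp_all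
  have dL: "?d \<in> L2 (G_meas \<gamma>)" by (rule L2plus_L2[OF IH_uhat(2)[OF k]])
  have "L2inner (G_meas \<gamma>) (IH \<gamma> f) ?d = 0" if f: "f \<in> L2 (D_meas \<gamma>)" for f
  proof -
    have "L2inner (G_meas \<gamma>) (IH \<gamma> f) ?d = L2inner (G_meas \<gamma>) (IH \<gamma> f) (\<lambda>_. 0)"
      by (rule L2inner_cong_AE[OF _ IH_uhat(1)[OF k]])
        (use L2_measurable[OF L2plus_L2[OF IH_L2plus(1)[OF \<gamma> f]]] L2_measurable[OF dL] in auto)
    then show ?thesis by simp
  qed
  then show "?d \<in> kerAdjH \<gamma>"
    using IH_uhat(2)[OF k] by (simp add: kerAdjH_def adjH_def)
  show "adjH \<gamma> (psiH \<gamma> n k) (\<lambda>z. of_real ?s * uhat \<gamma> n k z)"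
    unfolding PhiZ_eq_uhat[OF k, symmetric] adjH_def
    using PhiZ_L2[OF \<gamma> k] IH_inner_psiH[OF \<gamma>] by blast
qed

end

theorem theorem2p7:
  fixes \<gamma> :: real
  assumes "\<gamma> > -1"
  shows
    \<comment> \<open>(a) kernel of the adjoint\<close>
    "kerAdjH \<gamma> = cl_span (G_meas \<gamma>) (L2plus \<gamma>) {psiH \<gamma> n k | n k. k < 0 \<or> k > int n}
     \<and>
     \<comment> \<open>(b) SVD: uhat is an orthonormal basis of L2(D_H, x^(2 gamma+3) dV_H)\<close>
     (\<forall>n k. 0 \<le> k \<and> k \<le> int n \<longrightarrow> uhat \<gamma> n k \<in> L2 (D_meas \<gamma>))
     \<and> (\<forall>n k n' k'. 0 \<le> k \<and> k \<le> int n \<and> 0 \<le> k' \<and> k' \<le> int n' \<longrightarrow>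
          L2inner (D_meas \<gamma>) (uhat \<gamma> n k) (uhat \<gamma> n' k') = (if (n, k) = (n', k') then 1 else 0))
     \<and> cl_span (D_meas \<gamma>) (L2 (D_meas \<gamma>)) {uhat \<gamma> n k | n k. 0 \<le> k \<and> k \<le> int n} = L2 (D_meas \<gamma>)
     \<and>
     \<comment> \<open>the classes of psiH (0 \<le> k \<le> n) form an orthonormal basis of L2_+ / ker\<close>
     (\<forall>n k. 0 \<le> k \<and> k \<le> int n \<longrightarrow> psiH \<gamma> n k \<in> L2plus \<gamma>
          \<and> (\<forall>g \<in> kerAdjH \<gamma>. L2inner (G_meas \<gamma>) (psiH \<gamma> n k) g = 0))
     \<and> (\<forall>n k n' k'. 0 \<le> k \<and> k \<le> int n \<and> 0 \<le> k' \<and> k' \<le> int n' \<longrightarrow>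
          L2inner (G_meas \<gamma>) (psiH \<gamma> n k) (psiH \<gamma> n' k') = (if (n, k) = (n', k') then 1 else 0))
     \<and> cl_span (G_meas \<gamma>) (L2plus \<gamma>) ({psiH \<gamma> n k | n k. 0 \<le> k \<and> k \<le> int n} \<union> kerAdjH \<gamma>)
         = L2plus \<gamma>
     \<and>
     \<comment> \<open>singular values\<close>
     (\<forall>n k. 0 \<le> k \<and> k \<le> int n \<longrightarrow>
        (\<exists>\<sigma>::real. \<sigma> > 0 \<and> \<sigma>\<^sup>2 = sigma_sq \<gamma> n k
           \<and> (\<lambda>q. IH \<gamma> (uhat \<gamma> n k) q - of_real \<sigma> * psiH \<gamma> n k q) \<in> kerAdjH \<gamma>
           \<and> adjH \<gamma> (psiH \<gamma> n k) (\<lambda>z. of_real \<sigma> * uhat \<gamma> n k z)))"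
proof (intro conjI allI impI ballI; (elim conjE)?)
  show "kerAdjH \<gamma> = cl_span (G_meas \<gamma>) (L2plus \<gamma>) {psiH \<gamma> n k | n k. k < 0 \<or> k > int n}"
    by (rule kerAdjH_eq[OF assms])
  show "cl_span (D_meas \<gamma>) (L2 (D_meas \<gamma>)) {uhat \<gamma> n k | n k. 0 \<le> k \<and> k \<le> int n} = L2 (D_meas \<gamma>)"
    by (rule uhat_dense[OF assms])
  show "cl_span (G_meas \<gamma>) (L2plus \<gamma>) ({psiH \<gamma> n k | n k. 0 \<le> k \<and> k \<le> int n} \<union> kerAdjH \<gamma>) = L2plus \<gamma>"
    by (rule psiH_kerAdjH_dense[OF assms])
next
  fix n k assume k: "0 \<le> k" "k \<le> int n"
  show "uhat \<gamma> n k \<in> L2 (D_meas \<gamma>)" by (rule uhat_L2[OF assms k])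
  show "psiH \<gamma> n k \<in> L2plus \<gamma>" by (rule psiH_L2plus[OF assms])
  show "L2inner (G_meas \<gamma>) (psiH \<gamma> n k) g = 0" if "g \<in> kerAdjH \<gamma>" for g
    by (rule kerAdjH_inner_psiH[OF assms that k])
  show "\<exists>\<sigma>::real. \<sigma> > 0 \<and> \<sigma>\<^sup>2 = sigma_sq \<gamma> n k
     \<and> (\<lambda>q. IH \<gamma> (uhat \<gamma> n k) q - of_real \<sigma> * psiH \<gamma> n k q) \<in> kerAdjH \<gamma>
     \<and> adjH \<gamma> (psiH \<gamma> n k) (\<lambda>z. of_real \<sigma> * uhat \<gamma> n k z)"
    by (rule singular_values[OF assms k])
next
  fix n n' k k' assume k: "0 \<le> k" "k \<le> int n" "0 \<le> k'" "k' \<le> int n'"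
  show "L2inner (D_meas \<gamma>) (uhat \<gamma> n k) (uhat \<gamma> n' k') = (if (n, k) = (n', k') then 1 else 0)"
    by (rule uhat_orthonormal[OF assms k])
  show "L2inner (G_meas \<gamma>) (psiH \<gamma> n k) (psiH \<gamma> n' k') = (if (n, k) = (n', k') then 1 else 0)"
    by (rule psiH_orthonormal[OF assms])
qed

end
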